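(* Let $\mathcal{A}$ be diagonalizable with a Riesz basis of eigenvectors $(\varphi_n^i)_{(i,n)\in\{1,\dots,m\}\times\mathbb{N}^*}$ and eigenvalues $\lambda_n^i$ as described in the context, and assume that there are $(\alpha_1,\dots,\alpha_m)\in(1,+\infty)^m$ and $c,C>0$ such that for all $i\in\{1,\dots,m\}$ and all $n,p\in\mathbb{N}^*$ $$c\,n^{\alpha_i}\le|\lambda_n^i|+1\le C\,n^{\alpha_i},\qquad |\lambda_n^i-\lambda_p^i|\ge c\,n^{\alpha_i-1}|n-p|.$$ Let $(\gamma_1,\dots,\gamma_m)\in[0,(\alpha_1-1)/2)\times\cdots\times[0,(\alpha_m-1)/2)$, $r_i\in(1/2-\alpha_i+\gamma_i,\ \alpha_i-1/2-\gamma_i)$ for $i\in\{1,\dots,m\}$, $\vec\alpha=(\alpha_1,\dots,\alpha_m)$, $\vec r=(r_1,\dots,r_m)$, and $B=(B_1,\dots,B_m)\in\mathcal{H}_1^{-\alpha_1}\times\cdots\times\mathcal{H}_m^{-\alpha_m}$ such that there exist $c_1,c_2>0$ with $$c_1n^{r_i}\le|\langle B_i,\widetilde{\varphi_n}^i\rangle|\le c_2n^{r_i+\gamma_i},\qquad\forall n\in\mathbb{N}^*,\ i\in\{1,\dots,m\}.$$ Then for any $\mu>0$ there exists a bounded linear feedback $K\in\mathcal{L}(\mathcal{H}^{\vec\alpha/2-\vec r},\mathbb{C}^m)$ such that $K\in\mathcal{L}(\mathcal{H}^{1/2+\varepsilon-\vec r},\mathbb{C}^m)$ for any $\varepsilon>0$,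 where $1/2+\varepsilon-\vec r:=(1/2+\varepsilon-r_1,\dots,1/2+\varepsilon-r_m)$, and the system $\partial_tu=\mathcal{A}u+BK(u)$ is exponentially stable in $X$ with decay rate $\mu$.
   Context: $\mathbb{N}^*=\{1,2,\dots\}$. $(X,\langle\cdot,\cdot\rangle)$ is a complex Hilbert space and $\mathcal{A}:\mathcal{D}(\mathcal{A})\subset X\to X$, $\mathcal{D}(\mathcal{A})=\{f\in X:\mathcal{A}f\in X\}$, generates a $C^0$ semigroup with finite growth bound. $\mathcal{A}$ is diagonalizable: there is a Riesz basis of $X$ consisting of eigenvectors of $\mathcal{A}$, and the eigenvalues have bounded multiplicities; $m\in\mathbb{N}^*$ is the highest multiplicity. The basis is arranged as $(\varphi_n^i)_{(i,n)\in\{1,\dots,m\}\times\mathbb{N}^*}$ (a Riesz basis of $X$) with $\mathcal{A}\varphi_n^i=\lambda_n^i\varphi_n^i$ and $\lambda_n^i\ne\lambda_p^i$ for $n\ne p$; $X_i$ is the closed span of $(\varphi_n^i)_{n}$, so $X=X_1+\dots+X_m$. For $s\in\mathbb{R}$, $\mathcal{H}_i^s$ is the Hilbert space of (possibly formal) series $f=\sum_{n\in\mathbb{N}^*}f_n^i\varphi_n^i$ with $\|f\|_{\mathcal{H}_i^s}^2=\sum_nn^{2s}|f_n^i|^2<\infty$. For $\vec s=(s_1,\dots,s_m)\in\mathbb{R}^m$, $\mathcal{H}^{\vec s}=\mathcal{H}_1^{s_1}+\dots+\mathcal{H}_m^{s_m}$ with the corresponding Hilbert structure ($\mathcal{H}^{0}=X$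 with equivalent norms). $\mathcal{A}$ acts on these spaces coefficientwise by $\mathcal{A}\varphi_n^i=\lambda_n^i\varphi_n^i$. $(\widetilde{\varphi_n}^i)_n$ is the biorthogonal family of $(\varphi_n^i)_n$ in $X_i$, and for $f\in\mathcal{H}_i^s$ (any $s\in\mathbb{R}$), $\langle f,\widetilde{\varphi_n}^i\rangle=f_n^i$ is the coefficient of $f$ along $\varphi_n^i$. For $B=(B_1,\dots,B_m)$ and $K=(K_1,\dots,K_m)$ with scalar-valued $K_i$, $BK(u)=\sum_{i=1}^mB_iK_i(u)$. The system $\partial_tu=\mathcal{A}u+BK(u)$ is exponentially stable with decay rate $\mu>0$ in $X$ if $\mathcal{A}+BK$, with domain $\{f\in X:(\mathcal{A}+BK)f\in X\}$, generates a $C^0$ semigroup on $X$ and there is $C>0$ such that for every $u_0\in X$ the unique solution $u\in C^0([0,+\infty),X)$ with $u(0)=u_0$ satisfies $\|u(t)\|_X\le Ce^{-\mu t}\|u_0\|_X$ for all $t\ge0$. *)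

theory Defs
  imports "HOL-Analysis.Analysis"
begin

section \<open>Complex Hilbert spaces\<close>

text \<open>The inner product is linear in its first argument.\<close>

class complex_hilbert_space = banach +
  fixes scaleC :: "complex \<Rightarrow> 'a \<Rightarrow> 'a" (infixr "*\<^sub>C" 75)
    and cinner :: "'a \<Rightarrow> 'a \<Rightarrow> complex"
  assumes scaleC_add_right: "a *\<^sub>C (x + y) = a *\<^sub>C x + a *\<^sub>C y"
    and scaleC_add_left: "(a + b) *\<^sub>C x = a *\<^sub>C x + b *\<^sub>C x"
    and scaleC_scaleC: "a *\<^sub>C (b *\<^sub>C x) = (a * b) *\<^sub>C x"
    and scaleR_scaleC: "r *\<^sub>R x = complex_of_real r *\<^sub>C x"
    and cinner_commute: "cinner x y = cnj (cinner y x)"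
    and cinner_add_left: "cinner (x + y) z = cinner x z + cinner y z"
    and cinner_scaleC_left: "cinner (a *\<^sub>C x) y = a * cinner x y"
    and norm_eq_sqrt_cinner: "norm x = sqrt (Re (cinner x x))"

interpretation complex_vector:
  vector_space "scaleC :: complex \<Rightarrow> 'a \<Rightarrow> 'a::complex_hilbert_space"
proof
  fix x :: 'a
  have "1 *\<^sub>C x = (1::real) *\<^sub>R x"
    by (simp only: scaleR_scaleC of_real_1)
  then show "1 *\<^sub>C x = x" by simp
qed (simp_all add: scaleC_add_right scaleC_add_left scaleC_scaleC)

definition riesz_basis :: "'j set \<Rightarrow> ('j \<Rightarrow> 'a::complex_hilbert_space) \<Rightarrow> bool" where
  "riesz_basis J e \<longleftrightarrow>
     closure (complex_vector.span (e ` J)) = UNIV \<and>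
     (\<exists>c>0. \<exists>C>0. \<forall>F a. finite F \<and> F \<subseteq> J \<longrightarrow>
        c * (\<Sum>j\<in>F. (cmod (a j))\<^sup>2) \<le> (norm (\<Sum>j\<in>F. a j *\<^sub>C e j))\<^sup>2 \<and>
        (norm (\<Sum>j\<in>F. a j *\<^sub>C e j))\<^sup>2 \<le> C * (\<Sum>j\<in>F. (cmod (a j))\<^sup>2))"

section \<open>Semigroups and solutions\<close>

text \<open>An unbounded operator is given by its domain \<open>D\<close> and a total function \<open>A\<close>, of which only
  the values on \<open>D\<close> matter.  A semigroup is a function of a real time of which only
  the values at nonnegative times matter.\<close>

definition c0_semigroup :: "(real \<Rightarrow> 'a::complex_hilbert_space \<Rightarrow> 'a) \<Rightarrow> bool" where
  "c0_semigroup T \<longleftrightarrow>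
     (\<forall>t\<ge>0. bounded_linear (T t) \<and> (\<forall>c x. T t (c *\<^sub>C x) = c *\<^sub>C T t x)) \<and>
     T 0 = id \<and>
     (\<forall>s\<ge>0. \<forall>t\<ge>0. T (s + t) = T s \<circ> T t) \<and>
     (\<forall>x. ((\<lambda>t. T t x) \<longlongrightarrow> x) (at_right 0))"

definition generates ::
  "'a::complex_hilbert_space set \<Rightarrow> ('a \<Rightarrow> 'a) \<Rightarrow> (real \<Rightarrow> 'a \<Rightarrow> 'a) \<Rightarrow> bool" where
  "generates D A T \<longleftrightarrow> c0_semigroup T \<and>
     (\<forall>x y. x \<in> D \<and> A x = y \<longleftrightarrow> ((\<lambda>h. (T h x - x) /\<^sub>R h) \<longlongrightarrow> y) (at_right 0))"

definition growth_bound :: "(real \<Rightarrow> 'a::complex_hilbert_space \<Rightarrow> 'a) \<Rightarrow> ereal" where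
  "growth_bound T =
     Inf {ereal \<omega> | \<omega>. \<exists>M. \<forall>t\<ge>0. \<forall>x. norm (T t x) \<le> M * exp (\<omega> * t) * norm x}"

text \<open>Solutions with values in \<open>C\<^sup>0([0,\<infinity>), X)\<close> of \<open>u' = A u\<close> are understood in the mild
  (integrated) sense, since \<open>u\<close> need not take values in the domain.\<close>

definition mild_solution ::
  "'a::complex_hilbert_space set \<Rightarrow> ('a \<Rightarrow> 'a) \<Rightarrow> 'a \<Rightarrow> (real \<Rightarrow> 'a) \<Rightarrow> bool" where
  "mild_solution D A u0 u \<longleftrightarrow> continuous_on {0..} u \<and> u 0 = u0 \<and>
     (\<forall>t\<ge>0. integral {0..t} u \<in> D \<and> u t = u0 + A (integral {0..t} u))"

definition exponentially_stable ::
  "'a::complex_hilbert_space set \<Rightarrow> ('a \<Rightarrow> 'a) \<Rightarrow> real \<Rightarrow> bool" where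
  "exponentially_stable D A \<mu> \<longleftrightarrow> (\<exists>T. generates D A T) \<and>
     (\<exists>C>0. \<forall>u0. \<exists>u. mild_solution D A u0 u \<and>
        (\<forall>v. mild_solution D A u0 v \<longrightarrow> (\<forall>t\<ge>0. v t = u t)) \<and>
        (\<forall>t\<ge>0. norm (u t) \<le> C * exp (- \<mu> * t) * norm u0))"

section \<open>Formal series\<close>

text \<open>The index \<open>i\<close> ranges over a finite type \<open>'m\<close> with \<open>m = CARD('m)\<close> elements, and \<open>n\<close>
  over the positive naturals.  A formal series \<open>\<Sum>\<^sub>n f\<^sub>n \<phi>\<^sub>n\<^sup>i\<close> is the sequence \<open>f\<close> of its
  coefficients, normalised to vanish at the unused index \<open>0\<close>; hence the coefficient (the pairing
  of \<open>f\<close> with the \<open>n\<close>-th member of the biorthogonal family) is just \<open>f n\<close>.\<close>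

definition Hi :: "real \<Rightarrow> (nat \<Rightarrow> complex) set" where
  "Hi s = {f. f 0 = 0 \<and> (\<lambda>n. real n powr (2 * s) * (cmod (f n))\<^sup>2) summable_on {1..}}"

definition Hi_norm :: "real \<Rightarrow> (nat \<Rightarrow> complex) \<Rightarrow> real" where
  "Hi_norm s f = sqrt (\<Sum>\<^sub>\<infinity>n\<in>{1..}. real n powr (2 * s) * (cmod (f n))\<^sup>2)"

definition H :: "('m::finite \<Rightarrow> real) \<Rightarrow> ('m \<Rightarrow> nat \<Rightarrow> complex) set" where
  "H s = {f. \<forall>i. f i \<in> Hi (s i)}"

definition H_norm :: "('m::finite \<Rightarrow> real) \<Rightarrow> ('m \<Rightarrow> nat \<Rightarrow> complex) \<Rightarrow> real" where
  "H_norm s f = sqrt (\<Sum>i\<in>UNIV. (Hi_norm (s i) (f i))\<^sup>2)"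

definition bounded_linear_on_H ::
  "('m::finite \<Rightarrow> real) \<Rightarrow> (('m \<Rightarrow> nat \<Rightarrow> complex) \<Rightarrow> complex ^ 'm) \<Rightarrow> bool" where
  "bounded_linear_on_H s K \<longleftrightarrow>
     (\<forall>f\<in>H s. \<forall>g\<in>H s. K (\<lambda>i n. f i n + g i n) = K f + K g) \<and>
     (\<forall>c. \<forall>f\<in>H s. K (\<lambda>i n. c * f i n) = c *s K f) \<and>
     (\<exists>M. \<forall>f\<in>H s. norm (K f) \<le> M * H_norm s f)"

text \<open>For a Riesz basis \<open>\<phi>\<close>, the space \<open>X\<close> is identified with \<open>H (\<lambda>_. 0)\<close> through the mutually
  inverse maps \<open>coeffs \<phi>\<close> and \<open>series \<phi>\<close>.\<close>

definition coeffs ::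
  "('m::finite \<Rightarrow> nat \<Rightarrow> 'a::complex_hilbert_space) \<Rightarrow> 'a \<Rightarrow> 'm \<Rightarrow> nat \<Rightarrow> complex" where
  "coeffs \<phi> x = (THE f. f \<in> H (\<lambda>_. 0) \<and>
     ((\<lambda>(i, n). f i n *\<^sub>C \<phi> i n) has_sum x) (UNIV \<times> {1..}))"

definition series ::
  "('m::finite \<Rightarrow> nat \<Rightarrow> 'a::complex_hilbert_space) \<Rightarrow> ('m \<Rightarrow> nat \<Rightarrow> complex) \<Rightarrow> 'a" where
  "series \<phi> f = (\<Sum>\<^sub>\<infinity>(i, n)\<in>UNIV \<times> {1..}. f i n *\<^sub>C \<phi> i n)"

section \<open>The diagonalizable operator and the closed loop\<close>

definition diag_op ::
  "('m::finite \<Rightarrow> nat \<Rightarrow> complex) \<Rightarrow> ('m \<Rightarrow> nat \<Rightarrow> complex) \<Rightarrow> 'm \<Rightarrow> nat \<Rightarrow> complex" where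
  "diag_op lam f = (\<lambda>i n. lam i n * f i n)"

definition eigenspace ::
  "'a::complex_hilbert_space set \<Rightarrow> ('a \<Rightarrow> 'a) \<Rightarrow> complex \<Rightarrow> 'a set" where
  "eigenspace D A z = {x \<in> D. A x = z *\<^sub>C x}"

text \<open>The last two conjuncts say that \<open>CARD('m)\<close> is the highest multiplicity; the former also
  excludes eigenspaces of infinite dimension, for which \<open>dim\<close> is \<open>0\<close>.\<close>

definition diagonalizable ::
  "'a::complex_hilbert_space set \<Rightarrow> ('a \<Rightarrow> 'a) \<Rightarrow>
   ('m::finite \<Rightarrow> nat \<Rightarrow> 'a) \<Rightarrow> ('m \<Rightarrow> nat \<Rightarrow> complex) \<Rightarrow> bool" where
  "diagonalizable D A \<phi> lam \<longleftrightarrow>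
     riesz_basis (UNIV \<times> {1..}) (\<lambda>(i, n). \<phi> i n) \<and>
     (\<forall>i. \<forall>n\<ge>1. \<phi> i n \<in> eigenspace D A (lam i n)) \<and>
     (\<forall>i. \<forall>n\<ge>1. \<forall>p\<ge>1. n \<noteq> p \<longrightarrow> lam i n \<noteq> lam i p) \<and>
     D = {x. diag_op lam (coeffs \<phi> x) \<in> H (\<lambda>_. 0)} \<and>
     (\<forall>z. \<exists>S. finite S \<and> card S \<le> CARD('m) \<and> eigenspace D A z \<subseteq> complex_vector.span S) \<and>
     (\<exists>z. complex_vector.dim (eigenspace D A z) = CARD('m))"

text \<open>The formal series \<open>(A + B K) f\<close>, where \<open>B\<^sub>i\<close> has the coefficients \<open>B i\<close>.\<close>

definition closed_loop_coeffs ::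
  "('m::finite \<Rightarrow> nat \<Rightarrow> complex) \<Rightarrow> ('m \<Rightarrow> nat \<Rightarrow> complex) \<Rightarrow>
   (('m \<Rightarrow> nat \<Rightarrow> complex) \<Rightarrow> complex ^ 'm) \<Rightarrow>
   ('m \<Rightarrow> nat \<Rightarrow> complex) \<Rightarrow> 'm \<Rightarrow> nat \<Rightarrow> complex" where
  "closed_loop_coeffs lam B K f = (\<lambda>i n. diag_op lam f i n + B i n * (K f $ i))"

text \<open>The domain \<open>{f \<in> X. (A + B K) f \<in> X}\<close>, where \<open>V\<close> is the space on which \<open>K\<close> is defined
  (a total function in the logic, so \<open>V\<close> has to be given explicitly).\<close>

definition closed_loop_domain ::
  "('m::finite \<Rightarrow> nat \<Rightarrow> 'a::complex_hilbert_space) \<Rightarrow> ('m \<Rightarrow> nat \<Rightarrow> complex) \<Rightarrow>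
   ('m \<Rightarrow> nat \<Rightarrow> complex) \<Rightarrow> ('m \<Rightarrow> nat \<Rightarrow> complex) set \<Rightarrow>
   (('m \<Rightarrow> nat \<Rightarrow> complex) \<Rightarrow> complex ^ 'm) \<Rightarrow> 'a set" where
  "closed_loop_domain \<phi> lam B V K =
     {x. coeffs \<phi> x \<in> V \<and> closed_loop_coeffs lam B K (coeffs \<phi> x) \<in> H (\<lambda>_. 0)}"

definition closed_loop_op ::
  "('m::finite \<Rightarrow> nat \<Rightarrow> 'a::complex_hilbert_space) \<Rightarrow> ('m \<Rightarrow> nat \<Rightarrow> complex) \<Rightarrow>
   ('m \<Rightarrow> nat \<Rightarrow> complex) \<Rightarrow> (('m \<Rightarrow> nat \<Rightarrow> complex) \<Rightarrow> complex ^ 'm) \<Rightarrow> 'a \<Rightarrow> 'a" where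
  "closed_loop_op \<phi> lam B K x = series \<phi> (closed_loop_coeffs lam B K (coeffs \<phi> x))"

end

theory Submission
  imports Defs
begin

text \<open>The feedback is found by pole placement.  Let the \<open>i\<close>-th component of \<open>K u\<close> depend on the \<open>i\<close>-th
component of \<open>u\<close> only; then the closed loop splits into systems with a single input \<open>b\<close> and a
diagonal operator with simple eigenvalues \<open>\<lambda> n\<close>.  For a feedback \<open>f \<mapsto> \<Sum>n. k n * f n\<close> the eigenvalues
of such a closed loop are the zeros of \<open>1 - (\<Sum>n. k n * b n / (z - \<lambda> n))\<close>.  Prescribe them to be
\<open>\<nu> n = \<lambda> n - m\<close>, where \<open>m\<close> is so large that \<open>Re (\<nu> n) \<le> - \<mu>\<close> (the real parts of the \<open>\<lambda> n\<close> are bounded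
since the open loop generates a semigroup), and generic, so that no \<open>\<nu> n\<close> is a \<open>\<lambda> p\<close>.  Then
\<open>- k n * b n\<close> must be the residue at \<open>\<lambda> n\<close> of \<open>\<Prod>q. (z - \<nu> q) / (z - \<lambda> q)\<close>.  The gap condition
implies \<open>|\<lambda> n - \<lambda> p| \<ge> c |n - p| powr \<alpha>\<close> with \<open>\<alpha> > 1\<close>, which bounds these residues uniformly.  Hence
\<open>|k n| \<le> M * n powr (- r)\<close>, and this makes \<open>K\<close> continuous on \<open>H\<close> with exponents
\<open>1/2 + \<epsilon> - r\<close>.

The eigenvectors of the closed loop, written in the eigenvectors of the open loop, form up to
diagonal factors the Cauchy matrix \<open>1 / (\<lambda> p - \<nu> n)\<close>.  Its inverse is explicit, and the two relations
between a Cauchy matrix and its inverse are partial fraction identities, which pass from finite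
sections to the limit by dominated convergence (\<open>interlacing.w_sum\<close> and its companions).  Both matrices
are bounded on \<open>l2\<close> by the Schur test with weight \<open>n powr (-1/2)\<close>; the bounds on \<open>r\<close> are
precisely what the test requires (\<open>kernel_schur\<close>).  So the eigenvectors of the closed loop form a
Riesz basis.

In the coordinates of that basis the closed loop acts as multiplication by \<open>\<nu>\<close>
(\<open>single_input.X_diagonalises\<close>).  That it has the full domain of the multiplication operator follows
from a solution of the resolvent equation in closed form (\<open>multi_input.domain_eq\<close>).  An operator that is
diagonal in a Riesz basis with \<open>Re (\<nu> n) \<le> - \<mu>\<close> generates the semigroup of multiplications by
\<open>exp (\<nu> n * t)\<close>, whose orbits are the only mild solutions and decay like \<open>exp (- \<mu> * t)\<close>
(\<open>diagonalised.exponentially_stable\<close>).\<close>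

section \<open>Infinite sums and square summable families\<close>

lemma bounded_sums_imp_summable_on:
  fixes f :: "'j \<Rightarrow> real"
  assumes "\<And>j. j \<in> I \<Longrightarrow> 0 \<le> f j" and "\<And>F. finite F \<Longrightarrow> F \<subseteq> I \<Longrightarrow> sum f F \<le> M"
  shows "f summable_on I" and "infsum f I \<le> M"
proof -
  show *: "f summable_on I"
    by (rule nonneg_bdd_above_summable_on) (use assms in \<open>auto intro!: bdd_aboveI2\<close>)
  show "infsum f I \<le> M"
    by (rule infsum_le_finite_sums[OF *]) (use assms in auto)
qed

lemma infsum_dominated_tendsto:
  fixes f :: "'b \<Rightarrow> 'j \<Rightarrow> 'c::banach"
  assumes G: "G summable_on J"
    and dom: "\<forall>\<^sub>F x in F. \<forall>j\<in>J. norm (f x j) \<le> G j"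
    and lim: "\<And>j. j \<in> J \<Longrightarrow> ((\<lambda>x. f x j) \<longlongrightarrow> g j) F"
    and [simp]: "F \<noteq> bot"
  shows "((\<lambda>x. infsum (f x) J) \<longlongrightarrow> infsum g J) F"
proof (rule tendstoI)
  fix e :: real assume "e > 0"
  have gG: "norm (g j) \<le> G j" if "j \<in> J" for j
  proof (rule tendsto_upperbound)
    show "((\<lambda>x. norm (f x j)) \<longlongrightarrow> norm (g j)) F" using lim[OF that] by (rule tendsto_norm)
    show "\<forall>\<^sub>F x in F. norm (f x j) \<le> G j" using dom by eventually_elim (use that in auto)
  qed simp
  obtain S where S: "finite S" "S \<subseteq> J" "dist (sum G S) (infsum G J) \<le> e/4"
    using infsum_finite_approximation[OF G, of "e/4"] \<open>e > 0\<close> by auto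
  have tail: "norm (infsum h J - sum h S) \<le> e/4" if h: "\<And>j. j \<in> J \<Longrightarrow> norm (h j) \<le> G j"
    for h :: "'j \<Rightarrow> 'c"
  proof -
    have GS: "G summable_on (J - S)" using G by (rule summable_on_subset_banach) auto
    have hs: "(\<lambda>j. norm (h j)) summable_on J" by (rule Infinite_Sum.abs_summable_on_comparison_test'[OF G h])
    have hS: "(\<lambda>j. norm (h j)) summable_on (J - S)"
      by (rule Infinite_Sum.abs_summable_on_comparison_test'[OF GS]) (use h in auto)
    have fin: "h summable_on S" "G summable_on S" using S by auto
    have "infsum h J = infsum h (S \<union> (J - S))" using S by (metis Diff_partition)
    also have "\<dots> = sum h S + infsum h (J - S)"
      by (subst infsum_Un_disjoint) (use S hS in \<open>auto intro: Infinite_Sum.abs_summable_summable\<close>)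
    finally have 1: "infsum h J - sum h S = infsum h (J - S)" by simp
    have "infsum G J = infsum G (S \<union> (J - S))" using S by (metis Diff_partition)
    also have "\<dots> = sum G S + infsum G (J - S)"
      by (subst infsum_Un_disjoint) (use S GS in auto)
    finally have 2: "infsum G J - sum G S = infsum G (J - S)" by simp
    have "norm (infsum h (J - S)) \<le> infsum (\<lambda>j. norm (h j)) (J - S)"
      by (rule norm_infsum_bound[OF hS])
    also have "\<dots> \<le> infsum G (J - S)" by (rule infsum_mono[OF hS GS]) (use h in auto)
    also have "\<dots> \<le> e/4" using S(3) unfolding 2[symmetric] dist_real_def by linarith
    finally show ?thesis using 1 by simp
  qed
  have "((\<lambda>x. sum (f x) S) \<longlongrightarrow> sum g S) F"
    by (rule tendsto_sum) (use S lim in auto)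
  then have "\<forall>\<^sub>F x in F. dist (sum (f x) S) (sum g S) < e/4"
    by (rule tendstoD) (use \<open>e > 0\<close> in auto)
  with dom show "\<forall>\<^sub>F x in F. dist (infsum (f x) J) (infsum g J) < e"
  proof eventually_elim
    case (elim x)
    have 1: "norm (infsum (f x) J - sum (f x) S) \<le> e/4" by (rule tail) (use elim in auto)
    have 2: "norm (infsum g J - sum g S) \<le> e/4" by (rule tail) (use gG in auto)
    have "infsum (f x) J - infsum g J =
      (infsum (f x) J - sum (f x) S) + (sum (f x) S - sum g S) - (infsum g J - sum g S)" by simp
    also have "norm \<dots> \<le> norm (infsum (f x) J - sum (f x) S) + norm (sum (f x) S - sum g S)
         + norm (infsum g J - sum g S)"
      by (meson add_mono norm_triangle_ineq norm_triangle_ineq4 order.refl order_trans)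
    also have "\<dots> < e" using 1 2 elim \<open>e > 0\<close> by (simp add: dist_norm)
    finally show ?case by (simp add: dist_norm)
  qed
qed

definition l2 :: "'j set \<Rightarrow> ('j \<Rightarrow> complex) \<Rightarrow> bool" where
  "l2 I f \<longleftrightarrow> (\<lambda>j. (cmod (f j))\<^sup>2) summable_on I"

definition sqsum :: "'j set \<Rightarrow> ('j \<Rightarrow> complex) \<Rightarrow> real" where
  "sqsum I f = (\<Sum>\<^sub>\<infinity>j\<in>I. (cmod (f j))\<^sup>2)"

lemma l2_boundedI:
  assumes "\<And>F. finite F \<Longrightarrow> F \<subseteq> I \<Longrightarrow> (\<Sum>j\<in>F. (cmod (f j))\<^sup>2) \<le> M"
  shows "l2 I f" and "sqsum I f \<le> M"
  unfolding l2_def sqsum_def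
  using bounded_sums_imp_summable_on[of I "\<lambda>j. (cmod (f j))\<^sup>2" M] assms by auto

lemma sqsum_nonneg [simp]: "0 \<le> sqsum I f"
  unfolding sqsum_def by (rule infsum_nonneg) auto

lemma l2_finite_le: "l2 I f \<Longrightarrow> finite F \<Longrightarrow> F \<subseteq> I \<Longrightarrow> (\<Sum>j\<in>F. (cmod (f j))\<^sup>2) \<le> sqsum I f"
  unfolding l2_def sqsum_def by (rule finite_sum_le_infsum) auto

lemma l2_component_le: "l2 I f \<Longrightarrow> j \<in> I \<Longrightarrow> (cmod (f j))\<^sup>2 \<le> sqsum I f"
  using l2_finite_le[of I f "{j}"] by auto

lemma l2_comparison:
  assumes "l2 I g" and "\<And>j. j \<in> I \<Longrightarrow> cmod (f j) \<le> M * cmod (g j)"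
  shows "l2 I f" and "sqsum I f \<le> M\<^sup>2 * sqsum I g"
proof -
  have "(\<Sum>j\<in>F. (cmod (f j))\<^sup>2) \<le> M\<^sup>2 * sqsum I g" if "finite F" "F \<subseteq> I" for F
  proof -
    have "(\<Sum>j\<in>F. (cmod (f j))\<^sup>2) \<le> (\<Sum>j\<in>F. (M * cmod (g j))\<^sup>2)"
      by (intro sum_mono power_mono) (use assms that in auto)
    also have "\<dots> = M\<^sup>2 * (\<Sum>j\<in>F. (cmod (g j))\<^sup>2)"
      by (simp add: power_mult_distrib sum_distrib_left)
    also have "\<dots> \<le> M\<^sup>2 * sqsum I g"
      by (intro mult_left_mono l2_finite_le) (use assms that in auto)
    finally show ?thesis .
  qed
  from l2_boundedI[OF this] show "l2 I f" and "sqsum I f \<le> M\<^sup>2 * sqsum I g" by auto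
qed

lemma l2_cong: "(\<And>j. j \<in> I \<Longrightarrow> f j = g j) \<Longrightarrow> l2 I f \<longleftrightarrow> l2 I g"
  unfolding l2_def by (rule summable_on_cong) auto

lemma sqsum_cong: "(\<And>j. j \<in> I \<Longrightarrow> f j = g j) \<Longrightarrow> sqsum I f = sqsum I g"
  unfolding sqsum_def by (rule infsum_cong) auto

lemma l2_scale: "l2 I f \<Longrightarrow> l2 I (\<lambda>j. a * f j)"
  by (rule l2_comparison(1)[of I f _ "cmod a"]) (auto simp: norm_mult)

lemma l2_add:
  assumes "l2 I f" "l2 I g"
  shows "l2 I (\<lambda>j. f j + g j)"
proof (rule l2_boundedI(1))
  fix F assume F: "finite F" "F \<subseteq> I"
  have *: "(cmod (f j + g j))\<^sup>2 \<le> 2 * (cmod (f j))\<^sup>2 + 2 * (cmod (g j))\<^sup>2" for j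
  proof -
    have "(cmod (f j + g j))\<^sup>2 \<le> (cmod (f j) + cmod (g j))\<^sup>2"
      by (intro power_mono norm_triangle_ineq) auto
    also have "\<dots> \<le> 2 * (cmod (f j))\<^sup>2 + 2 * (cmod (g j))\<^sup>2"
      using sum_squares_bound[of "cmod (f j)" "cmod (g j)"] by (simp add: power2_sum)
    finally show ?thesis .
  qed
  have "(\<Sum>j\<in>F. (cmod (f j + g j))\<^sup>2) \<le> (\<Sum>j\<in>F. 2 * (cmod (f j))\<^sup>2 + 2 * (cmod (g j))\<^sup>2)"
    by (intro sum_mono *)
  also have "\<dots> = 2 * (\<Sum>j\<in>F. (cmod (f j))\<^sup>2) + 2 * (\<Sum>j\<in>F. (cmod (g j))\<^sup>2)"
    by (simp add: sum.distrib sum_distrib_left)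
  also have "\<dots> \<le> 2 * sqsum I f + 2 * sqsum I g"
    using l2_finite_le[OF assms(1) F] l2_finite_le[OF assms(2) F] by simp
  finally show "(\<Sum>j\<in>F. (cmod (f j + g j))\<^sup>2) \<le> 2 * sqsum I f + 2 * sqsum I g" .
qed

lemma l2_diff: "l2 I f \<Longrightarrow> l2 I g \<Longrightarrow> l2 I (\<lambda>j. f j - g j)"
  using l2_add[of I f "\<lambda>j. -1 * g j"] l2_scale[of I g "-1"] by simp

lemma l2_mult_summable:
  assumes "l2 I f" "l2 I g"
  shows "(\<lambda>j. cmod (f j) * cmod (g j)) summable_on I"
    and "(\<Sum>\<^sub>\<infinity>j\<in>I. cmod (f j) * cmod (g j)) \<le> sqrt (sqsum I f) * sqrt (sqsum I g)"
proof -
  have "(\<Sum>j\<in>F. cmod (f j) * cmod (g j)) \<le> sqrt (sqsum I f) * sqrt (sqsum I g)"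
    if "finite F" "F \<subseteq> I" for F
  proof -
    have "(\<Sum>j\<in>F. cmod (f j) * cmod (g j)) \<le> L2_set (\<lambda>j. cmod (f j)) F * L2_set (\<lambda>j. cmod (g j)) F"
      using L2_set_mult_ineq[of "\<lambda>j. cmod (f j)" "\<lambda>j. cmod (g j)" F] by simp
    also have "\<dots> \<le> sqrt (sqsum I f) * sqrt (sqsum I g)"
      unfolding L2_set_def
      by (intro mult_mono real_sqrt_le_mono l2_finite_le that assms) (auto intro: sum_nonneg)
    finally show ?thesis .
  qed
  from bounded_sums_imp_summable_on[of I "\<lambda>j. cmod (f j) * cmod (g j)", OF _ this]
  show "(\<lambda>j. cmod (f j) * cmod (g j)) summable_on I"
    and "(\<Sum>\<^sub>\<infinity>j\<in>I. cmod (f j) * cmod (g j)) \<le> sqrt (sqsum I f) * sqrt (sqsum I g)"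
    by auto
qed

section \<open>The Schur test\<close>

text \<open>The hypothesis of Schur's test with the weight \<open>w\<close>.  It is stated for finite sums, which
carries the convergence of the rows and columns along with the bound; rows and columns get the
same weight, since \<open>n powr (-1/2)\<close> works for both in the application.\<close>

definition schur :: "'j set \<Rightarrow> ('j \<Rightarrow> real) \<Rightarrow> real \<Rightarrow> ('j \<Rightarrow> 'j \<Rightarrow> complex) \<Rightarrow> bool" where
  "schur I w M A \<longleftrightarrow> 0 \<le> M \<and> (\<forall>p\<in>I. 0 < w p \<and> (\<forall>F. finite F \<and> F \<subseteq> I \<longrightarrow>
     (\<Sum>n\<in>F. cmod (A p n) * w n) \<le> M * w p \<and> (\<Sum>n\<in>F. cmod (A n p) * w n) \<le> M * w p))"

definition mat_app :: "'j set \<Rightarrow> ('j \<Rightarrow> 'j \<Rightarrow> complex) \<Rightarrow> ('j \<Rightarrow> complex) \<Rightarrow> 'j \<Rightarrow> complex" where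
  "mat_app I A x p = (\<Sum>\<^sub>\<infinity>n\<in>I. A p n * x n)"

text \<open>Cauchy--Schwarz in the form
  \<open>(\<Sum> |A p n| |x n|)\<^sup>2 \<le> (\<Sum> |A p n| w n) (\<Sum> |A p n| |x n|\<^sup>2 / w n)\<close> reduces the square sum over the
  rows to the two weighted sums.\<close>

lemma schur_finite:
  assumes A: "schur I w M A" and P: "finite P" "P \<subseteq> I" and F: "finite F" "F \<subseteq> I"
  shows "(\<Sum>p\<in>P. (\<Sum>n\<in>F. cmod (A p n) * cmod (x n))\<^sup>2) \<le> M\<^sup>2 * (\<Sum>n\<in>F. (cmod (x n))\<^sup>2)"
proof -
  have w: "w n > 0" if "n \<in> I" for n using A that by (auto simp: schur_def)
  have w0: "w n \<ge> 0" if "n \<in> I" for n using w[OF that] by simp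
  have M: "M \<ge> 0" using A by (auto simp: schur_def)
  have row: "(\<Sum>n\<in>F. cmod (A p n) * cmod (x n))\<^sup>2
       \<le> M * w p * (\<Sum>n\<in>F. cmod (A p n) * (cmod (x n))\<^sup>2 / w n)" if "p \<in> P" for p
  proof -
    have eq: "(\<Sum>n\<in>F. cmod (A p n) * cmod (x n)) =
        (\<Sum>n\<in>F. sqrt (cmod (A p n) * w n) * sqrt (cmod (A p n) * (cmod (x n))\<^sup>2 / w n))"
    proof (rule sum.cong[OF refl])
      fix n assume "n \<in> F"
      then have "w n > 0" using w F by auto
      then show "cmod (A p n) * cmod (x n) =
          sqrt (cmod (A p n) * w n) * sqrt (cmod (A p n) * (cmod (x n))\<^sup>2 / w n)"
        by (simp add: real_sqrt_mult real_sqrt_divide)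
    qed
    have "(\<Sum>n\<in>F. cmod (A p n) * cmod (x n))\<^sup>2 \<le>
        (\<Sum>n\<in>F. (sqrt (cmod (A p n) * w n))\<^sup>2) *
        (\<Sum>n\<in>F. (sqrt (cmod (A p n) * (cmod (x n))\<^sup>2 / w n))\<^sup>2)"
      unfolding eq by (rule Cauchy_Schwarz_ineq_sum)
    also have "\<dots> = (\<Sum>n\<in>F. cmod (A p n) * w n) * (\<Sum>n\<in>F. cmod (A p n) * (cmod (x n))\<^sup>2 / w n)"
      by (intro arg_cong2[where f="(*)"] sum.cong refl; subst real_sqrt_pow2)
         (use w0 F in \<open>auto intro!: mult_nonneg_nonneg divide_nonneg_nonneg\<close>)
    also have "\<dots> \<le> M * w p * (\<Sum>n\<in>F. cmod (A p n) * (cmod (x n))\<^sup>2 / w n)"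
      by (intro mult_right_mono sum_nonneg)
         (use A P F that w0 in \<open>auto simp: schur_def intro!: divide_nonneg_nonneg\<close>)
    finally show ?thesis .
  qed
  have "(\<Sum>p\<in>P. (\<Sum>n\<in>F. cmod (A p n) * cmod (x n))\<^sup>2)
      \<le> (\<Sum>p\<in>P. M * w p * (\<Sum>n\<in>F. cmod (A p n) * (cmod (x n))\<^sup>2 / w n))"
    by (intro sum_mono row)
  also have "\<dots> = (\<Sum>p\<in>P. \<Sum>n\<in>F. M * ((cmod (x n))\<^sup>2 / w n) * (cmod (A p n) * w p))"
    by (simp add: sum_distrib_left field_simps)
  also have "\<dots> = (\<Sum>n\<in>F. M * ((cmod (x n))\<^sup>2 / w n) * (\<Sum>p\<in>P. cmod (A p n) * w p))"
    by (subst sum.swap) (simp add: sum_distrib_left)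
  also have "\<dots> \<le> (\<Sum>n\<in>F. M * ((cmod (x n))\<^sup>2 / w n) * (M * w n))"
    by (intro sum_mono mult_left_mono)
       (use A P F w0 M in \<open>auto simp: schur_def intro!: mult_nonneg_nonneg divide_nonneg_nonneg\<close>)
  also have "\<dots> = M\<^sup>2 * (\<Sum>n\<in>F. (cmod (x n))\<^sup>2)"
    unfolding sum_distrib_left
  proof (rule sum.cong[OF refl])
    fix n assume "n \<in> F"
    then have "w n > 0" using w F by auto
    then show "M * ((cmod (x n))\<^sup>2 / w n) * (M * w n) = M\<^sup>2 * (cmod (x n))\<^sup>2"
      by (simp add: power2_eq_square)
  qed
  finally show ?thesis .
qed

lemma schur_row_summable:
  assumes A: "schur I w M A" and x: "l2 I x" and p: "p \<in> I"
  shows "(\<lambda>n. cmod (A p n) * cmod (x n)) summable_on I"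
proof (rule bounded_sums_imp_summable_on(1))
  fix F assume F: "finite F" "F \<subseteq> I"
  have "(\<Sum>n\<in>F. cmod (A p n) * cmod (x n))\<^sup>2 \<le> M\<^sup>2 * (\<Sum>n\<in>F. (cmod (x n))\<^sup>2)"
    using schur_finite[OF A, of "{p}" F x] p F by auto
  also have "\<dots> \<le> M\<^sup>2 * sqsum I x" by (intro mult_left_mono l2_finite_le x F) auto
  finally show "(\<Sum>n\<in>F. cmod (A p n) * cmod (x n)) \<le> sqrt (M\<^sup>2 * sqsum I x)"
    by (rule real_le_rsqrt)
qed auto

lemma schur_abs_bound:
  assumes A: "schur I w M A" and x: "l2 I x"
  defines "y \<equiv> \<lambda>p. complex_of_real (\<Sum>\<^sub>\<infinity>n\<in>I. cmod (A p n) * cmod (x n))"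
  shows "l2 I y" and "sqsum I y \<le> M\<^sup>2 * sqsum I x"
proof -
  have "(\<Sum>p\<in>P. (cmod (y p))\<^sup>2) \<le> M\<^sup>2 * sqsum I x" if P: "finite P" "P \<subseteq> I" for P
  proof (rule tendsto_upperbound)
    show "((\<lambda>F. \<Sum>p\<in>P. (\<Sum>n\<in>F. cmod (A p n) * cmod (x n))\<^sup>2) \<longlongrightarrow> (\<Sum>p\<in>P. (cmod (y p))\<^sup>2))
        (finite_subsets_at_top I)"
    proof (intro tendsto_sum)
      fix p assume "p \<in> P"
      then have "(\<lambda>n. cmod (A p n) * cmod (x n)) summable_on I"
        using schur_row_summable[OF A x] P by auto
      then have "(sum (\<lambda>n. cmod (A p n) * cmod (x n)) \<longlongrightarrow> (\<Sum>\<^sub>\<infinity>n\<in>I. cmod (A p n) * cmod (x n)))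
          (finite_subsets_at_top I)"
        by (rule infsum_tendsto)
      from tendsto_power[OF this, of 2]
      show "((\<lambda>F. (\<Sum>n\<in>F. cmod (A p n) * cmod (x n))\<^sup>2) \<longlongrightarrow> (cmod (y p))\<^sup>2) (finite_subsets_at_top I)"
        by (simp add: y_def)
    qed
    show "\<forall>\<^sub>F F in finite_subsets_at_top I.
        (\<Sum>p\<in>P. (\<Sum>n\<in>F. cmod (A p n) * cmod (x n))\<^sup>2) \<le> M\<^sup>2 * sqsum I x"
    proof (rule eventually_finite_subsets_at_top_weakI)
      fix F assume F: "finite F" "F \<subseteq> I"
      have "(\<Sum>p\<in>P. (\<Sum>n\<in>F. cmod (A p n) * cmod (x n))\<^sup>2) \<le> M\<^sup>2 * (\<Sum>n\<in>F. (cmod (x n))\<^sup>2)"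
        by (rule schur_finite[OF A P F])
      also have "\<dots> \<le> M\<^sup>2 * sqsum I x" by (intro mult_left_mono l2_finite_le x F) auto
      finally show "(\<Sum>p\<in>P. (\<Sum>n\<in>F. cmod (A p n) * cmod (x n))\<^sup>2) \<le> M\<^sup>2 * sqsum I x" .
    qed
  qed simp
  from l2_boundedI[OF this] show "l2 I y" and "sqsum I y \<le> M\<^sup>2 * sqsum I x" by auto
qed

lemma schur_mat_app_summable:
  assumes "schur I w M A" "l2 I x" "p \<in> I"
  shows "(\<lambda>n. cmod (A p n * x n)) summable_on I" and "(\<lambda>n. A p n * x n) summable_on I"
proof -
  show *: "(\<lambda>n. cmod (A p n * x n)) summable_on I"
    using schur_row_summable[OF assms] by (simp add: norm_mult)
  show "(\<lambda>n. A p n * x n) summable_on I" using Infinite_Sum.abs_summable_summable[OF *] .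
qed

lemma schur_l2:
  assumes A: "schur I w M A" and x: "l2 I x"
  shows "l2 I (mat_app I A x)" and "sqsum I (mat_app I A x) \<le> M\<^sup>2 * sqsum I x"
proof -
  define y where "y = (\<lambda>p. complex_of_real (\<Sum>\<^sub>\<infinity>n\<in>I. cmod (A p n) * cmod (x n)))"
  have le: "cmod (mat_app I A x p) \<le> 1 * cmod (y p)" if "p \<in> I" for p
  proof -
    have "cmod (mat_app I A x p) \<le> (\<Sum>\<^sub>\<infinity>n\<in>I. cmod (A p n * x n))"
      unfolding mat_app_def by (rule norm_infsum_bound[OF schur_mat_app_summable(1)[OF A x that]])
    also have "\<dots> = (\<Sum>\<^sub>\<infinity>n\<in>I. cmod (A p n) * cmod (x n))" by (simp add: norm_mult)
    also have "\<dots> \<le> 1 * cmod (y p)" by (simp add: y_def)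
    finally show ?thesis .
  qed
  have y: "l2 I y" "sqsum I y \<le> M\<^sup>2 * sqsum I x"
    using schur_abs_bound[OF A x] unfolding y_def by auto
  show "l2 I (mat_app I A x)" by (rule l2_comparison(1)[OF y(1) le])
  have "sqsum I (mat_app I A x) \<le> 1\<^sup>2 * sqsum I y" by (rule l2_comparison(2)[OF y(1) le])
  with y(2) show "sqsum I (mat_app I A x) \<le> M\<^sup>2 * sqsum I x" by simp
qed

lemma mat_app_add:
  assumes "schur I w M A" "l2 I x" "l2 I y" "p \<in> I"
  shows "mat_app I A (\<lambda>n. x n + y n) p = mat_app I A x p + mat_app I A y p"
  unfolding mat_app_def
  by (simp add: distrib_left infsum_add schur_mat_app_summable(2)[OF assms(1) _ assms(4)] assms)

lemma mat_app_scale: "mat_app I A (\<lambda>n. a * x n) p = a * mat_app I A x p"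
proof -
  have "(\<lambda>n. A p n * (a * x n)) = (\<lambda>n. a * (A p n * x n))" by (simp add: algebra_simps)
  then show ?thesis unfolding mat_app_def by (simp add: infsum_cmult_right')
qed

text \<open>Fubini is applicable because the absolute values of the entries again satisfy the Schur test: the
inner sums of \<open>|B n m| |x m|\<close> form a square summable family, on which a row of \<open>|A|\<close> converges.\<close>

lemma mat_app_inverse:
  assumes A: "schur I w M A" and B: "schur I w' M' B" and x: "l2 I x"
    and AB: "\<And>p q. p \<in> I \<Longrightarrow> q \<in> I \<Longrightarrow> (\<Sum>\<^sub>\<infinity>n\<in>I. A p n * B n q) = (if p = q then 1 else 0)"
    and p: "p \<in> I"
  shows "mat_app I A (mat_app I B x) p = x p"
proof -
  define y where "y = (\<lambda>p. complex_of_real (\<Sum>\<^sub>\<infinity>m\<in>I. cmod (B p m) * cmod (x m)))"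
  have y: "l2 I y" unfolding y_def by (rule schur_abs_bound(1)[OF B x])
  have ynn: "cmod (y n) = (\<Sum>\<^sub>\<infinity>m\<in>I. cmod (B n m) * cmod (x m))" for n
    unfolding y_def norm_of_real by (rule abs_of_nonneg, rule infsum_nonneg) auto
  have "(\<lambda>z. norm (case z of (n, m) \<Rightarrow> A p n * B n m * x m)) summable_on I \<times> I"
    unfolding Infinite_Sum.abs_summable_on_Sigma_iff
  proof (intro conjI ballI)
    fix n assume n: "n \<in> I"
    show "(\<lambda>m. norm (case (n, m) of (n, m) \<Rightarrow> A p n * B n m * x m)) summable_on I"
      using summable_on_cmult_right[OF schur_row_summable[OF B x n], of "cmod (A p n)"]
      by (simp add: norm_mult mult.assoc)
  next
    have "(\<lambda>n. cmod (A p n) * cmod (y n)) summable_on I"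
      by (rule schur_row_summable[OF A y p])
    moreover have "cmod (A p n) * cmod (y n) =
        norm (\<Sum>\<^sub>\<infinity>m\<in>I. norm (case (n, m) of (n, m) \<Rightarrow> A p n * B n m * x m))" for n
    proof -
      have "(\<Sum>\<^sub>\<infinity>m\<in>I. norm (case (n, m) of (n, m) \<Rightarrow> A p n * B n m * x m)) =
         cmod (A p n) * cmod (y n)"
        unfolding ynn by (simp add: norm_mult mult.assoc infsum_cmult_right')
      then show ?thesis by simp
    qed
    ultimately show "(\<lambda>n. norm (\<Sum>\<^sub>\<infinity>m\<in>I. norm (case (n, m) of (n, m) \<Rightarrow> A p n * B n m * x m)))
        summable_on I"
      by simp
  qed
  then have S: "(\<lambda>(n, m). A p n * B n m * x m) summable_on I \<times> I"
    by (rule Infinite_Sum.abs_summable_summable)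
  have "mat_app I A (mat_app I B x) p = (\<Sum>\<^sub>\<infinity>n\<in>I. \<Sum>\<^sub>\<infinity>m\<in>I. A p n * B n m * x m)"
    unfolding mat_app_def by (simp add: mult.assoc infsum_cmult_right')
  also have "\<dots> = (\<Sum>\<^sub>\<infinity>m\<in>I. \<Sum>\<^sub>\<infinity>n\<in>I. A p n * B n m * x m)"
    by (rule infsum_swap_banach[OF S])
  also have "\<dots> = (\<Sum>\<^sub>\<infinity>m\<in>I. (if p = m then 1 else 0) * x m)"
    by (rule infsum_cong) (simp add: infsum_cmult_left' AB p)
  also have "\<dots> = (\<Sum>\<^sub>\<infinity>m\<in>{p}. x m)"
    by (rule infsum_cong_neutral) (use p in auto)
  also have "\<dots> = x p" by simp
  finally show ?thesis .
qed

section \<open>Complex Hilbert spaces and Riesz bases\<close>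

lemma norm_scaleC: "norm (a *\<^sub>C x) = cmod a * norm (x :: 'a::complex_hilbert_space)"
proof -
  have "cinner (a *\<^sub>C x) (a *\<^sub>C x) = a * cnj (cinner (a *\<^sub>C x) x)"
    by (metis cinner_commute cinner_scaleC_left)
  also have "\<dots> = (a * cnj a) * cnj (cinner x x)" by (simp add: cinner_scaleC_left)
  also have "\<dots> = complex_of_real ((cmod a)\<^sup>2) * cinner x x"
    by (metis cinner_commute complex_norm_square)
  finally have "Re (cinner (a *\<^sub>C x) (a *\<^sub>C x)) = (cmod a)\<^sup>2 * Re (cinner x x)" by simp
  then show ?thesis by (simp add: norm_eq_sqrt_cinner real_sqrt_mult)
qed

lemma scaleC_minus_right: "a *\<^sub>C (x - y) = a *\<^sub>C x - a *\<^sub>C (y :: 'a::complex_hilbert_space)"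
  by (rule complex_vector.scale_right_diff_distrib)

lemma scaleC_minus_left: "(a - b) *\<^sub>C x = a *\<^sub>C x - b *\<^sub>C (x :: 'a::complex_hilbert_space)"
  by (rule complex_vector.scale_left_diff_distrib)

lemma bounded_linear_scaleC: "bounded_linear (\<lambda>x :: 'a::complex_hilbert_space. a *\<^sub>C x)"
proof (rule bounded_linear_intro[of _ "cmod a"])
  show "a *\<^sub>C (r *\<^sub>R x) = r *\<^sub>R (a *\<^sub>C x)" for r and x :: 'a
    by (simp add: scaleR_scaleC scaleC_scaleC mult.commute)
qed (auto simp: scaleC_add_right norm_scaleC mult.commute)

lemma bounded_linear_scaleC_left: "bounded_linear (\<lambda>a. a *\<^sub>C (x :: 'a::complex_hilbert_space))"
proof (rule bounded_linear_intro[of _ "norm x"])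
  show "(r *\<^sub>R a) *\<^sub>C x = r *\<^sub>R (a *\<^sub>C x)" for r a
    by (simp add: scaleR_scaleC scaleC_scaleC scaleR_conv_of_real)
qed (auto simp: scaleC_add_left norm_scaleC)

text \<open>The Cauchy criterion for unconditional convergence.  The expansions along a Riesz basis converge
unconditionally but in general not absolutely.\<close>

lemma summable_on_CauchyI:
  fixes f :: "'j \<Rightarrow> 'c::banach"
  assumes "\<And>e. e > 0 \<Longrightarrow> \<exists>S. finite S \<and> S \<subseteq> I \<and>
     (\<forall>F. finite F \<and> F \<subseteq> I \<and> F \<inter> S = {} \<longrightarrow> norm (sum f F) < e)"
  shows "f summable_on I"
proof -
  have "\<exists>P. eventually P (finite_subsets_at_top I) \<and>
      (\<forall>F F'. P F \<and> P F' \<longrightarrow> dist (sum f F) (sum f F') < e)" if "e > 0" for e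
  proof -
    obtain S where S: "finite S" "S \<subseteq> I"
      and small: "\<forall>F. finite F \<and> F \<subseteq> I \<and> F \<inter> S = {} \<longrightarrow> norm (sum f F) < e/2"
      using assms[OF half_gt_zero[OF \<open>e > 0\<close>]] by (elim exE conjE)
    define P where "P F \<longleftrightarrow> finite F \<and> S \<subseteq> F \<and> F \<subseteq> I" for F
    have P: "dist (sum f F) (sum f S) < e/2" if "P F" for F
    proof -
      have "sum f F - sum f S = sum f (F - S)"
        using that by (subst sum_diff) (auto simp: P_def)
      then show ?thesis using small[rule_format, of "F - S"] that by (auto simp: P_def dist_norm)
    qed
    have "eventually P (finite_subsets_at_top I)"
      unfolding eventually_finite_subsets_at_top by (rule exI[of _ S]) (use S in \<open>auto simp: P_def\<close>)
    moreover have "dist (sum f F) (sum f F') < e" if "P F" "P F'" for F F'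
      using P[OF that(1)] P[OF that(2)] dist_triangle2[of "sum f F" "sum f F'" "sum f S"] by linarith
    ultimately show ?thesis by (intro exI[of _ P] conjI allI impI) auto
  qed
  then have "cauchy_filter (filtermap (sum f) (finite_subsets_at_top I))"
    by (simp add: cauchy_filter_metric_filtermap)
  moreover have "complete (UNIV :: 'c set)"
    by (meson Cauchy_convergent UNIV_I complete_def convergent_def)
  ultimately obtain L where "(sum f \<longlongrightarrow> L) (finite_subsets_at_top I)"
    using complete_uniform[where S = UNIV] by (force simp add: filterlim_def)
  then show ?thesis using summable_on_def has_sum_def by blast
qed

locale riesz_family =
  fixes J :: "'j set" and e :: "'j \<Rightarrow> 'a::complex_hilbert_space" and c C :: real
  assumes c: "c > 0" and C: "C > 0"
    and dense: "closure (complex_vector.span (e ` J)) = UNIV"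
    and lower: "\<And>F a. finite F \<Longrightarrow> F \<subseteq> J \<Longrightarrow>
        c * (\<Sum>j\<in>F. (cmod (a j))\<^sup>2) \<le> (norm (\<Sum>j\<in>F. a j *\<^sub>C e j))\<^sup>2"
    and upper: "\<And>F a. finite F \<Longrightarrow> F \<subseteq> J \<Longrightarrow>
        (norm (\<Sum>j\<in>F. a j *\<^sub>C e j))\<^sup>2 \<le> C * (\<Sum>j\<in>F. (cmod (a j))\<^sup>2)"
begin

definition synth :: "('j \<Rightarrow> complex) \<Rightarrow> 'a" where
  "synth a = (\<Sum>\<^sub>\<infinity>j\<in>J. a j *\<^sub>C e j)"

lemma synth_has_sum:
  assumes a: "l2 J a"
  shows "((\<lambda>j. a j *\<^sub>C e j) has_sum synth a) J"
proof -
  have "(\<lambda>j. a j *\<^sub>C e j) summable_on J"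
  proof (rule summable_on_CauchyI)
    fix \<epsilon> :: real assume "\<epsilon> > 0"
    define \<delta> where "\<delta> = \<epsilon>\<^sup>2 / (2 * C)"
    have \<delta>: "\<delta> > 0" using \<open>\<epsilon> > 0\<close> C by (simp add: \<delta>_def)
    obtain S where S: "finite S" "S \<subseteq> J"
      "dist (\<Sum>j\<in>S. (cmod (a j))\<^sup>2) (\<Sum>\<^sub>\<infinity>j\<in>J. (cmod (a j))\<^sup>2) \<le> \<delta>"
      using infsum_finite_approximation[OF a[unfolded l2_def] \<delta>] by blast
    have "norm (\<Sum>j\<in>F. a j *\<^sub>C e j) < \<epsilon>" if F: "finite F" "F \<subseteq> J" "F \<inter> S = {}" for F
    proof -
      have "(\<Sum>j\<in>F. (cmod (a j))\<^sup>2) + (\<Sum>j\<in>S. (cmod (a j))\<^sup>2) = (\<Sum>j\<in>F \<union> S. (cmod (a j))\<^sup>2)"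
        using F S by (simp add: sum.union_disjoint)
      also have "\<dots> \<le> (\<Sum>\<^sub>\<infinity>j\<in>J. (cmod (a j))\<^sup>2)"
        using l2_finite_le[OF a, of "F \<union> S"] F S by (simp add: sqsum_def)
      finally have "(\<Sum>j\<in>F. (cmod (a j))\<^sup>2) \<le> \<delta>" using S(3) by (simp add: dist_real_def)
      then have "C * (\<Sum>j\<in>F. (cmod (a j))\<^sup>2) \<le> C * \<delta>" using C by simp
      with upper[OF F(1,2), of a] have "(norm (\<Sum>j\<in>F. a j *\<^sub>C e j))\<^sup>2 \<le> C * \<delta>" by linarith
      also have "\<dots> = \<epsilon>\<^sup>2 / 2" using C by (simp add: \<delta>_def)
      also have "\<dots> < \<epsilon>\<^sup>2" using \<open>\<epsilon> > 0\<close> by simp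
      finally show ?thesis using \<open>\<epsilon> > 0\<close> by (simp add: power2_less_imp_less)
    qed
    then show "\<exists>S. finite S \<and> S \<subseteq> J \<and>
       (\<forall>F. finite F \<and> F \<subseteq> J \<and> F \<inter> S = {} \<longrightarrow> norm (\<Sum>j\<in>F. a j *\<^sub>C e j) < \<epsilon>)"
      using S by blast
  qed
  then show ?thesis by (simp add: synth_def)
qed

lemma synth_bounds:
  assumes a: "l2 J a"
  shows "c * sqsum J a \<le> (norm (synth a))\<^sup>2" and "(norm (synth a))\<^sup>2 \<le> C * sqsum J a"
proof -
  have 1: "((\<lambda>F. (norm (\<Sum>j\<in>F. a j *\<^sub>C e j))\<^sup>2) \<longlongrightarrow> (norm (synth a))\<^sup>2) (finite_subsets_at_top J)"
    using synth_has_sum[OF a] unfolding has_sum_def by (intro tendsto_intros)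
  have 2: "((\<lambda>F. k * (\<Sum>j\<in>F. (cmod (a j))\<^sup>2)) \<longlongrightarrow> k * sqsum J a) (finite_subsets_at_top J)" for k
    using infsum_tendsto[OF a[unfolded l2_def]] unfolding sqsum_def by (intro tendsto_intros)
  show "c * sqsum J a \<le> (norm (synth a))\<^sup>2"
    by (rule tendsto_le[OF _ 1 2]) (auto intro: eventually_finite_subsets_at_top_weakI lower)
  show "(norm (synth a))\<^sup>2 \<le> C * sqsum J a"
    by (rule tendsto_le[OF _ 2 1]) (auto intro: eventually_finite_subsets_at_top_weakI upper)
qed

lemma synth_add:
  assumes "l2 J a" "l2 J b"
  shows "synth (\<lambda>j. a j + b j) = synth a + synth b"
  using has_sum_add[OF synth_has_sum[OF assms(1)] synth_has_sum[OF assms(2)]]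
  unfolding scaleC_add_left[symmetric] by (simp add: synth_def[of "\<lambda>j. a j + b j"] infsumI)

lemma synth_scale:
  assumes "l2 J a"
  shows "synth (\<lambda>j. z * a j) = z *\<^sub>C synth a"
  using has_sum_bounded_linear[OF bounded_linear_scaleC synth_has_sum[OF assms], of z]
  unfolding scaleC_scaleC by (simp add: synth_def[of "\<lambda>j. z * a j"] infsumI)

lemma synth_diff: "l2 J a \<Longrightarrow> l2 J b \<Longrightarrow> synth (\<lambda>j. a j - b j) = synth a - synth b"
  using synth_add[of a "\<lambda>j. -1 * b j"] synth_scale[of b "-1"] l2_scale[of J b "-1"]
  by (simp add: complex_vector.scale_minus_left)

text \<open>The range of the synthesis map is a subspace that contains the basis, so only its closedness is at
stake.  By the lower bound, coefficients of a convergent sequence of sums form a Cauchy sequence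
of square summable families; its componentwise limit is the family looked for, because the bounds
on finite partial sums pass to the limit.\<close>

lemma synth_surj: "\<exists>a. l2 J a \<and> synth a = x"
proof -
  define R where "R = synth ` {a. l2 J a}"
  have "e ` J \<subseteq> R"
  proof
    fix y assume "y \<in> e ` J"
    then obtain j where j: "j \<in> J" "y = e j" by auto
    define d where "d = (\<lambda>i. if i = j then 1 else 0 :: complex)"
    have "l2 J d"
      unfolding l2_def
      by (rule finite_nonzero_values_imp_summable_on) (rule finite_subset[of _ "{j}"], auto simp: d_def)
    moreover have "synth d = (\<Sum>\<^sub>\<infinity>i\<in>{j}. d i *\<^sub>C e i)"
      unfolding synth_def by (rule infsum_cong_neutral) (use j in \<open>auto simp: d_def\<close>)
    ultimately show "y \<in> R" using j by (auto simp: R_def d_def image_iff intro!: exI[of _ d])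
  qed
  moreover have "complex_vector.subspace R"
  proof (rule complex_vector.subspaceI)
    show "0 \<in> R"
      unfolding R_def by (rule image_eqI[of _ _ "\<lambda>_. 0"]) (auto simp: synth_def l2_def)
  next
    fix x y assume "x \<in> R" "y \<in> R"
    then obtain a b where ab: "l2 J a" "l2 J b" "x = synth a" "y = synth b" by (auto simp: R_def)
    show "x + y \<in> R"
      unfolding R_def by (rule image_eqI[of _ _ "\<lambda>j. a j + b j"]) (use ab in \<open>simp_all add: synth_add l2_add\<close>)
  next
    fix z x assume "x \<in> R"
    then obtain a where a: "l2 J a" "x = synth a" by (auto simp: R_def)
    show "z *\<^sub>C x \<in> R"
      unfolding R_def by (rule image_eqI[of _ _ "\<lambda>j. z * a j"]) (use a in \<open>simp_all add: synth_scale l2_scale\<close>)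
  qed
  ultimately have "complex_vector.span (e ` J) \<subseteq> R" by (rule complex_vector.span_minimal)
  then have "x \<in> closure R" using dense closure_mono by blast
  then obtain xs where xs: "\<And>k. xs k \<in> R" "xs \<longlonglongrightarrow> x" by (auto simp: closure_sequential)
  have "\<exists>a. l2 J a \<and> synth a = xs k" for k using xs(1)[of k] by (auto simp: R_def)
  then obtain a where a: "\<And>k. l2 J (a k)" "\<And>k. synth (a k) = xs k" by metis
  have dist_a: "c * sqsum J (\<lambda>j. a k j - a l j) \<le> (dist (xs k) (xs l))\<^sup>2" for k l
    using synth_bounds(1)[of "\<lambda>j. a k j - a l j"] a by (simp add: l2_diff synth_diff dist_norm)
  have Cauchy: "Cauchy xs" using xs(2) by (rule LIMSEQ_imp_Cauchy)
  have "convergent (\<lambda>k. a k j)" if "j \<in> J" for j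
  proof (rule Cauchy_convergent, rule metric_CauchyI)
    fix \<epsilon> :: real assume "\<epsilon> > 0"
    then have "sqrt c * \<epsilon> > 0" using c by simp
    then obtain N where N: "\<And>k l. k \<ge> N \<Longrightarrow> l \<ge> N \<Longrightarrow> dist (xs k) (xs l) < sqrt c * \<epsilon>"
      using metric_CauchyD[OF Cauchy] by blast
    have "dist (a k j) (a l j) < \<epsilon>" if "k \<ge> N" "l \<ge> N" for k l
    proof -
      have "c * (cmod (a k j - a l j))\<^sup>2 \<le> c * sqsum J (\<lambda>j. a k j - a l j)"
        using l2_component_le[OF l2_diff[OF a(1)[of k] a(1)[of l]] \<open>j \<in> J\<close>] c by simp
      also have "\<dots> \<le> (dist (xs k) (xs l))\<^sup>2" by (rule dist_a)
      also have "\<dots> < (sqrt c * \<epsilon>)\<^sup>2"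
        using N[OF that] by (intro power_strict_mono) auto
      also have "\<dots> = c * \<epsilon>\<^sup>2" using c by (simp add: power_mult_distrib)
      finally have "(cmod (a k j - a l j))\<^sup>2 < \<epsilon>\<^sup>2" using c by simp
      then show ?thesis using \<open>\<epsilon> > 0\<close> by (simp add: dist_norm power2_less_imp_less)
    qed
    then show "\<exists>N. \<forall>k\<ge>N. \<forall>l\<ge>N. dist (a k j) (a l j) < \<epsilon>" by blast
  qed
  then obtain b where b: "\<And>j. j \<in> J \<Longrightarrow> (\<lambda>k. a k j) \<longlonglongrightarrow> b j"
    unfolding convergent_def by metis
  have close: "\<exists>N. \<forall>k\<ge>N. l2 J (\<lambda>j. a k j - b j) \<and> sqsum J (\<lambda>j. a k j - b j) \<le> \<epsilon>\<^sup>2 / c"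
    if "\<epsilon> > 0" for \<epsilon>
  proof -
    obtain N where N: "\<And>k l. k \<ge> N \<Longrightarrow> l \<ge> N \<Longrightarrow> dist (xs k) (xs l) < \<epsilon>"
      using metric_CauchyD[OF Cauchy \<open>\<epsilon> > 0\<close>] by blast
    have "(\<Sum>j\<in>F. (cmod (a k j - b j))\<^sup>2) \<le> \<epsilon>\<^sup>2 / c"
      if k: "k \<ge> N" and F: "finite F" "F \<subseteq> J" for k F
    proof (rule tendsto_upperbound)
      show "((\<lambda>l. \<Sum>j\<in>F. (cmod (a k j - a l j))\<^sup>2) \<longlongrightarrow> (\<Sum>j\<in>F. (cmod (a k j - b j))\<^sup>2)) sequentially"
        by (intro tendsto_intros b) (use F in auto)
      show "\<forall>\<^sub>F l in sequentially. (\<Sum>j\<in>F. (cmod (a k j - a l j))\<^sup>2) \<le> \<epsilon>\<^sup>2 / c"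
        using eventually_ge_at_top[of N]
      proof eventually_elim
        case (elim l)
        have "c * (\<Sum>j\<in>F. (cmod (a k j - a l j))\<^sup>2) \<le> c * sqsum J (\<lambda>j. a k j - a l j)"
          using l2_finite_le[OF l2_diff[OF a(1)[of k] a(1)[of l]] F] c by simp
        also have "\<dots> \<le> (dist (xs k) (xs l))\<^sup>2" by (rule dist_a)
        also have "\<dots> \<le> \<epsilon>\<^sup>2" using N[OF k elim] by (intro power_mono) auto
        finally show ?case using c by (simp add: field_simps)
      qed
    qed simp
    then have "l2 J (\<lambda>j. a k j - b j) \<and> sqsum J (\<lambda>j. a k j - b j) \<le> \<epsilon>\<^sup>2 / c" if "k \<ge> N" for k
      using l2_boundedI[of J "\<lambda>j. a k j - b j" "\<epsilon>\<^sup>2 / c"] that by simp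
    then show ?thesis by blast
  qed
  obtain k where "l2 J (\<lambda>j. a k j - b j)" using close[of 1] by auto
  then have lb: "l2 J b" using l2_diff[OF a(1)[of k]] by fastforce
  have "xs \<longlonglongrightarrow> synth b"
  proof (rule metric_LIMSEQ_I)
    fix \<epsilon> :: real assume "\<epsilon> > 0"
    define \<delta> where "\<delta> = \<epsilon> * sqrt (c / (2 * C))"
    have \<delta>: "\<delta> > 0" using \<open>\<epsilon> > 0\<close> c C by (simp add: \<delta>_def)
    obtain N where N: "\<And>k. k \<ge> N \<Longrightarrow> l2 J (\<lambda>j. a k j - b j)"
      "\<And>k. k \<ge> N \<Longrightarrow> sqsum J (\<lambda>j. a k j - b j) \<le> \<delta>\<^sup>2 / c" using close[OF \<delta>] by blast
    have "dist (xs k) (synth b) < \<epsilon>" if k: "k \<ge> N" for k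
    proof -
      have "xs k - synth b = synth (\<lambda>j. a k j - b j)" using a lb by (simp add: synth_diff)
      then have "(dist (xs k) (synth b))\<^sup>2 \<le> C * sqsum J (\<lambda>j. a k j - b j)"
        using synth_bounds(2)[OF N(1)[OF k]] by (simp add: dist_norm)
      also have "\<dots> \<le> C * (\<delta>\<^sup>2 / c)" by (rule mult_left_mono[OF N(2)[OF k]]) (use C in simp)
      also have "\<dots> = \<epsilon>\<^sup>2 / 2" using c C by (simp add: \<delta>_def power_mult_distrib)
      also have "\<dots> < \<epsilon>\<^sup>2" using \<open>\<epsilon> > 0\<close> by simp
      finally show ?thesis using \<open>\<epsilon> > 0\<close> by (simp add: power2_less_imp_less)
    qed
    then show "\<exists>N. \<forall>k\<ge>N. dist (xs k) (synth b) < \<epsilon>" by blast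
  qed
  then have "synth b = x" using xs(2) LIMSEQ_unique by blast
  with lb show ?thesis by blast
qed

lemma synth_inj:
  assumes "l2 J a" "l2 J b" "synth a = synth b" "j \<in> J"
  shows "a j = b j"
proof -
  have d: "l2 J (\<lambda>j. a j - b j)" using assms by (simp add: l2_diff)
  have "c * sqsum J (\<lambda>j. a j - b j) \<le> 0"
    using synth_bounds(1)[OF d] assms by (simp add: synth_diff)
  then have "sqsum J (\<lambda>j. a j - b j) \<le> 0" using c by (simp add: mult_le_0_iff)
  with l2_component_le[OF d assms(4)] have "(cmod (a j - b j))\<^sup>2 \<le> 0" by linarith
  then show ?thesis by simp
qed

end

lemma riesz_basis_family:
  assumes "riesz_basis J e"
  obtains c C where "riesz_family J e c C"
proof -
  from assms have dense: "closure (complex_vector.span (e ` J)) = UNIV"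
    unfolding riesz_basis_def by (rule conjunct1)
  from assms obtain c C where cC: "c > 0" "C > 0" and bounds: "\<forall>F a. finite F \<and> F \<subseteq> J \<longrightarrow>
        c * (\<Sum>j\<in>F. (cmod (a j))\<^sup>2) \<le> (norm (\<Sum>j\<in>F. a j *\<^sub>C e j))\<^sup>2 \<and>
        (norm (\<Sum>j\<in>F. a j *\<^sub>C e j))\<^sup>2 \<le> C * (\<Sum>j\<in>F. (cmod (a j))\<^sup>2)"
    unfolding riesz_basis_def by (elim conjE exE)
  show ?thesis
    by (rule that[of c C], unfold_locales) (fact cC dense | simp add: bounds)+
qed

section \<open>Semigroups generated by diagonal operators\<close>

lemma norm_exp_minus_one_le:
  assumes "Re z \<le> 0"
  shows "cmod (exp z - 1) \<le> cmod z"
proof -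
  have "cmod (exp z - exp 0) \<le> 1 * cmod (z - 0)"
  proof (rule field_differentiable_bound)
    show "convex {w. Re w \<le> 0}" by (rule convex_halfspace_Re_le)
    show "(exp has_field_derivative exp w) (at w within {w. Re w \<le> 0})" for w :: complex
      by (rule DERIV_subset[OF DERIV_exp]) auto
  qed (use assms in auto)
  then show ?thesis by simp
qed

lemma exp_difference_quotient:
  "((\<lambda>h. (exp (z * complex_of_real h) - 1) / complex_of_real h) \<longlongrightarrow> z) (at_right 0)"
proof -
  have "((\<lambda>w. exp (z * w)) has_field_derivative z) (at 0)"
    by (auto intro!: derivative_eq_intros)
  then have "((\<lambda>w. (exp (z * w) - 1) / w) \<longlongrightarrow> z) (at 0)"
    by (simp add: has_field_derivative_iff)
  moreover have "filterlim complex_of_real (at 0) (at_right 0)"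
    unfolding filterlim_at
    by (auto intro!: tendsto_eq_intros simp: eventually_at_filter)
  ultimately show ?thesis by (rule filterlim_compose)
qed

lemma integral_exp_scaled:
  assumes "z \<noteq> 0" "t \<ge> 0"
  shows "integral {0..t} (\<lambda>s. exp (z * complex_of_real s) * g) = (exp (z * complex_of_real t) - 1) / z * g"
proof -
  have "((\<lambda>s. exp (z * complex_of_real s) * g) has_integral
     (exp (z * complex_of_real t) / z * g - exp (z * complex_of_real 0) / z * g)) {0..t}"
  proof (rule fundamental_theorem_of_calculus[OF \<open>t \<ge> 0\<close>])
    fix s
    show "((\<lambda>s. exp (z * complex_of_real s) / z * g) has_vector_derivative exp (z * complex_of_real s) * g)
        (at s within {0..t})"
      by (rule has_vector_derivative_real_field) (use assms in \<open>auto intro!: derivative_eq_intros\<close>)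
  qed
  from integral_unique[OF this] show ?thesis by (simp only: left_diff_distrib diff_divide_distrib) simp
qed

lemma scalar_mild_solution_unique:
  fixes y :: "real \<Rightarrow> complex"
  assumes cont: "continuous_on {0..} y" and eq: "\<And>t. t \<ge> 0 \<Longrightarrow> y t = g + z * integral {0..t} y"
    and t: "t \<ge> 0"
  shows "y t = exp (z * complex_of_real t) * g"
proof -
  define w where "w s = exp (- z * complex_of_real s) * y s" for s
  have cont': "continuous_on {0..t} y" by (rule continuous_on_subset[OF cont]) auto
  have dy: "(y has_vector_derivative z * y s) (at s within {0..t})" if "s \<in> {0..t}" for s
  proof -
    have "((\<lambda>s. integral {0..s} y) has_vector_derivative y s) (at s within {0..t})"
      by (rule integral_has_vector_derivative[OF cont' that])
    then have "((\<lambda>s. g + z * integral {0..s} y) has_vector_derivative 0 + z * y s) (at s within {0..t})"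
      by (intro derivative_intros)
    then show ?thesis
      by (rule has_vector_derivative_transform[OF that, rotated 1, THEN has_vector_derivative_eq_rhs])
         (use eq in auto)
  qed
  have "(w has_vector_derivative 0) (at s within {0..t})" if "s \<in> {0..t}" for s
  proof -
    have "((\<lambda>s. exp (- z * complex_of_real s)) has_vector_derivative - z * exp (- z * complex_of_real s))
        (at s within {0..t})"
      by (rule has_vector_derivative_real_field) (auto intro!: derivative_eq_intros)
    from has_vector_derivative_mult[OF this dy[OF that]] show ?thesis
      unfolding w_def by (rule has_vector_derivative_eq_rhs) (simp add: algebra_simps)
  qed
  then obtain k where k: "\<And>s. s \<in> {0..t} \<Longrightarrow> w s = k"
    using has_vector_derivative_zero_constant[of "{0..t}" w] by auto
  have "exp (- z * complex_of_real t) * y t = g"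
    using k[of 0] k[of t] t eq[of 0] by (simp add: w_def)
  then have "exp (z * complex_of_real t) * (exp (- z * complex_of_real t) * y t) = exp (z * complex_of_real t) * g"
    by simp
  then show ?thesis by (simp add: exp_minus flip: mult.assoc)
qed

text \<open>\<open>U\<close> is an isomorphism of the Hilbert space onto \<open>l2 J\<close> with inverse \<open>V\<close>, in other words the
coefficient map of a Riesz basis.\<close>

locale coordinates =
  fixes J :: "'j set" and U :: "'a::complex_hilbert_space \<Rightarrow> 'j \<Rightarrow> complex"
    and V :: "('j \<Rightarrow> complex) \<Rightarrow> 'a" and a b :: real
  assumes U_l2: "\<And>x. l2 J (U x)"
    and U_add: "\<And>x y j. j \<in> J \<Longrightarrow> U (x + y) j = U x j + U y j"
    and U_scale: "\<And>z x j. j \<in> J \<Longrightarrow> U (z *\<^sub>C x) j = z * U x j"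
    and a: "a > 0" and b: "b > 0"
    and upper: "\<And>x. sqsum J (U x) \<le> b * (norm x)\<^sup>2"
    and lower: "\<And>x. (norm x)\<^sup>2 \<le> a * sqsum J (U x)"
    and U_V: "\<And>g j. l2 J g \<Longrightarrow> j \<in> J \<Longrightarrow> U (V g) j = g j"
begin

lemma U_scaleR: "j \<in> J \<Longrightarrow> U (r *\<^sub>R x) j = complex_of_real r * U x j"
  by (simp add: scaleR_scaleC U_scale)

lemma U_diff: "j \<in> J \<Longrightarrow> U (x - y) j = U x j - U y j"
  using U_add[of j x "- y"] U_scaleR[of j "-1" y] by simp

lemma U_bounded_linear: "j \<in> J \<Longrightarrow> bounded_linear (\<lambda>x. U x j)"
proof (rule bounded_linear_intro[of _ "sqrt b"])
  fix x assume j: "j \<in> J"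
  have "(cmod (U x j))\<^sup>2 \<le> b * (norm x)\<^sup>2"
    using l2_component_le[OF U_l2 j, of x] upper[of x] by linarith
  then have "cmod (U x j) \<le> sqrt (b * (norm x)\<^sup>2)" by (rule real_le_rsqrt)
  then show "cmod (U x j) \<le> norm x * sqrt b" by (simp add: real_sqrt_mult mult.commute)
qed (auto simp: U_add U_scaleR scaleR_conv_of_real)

lemma U_inject:
  assumes "\<And>j. j \<in> J \<Longrightarrow> U x j = U y j"
  shows "x = y"
proof -
  have "sqsum J (U (x - y)) = 0"
    unfolding sqsum_def by (rule infsum_0) (use assms in \<open>auto simp: U_diff\<close>)
  with lower[of "x - y"] show ?thesis by simp
qed

text \<open>Dominated convergence in \<open>l2 J\<close>, transported along \<open>U\<close>.  It is the only source of norm limits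
for the semigroup: strong continuity and difference quotients are both read off the scalar
exponentials.\<close>

lemma tendsto_by_coordinates:
  assumes F: "F \<noteq> bot" and G: "l2 J G"
    and dom: "\<forall>\<^sub>F s in F. \<forall>j\<in>J. cmod (U (X s) j - U x j) \<le> cmod (G j)"
    and lim: "\<And>j. j \<in> J \<Longrightarrow> ((\<lambda>s. U (X s) j) \<longlongrightarrow> U x j) F"
  shows "(X \<longlongrightarrow> x) F"
proof -
  have "((\<lambda>s. \<Sum>\<^sub>\<infinity>j\<in>J. (cmod (U (X s - x) j))\<^sup>2) \<longlongrightarrow> (\<Sum>\<^sub>\<infinity>j\<in>J. 0)) F"
  proof (rule infsum_dominated_tendsto[OF G[unfolded l2_def] _ _ F])
    show "\<forall>\<^sub>F s in F. \<forall>j\<in>J. norm ((cmod (U (X s - x) j))\<^sup>2) \<le> (cmod (G j))\<^sup>2"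
      using dom by eventually_elim (auto simp: U_diff intro!: power_mono)
    fix j assume j: "j \<in> J"
    have "((\<lambda>s. (cmod (U (X s) j - U x j))\<^sup>2) \<longlongrightarrow> (cmod (U x j - U x j))\<^sup>2) F"
      by (intro tendsto_intros lim j)
    then show "((\<lambda>s. (cmod (U (X s - x) j))\<^sup>2) \<longlongrightarrow> 0) F" using j by (simp add: U_diff)
  qed
  then have "((\<lambda>s. sqsum J (U (X s - x))) \<longlongrightarrow> 0) F" by (simp add: sqsum_def)
  then have "((\<lambda>s. a * sqsum J (U (X s - x))) \<longlongrightarrow> 0) F" by (rule tendsto_mult_right_zero)
  then have "((\<lambda>s. (norm (X s - x))\<^sup>2) \<longlongrightarrow> 0) F"
    by (rule tendsto_sandwich[OF _ _ tendsto_const, rotated 2]) (auto simp: lower)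
  then have "((\<lambda>s. sqrt ((norm (X s - x))\<^sup>2)) \<longlongrightarrow> sqrt 0) F" by (rule tendsto_real_sqrt)
  then have "((\<lambda>s. X s - x) \<longlongrightarrow> 0) F" by (simp add: tendsto_norm_zero_iff)
  then show ?thesis by (simp add: Lim_null[symmetric])
qed

end

text \<open>\<open>A\<close> acts as multiplication by \<open>\<nu>\<close> in the coordinates \<open>U\<close>, on the maximal domain.\<close>

locale diagonalised = coordinates J U V a b
  for J :: "'j set" and U :: "'a::complex_hilbert_space \<Rightarrow> 'j \<Rightarrow> complex" and V a b +
  fixes \<nu> :: "'j \<Rightarrow> complex" and \<mu> :: real and D :: "'a set" and A :: "'a \<Rightarrow> 'a"
  assumes \<mu>: "\<mu> > 0" and Re_\<nu>: "\<And>j. j \<in> J \<Longrightarrow> Re (\<nu> j) \<le> - \<mu>"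
    and D_eq: "D = {x. l2 J (\<lambda>j. \<nu> j * U x j)}"
    and U_A: "\<And>x j. x \<in> D \<Longrightarrow> j \<in> J \<Longrightarrow> U (A x) j = \<nu> j * U x j"
begin

definition semigroup :: "real \<Rightarrow> 'a \<Rightarrow> 'a" where
  "semigroup t x = V (\<lambda>j. exp (\<nu> j * complex_of_real t) * U x j)"

lemma norm_exp_le:
  assumes "j \<in> J" "t \<ge> 0"
  shows "cmod (exp (\<nu> j * complex_of_real t)) \<le> exp (- \<mu> * t)"
proof -
  have "Re (\<nu> j) * t \<le> - \<mu> * t" by (rule mult_right_mono) (use assms Re_\<nu> in auto)
  then show ?thesis by (simp only: norm_exp_eq_Re) simp
qed

lemma U_semigroup:
  assumes t: "t \<ge> 0"
  shows "j \<in> J \<Longrightarrow> U (semigroup t x) j = exp (\<nu> j * complex_of_real t) * U x j"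
    and "sqsum J (U (semigroup t x)) \<le> (exp (- \<mu> * t))\<^sup>2 * sqsum J (U x)"
proof -
  have le: "cmod (exp (\<nu> j * complex_of_real t) * U x j) \<le> exp (- \<mu> * t) * cmod (U x j)" if "j \<in> J" for j
    unfolding norm_mult by (rule mult_right_mono[OF norm_exp_le[OF that t]]) simp
  note l2 = l2_comparison[OF U_l2 le]
  show *: "U (semigroup t x) j = exp (\<nu> j * complex_of_real t) * U x j" if "j \<in> J" for j
    unfolding semigroup_def by (rule U_V[OF l2(1) that])
  show "sqsum J (U (semigroup t x)) \<le> (exp (- \<mu> * t))\<^sup>2 * sqsum J (U x)"
    by (rule ord_eq_le_trans[OF sqsum_cong l2(2)]) (rule *)
qed

lemma norm_semigroup_le:
  assumes t: "t \<ge> 0"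
  shows "norm (semigroup t x) \<le> sqrt (a * b) * exp (- \<mu> * t) * norm x"
proof (rule power2_le_imp_le)
  have "(norm (semigroup t x))\<^sup>2 \<le> a * sqsum J (U (semigroup t x))" by (rule lower)
  also have "\<dots> \<le> a * ((exp (- \<mu> * t))\<^sup>2 * sqsum J (U x))"
    by (rule mult_left_mono[OF U_semigroup(2)[OF t]]) (use a in simp)
  also have "\<dots> \<le> a * ((exp (- \<mu> * t))\<^sup>2 * (b * (norm x)\<^sup>2))"
    by (intro mult_left_mono upper) (use a in simp_all)
  also have "\<dots> = (sqrt (a * b) * exp (- \<mu> * t) * norm x)\<^sup>2"
    using a b by (simp add: power_mult_distrib)
  finally show "(norm (semigroup t x))\<^sup>2 \<le> (sqrt (a * b) * exp (- \<mu> * t) * norm x)\<^sup>2" .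
qed (use a b in simp)

lemma semigroup_continuous: "continuous_on {0..} (\<lambda>t. semigroup t x)"
  unfolding continuous_on_def
proof
  fix t :: real assume t: "t \<in> {0..}"
  show "((\<lambda>t. semigroup t x) \<longlongrightarrow> semigroup t x) (at t within {0..})"
  proof (rule tendsto_by_coordinates)
    have "at_right t \<le> at t within {0..}" by (rule at_le) (use t in auto)
    then show "at t within {0..} \<noteq> bot"
      using trivial_limit_at_right_real[of t] bot.extremum_uniqueI by metis
    show "l2 J (\<lambda>j. 2 * U x j)" by (rule l2_scale[OF U_l2])
    show "\<forall>\<^sub>F s in at t within {0..}. \<forall>j\<in>J.
        cmod (U (semigroup s x) j - U (semigroup t x) j) \<le> cmod (2 * U x j)"
      unfolding eventually_at_filter
    proof (intro always_eventually allI impI ballI)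
      fix s j assume "s \<noteq> t" "s \<in> {0..}" and j: "j \<in> J"
      then have s: "s \<ge> 0" and t0: "t \<ge> 0" using t by auto
      have le1: "cmod (exp (\<nu> j * complex_of_real r)) \<le> 1" if "r \<ge> 0" for r
      proof -
        have "exp (- \<mu> * r) \<le> 1" using \<mu> that by simp
        with norm_exp_le[OF j that] show ?thesis by linarith
      qed
      have "cmod (exp (\<nu> j * complex_of_real s) - exp (\<nu> j * complex_of_real t)) \<le> 2"
        using norm_triangle_ineq4[of "exp (\<nu> j * complex_of_real s)" "exp (\<nu> j * complex_of_real t)"]
          le1[OF s] le1[OF t0] by linarith
      then have "cmod (exp (\<nu> j * complex_of_real s) - exp (\<nu> j * complex_of_real t)) * cmod (U x j)
          \<le> 2 * cmod (U x j)" by (rule mult_right_mono) simp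
      then show "cmod (U (semigroup s x) j - U (semigroup t x) j) \<le> cmod (2 * U x j)"
        using s t j by (simp add: U_semigroup(1) norm_mult flip: left_diff_distrib)
    qed
    fix j assume j: "j \<in> J"
    have "((\<lambda>s. exp (\<nu> j * complex_of_real s) * U x j) \<longlongrightarrow> exp (\<nu> j * complex_of_real t) * U x j)
        (at t within {0..})"
      by (intro tendsto_intros)
    then have "((\<lambda>s. U (semigroup s x) j) \<longlongrightarrow> exp (\<nu> j * complex_of_real t) * U x j) (at t within {0..})"
      by (rule Lim_transform_eventually)
         (use j in \<open>auto simp: U_semigroup(1) eventually_at_filter intro!: always_eventually\<close>)
    then show "((\<lambda>s. U (semigroup s x) j) \<longlongrightarrow> U (semigroup t x) j) (at t within {0..})"
      using t j by (simp add: U_semigroup(1))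
  qed
qed

lemma semigroup_c0: "c0_semigroup semigroup"
  unfolding c0_semigroup_def
proof (intro conjI allI impI)
  fix t :: real assume t: "t \<ge> 0"
  show "bounded_linear (semigroup t)"
  proof (rule bounded_linear_intro[of _ "sqrt (a * b) * exp (- \<mu> * t)"])
    show "semigroup t (x + y) = semigroup t x + semigroup t y" for x y
      by (rule U_inject) (simp add: U_semigroup(1)[OF t] U_add distrib_left)
    show "semigroup t (r *\<^sub>R x) = r *\<^sub>R semigroup t x" for r x
      by (rule U_inject) (simp add: U_semigroup(1)[OF t] U_scaleR)
    show "norm (semigroup t x) \<le> norm x * (sqrt (a * b) * exp (- \<mu> * t))" for x
      using norm_semigroup_le[OF t, of x] by (simp add: mult.commute)
  qed
  show "semigroup t (c *\<^sub>C x) = c *\<^sub>C semigroup t x" for c x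
    by (rule U_inject) (simp add: U_semigroup(1)[OF t] U_scale)
next
  show "semigroup 0 = id"
    by (rule ext, rule U_inject) (simp add: U_semigroup(1))
next
  fix s t :: real assume st: "s \<ge> 0" "t \<ge> 0"
  show "semigroup (s + t) = semigroup s \<circ> semigroup t"
    by (rule ext, rule U_inject) (simp add: U_semigroup(1) st distrib_left exp_add)
next
  fix x
  have "((\<lambda>t. semigroup t x) \<longlongrightarrow> semigroup 0 x) (at 0 within {0..})"
    using semigroup_continuous[of x] by (auto simp: continuous_on_def)
  moreover have "semigroup 0 x = x" by (rule U_inject) (simp add: U_semigroup(1))
  ultimately show "((\<lambda>t. semigroup t x) \<longlongrightarrow> x) (at_right 0)"
    by (auto elim!: filterlim_mono intro!: at_le)
qed

text \<open>If \<open>x\<close> is in the domain, the difference quotients of the exponentials differ from \<open>\<nu> j\<close>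
by at most \<open>2 |\<nu> j|\<close>, since \<open>Re (\<nu> j) \<le> 0\<close>.  Conversely a limit of the quotients has the coordinates
\<open>\<nu> j * U x j\<close>, which are therefore square summable: this gives the maximality of the domain.\<close>

lemma generates: "generates D A semigroup"
  unfolding generates_def
proof (intro conjI allI semigroup_c0)
  fix x y
  have quot: "U ((semigroup h x - x) /\<^sub>R h) j =
      (exp (\<nu> j * complex_of_real h) - 1) / complex_of_real h * U x j"
    if "j \<in> J" "h > 0" for j h
    using that by (simp add: U_scaleR U_diff U_semigroup(1) field_simps)
  have lim: "((\<lambda>h. U ((semigroup h x - x) /\<^sub>R h) j) \<longlongrightarrow> \<nu> j * U x j) (at_right 0)" if j: "j \<in> J" for j
  proof (rule Lim_transform_eventually)
    show "((\<lambda>h. (exp (\<nu> j * complex_of_real h) - 1) / complex_of_real h * U x j) \<longlongrightarrow> \<nu> j * U x j) (at_right 0)"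
      by (intro tendsto_mult exp_difference_quotient tendsto_const)
    show "\<forall>\<^sub>F h in at_right 0. (exp (\<nu> j * complex_of_real h) - 1) / complex_of_real h * U x j =
        U ((semigroup h x - x) /\<^sub>R h) j"
      using quot[OF j] by (auto simp: eventually_at_filter intro!: always_eventually)
  qed
  show "x \<in> D \<and> A x = y \<longleftrightarrow> ((\<lambda>h. (semigroup h x - x) /\<^sub>R h) \<longlongrightarrow> y) (at_right 0)"
  proof
    assume *: "x \<in> D \<and> A x = y"
    show "((\<lambda>h. (semigroup h x - x) /\<^sub>R h) \<longlongrightarrow> y) (at_right 0)"
    proof (rule tendsto_by_coordinates)
      show "l2 J (\<lambda>j. 2 * (\<nu> j * U x j))" by (rule l2_scale) (use * D_eq in auto)
      have Uy: "U y j = \<nu> j * U x j" if "j \<in> J" for j using * U_A[OF _ that] by auto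
      show "((\<lambda>h. U ((semigroup h x - x) /\<^sub>R h) j) \<longlongrightarrow> U y j) (at_right 0)" if "j \<in> J" for j
        using lim[OF that] Uy[OF that] by simp
      show "\<forall>\<^sub>F h in at_right 0. \<forall>j\<in>J. cmod (U ((semigroup h x - x) /\<^sub>R h) j - U y j)
          \<le> cmod (2 * (\<nu> j * U x j))"
        unfolding eventually_at_filter
      proof (intro always_eventually allI impI ballI)
        fix h :: real and j assume "h \<in> {0<..}" and j: "j \<in> J"
        then have h: "h > 0" by simp
        have "Re (\<nu> j * complex_of_real h) \<le> 0"
          using Re_\<nu>[OF j] \<mu> h by (simp add: mult_nonpos_nonneg)
        then have "cmod (exp (\<nu> j * complex_of_real h) - 1) \<le> cmod (\<nu> j) * h"
          using norm_exp_minus_one_le[of "\<nu> j * complex_of_real h"] h by (simp add: norm_mult)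
        then have "cmod ((exp (\<nu> j * complex_of_real h) - 1) / complex_of_real h) \<le> cmod (\<nu> j)"
          using h by (simp add: norm_divide field_simps)
        then have "cmod ((exp (\<nu> j * complex_of_real h) - 1) / complex_of_real h - \<nu> j) \<le> 2 * cmod (\<nu> j)"
          using norm_triangle_ineq4[of "(exp (\<nu> j * complex_of_real h) - 1) / complex_of_real h" "\<nu> j"]
          by linarith
        then have "cmod ((exp (\<nu> j * complex_of_real h) - 1) / complex_of_real h - \<nu> j) * cmod (U x j)
            \<le> 2 * cmod (\<nu> j) * cmod (U x j)" by (rule mult_right_mono) simp
        then show "cmod (U ((semigroup h x - x) /\<^sub>R h) j - U y j) \<le> cmod (2 * (\<nu> j * U x j))"
          unfolding quot[OF j h] Uy[OF j] left_diff_distrib[symmetric] norm_mult by simp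
      qed
    qed simp
  next
    assume *: "((\<lambda>h. (semigroup h x - x) /\<^sub>R h) \<longlongrightarrow> y) (at_right 0)"
    have Uy: "U y j = \<nu> j * U x j" if j: "j \<in> J" for j
      by (rule tendsto_unique[OF _ bounded_linear.tendsto[OF U_bounded_linear[OF j] *] lim[OF j]]) simp
    have "l2 J (\<lambda>j. \<nu> j * U x j)" using U_l2[of y] l2_cong[of J "U y" "\<lambda>j. \<nu> j * U x j"] Uy by simp
    then have "x \<in> D" by (simp add: D_eq)
    moreover have "A x = y" by (rule U_inject) (simp add: U_A[OF \<open>x \<in> D\<close>] Uy)
    ultimately show "x \<in> D \<and> A x = y" by simp
  qed
qed

lemma U_integral:
  fixes u :: "real \<Rightarrow> 'a"
  assumes "continuous_on {0..} u" "j \<in> J"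
  shows "U (integral {0..t} u) j = integral {0..t} (\<lambda>s. U (u s) j)"
proof -
  have "continuous_on {0..t} u" by (rule continuous_on_subset[OF assms(1)]) auto
  then have "u integrable_on {0..t}" by (rule integrable_continuous_real)
  from integral_linear[OF this U_bounded_linear[OF assms(2)]] show ?thesis by (simp add: o_def)
qed

lemma mild_solution_semigroup: "mild_solution D A x (\<lambda>t. semigroup t x)"
  unfolding mild_solution_def
proof (intro conjI allI impI semigroup_continuous)
  show "semigroup 0 x = x" by (rule U_inject) (simp add: U_semigroup(1))
next
  fix t :: real assume t: "t \<ge> 0"
  have U_int: "\<nu> j * U (integral {0..t} (\<lambda>s. semigroup s x)) j = U (semigroup t x) j - U x j"
    if j: "j \<in> J" for j
  proof -
    have "U (integral {0..t} (\<lambda>s. semigroup s x)) j = integral {0..t} (\<lambda>s. U (semigroup s x) j)"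
      by (rule U_integral[OF semigroup_continuous j])
    also have "\<dots> = integral {0..t} (\<lambda>s. exp (\<nu> j * complex_of_real s) * U x j)"
      by (rule integral_cong) (use j in \<open>simp add: U_semigroup(1)\<close>)
    also have "\<dots> = (exp (\<nu> j * complex_of_real t) - 1) / \<nu> j * U x j"
      using Re_\<nu>[OF j] \<mu> t by (intro integral_exp_scaled) auto
    finally show ?thesis
      using Re_\<nu>[OF j] \<mu> t j by (auto simp: U_semigroup(1) left_diff_distrib)
  qed
  have "l2 J (\<lambda>j. U (semigroup t x) j - U x j)" by (intro l2_diff U_l2)
  then have D: "integral {0..t} (\<lambda>s. semigroup s x) \<in> D"
    unfolding D_eq mem_Collect_eq by (subst l2_cong[OF U_int])
  then show "integral {0..t} (\<lambda>s. semigroup s x) \<in> D" .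
  show "semigroup t x = x + A (integral {0..t} (\<lambda>s. semigroup s x))"
    by (rule U_inject) (simp add: U_add U_A[OF D] U_int)
qed

text \<open>In each coordinate a mild solution solves a scalar integral equation, whose only continuous
solution is the exponential.\<close>

lemma mild_solution_unique:
  assumes v: "mild_solution D A x v" and t: "t \<ge> 0"
  shows "v t = semigroup t x"
proof (rule U_inject)
  fix j assume j: "j \<in> J"
  have cont: "continuous_on {0..} v" using v by (simp add: mild_solution_def)
  have "U (v t) j = exp (\<nu> j * complex_of_real t) * U x j"
  proof (rule scalar_mild_solution_unique[OF _ _ t])
    show "continuous_on {0..} (\<lambda>t. U (v t) j)"
      by (rule bounded_linear.continuous_on[OF U_bounded_linear[OF j] cont])
    fix s :: real assume "s \<ge> 0"
    then have "integral {0..s} v \<in> D" "v s = x + A (integral {0..s} v)"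
      using v by (auto simp: mild_solution_def)
    then show "U (v s) j = U x j + \<nu> j * integral {0..s} (\<lambda>t. U (v t) j)"
      using j by (simp add: U_add U_A U_integral[OF cont j])
  qed
  then show "U (v t) j = U (semigroup t x) j" using j t by (simp add: U_semigroup(1))
qed

lemma exponentially_stable: "exponentially_stable D A \<mu>"
  unfolding exponentially_stable_def
proof (intro conjI)
  show "\<exists>T. generates D A T" using generates by blast
  show "\<exists>C>0. \<forall>u0. \<exists>u. mild_solution D A u0 u \<and>
        (\<forall>v. mild_solution D A u0 v \<longrightarrow> (\<forall>t\<ge>0. v t = u t)) \<and>
        (\<forall>t\<ge>0. norm (u t) \<le> C * exp (- \<mu> * t) * norm u0)"
  proof (rule exI[of _ "sqrt (a * b)"], intro conjI allI)
    show "sqrt (a * b) > 0" using a b by simp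
    fix u0
    show "\<exists>u. mild_solution D A u0 u \<and>
        (\<forall>v. mild_solution D A u0 v \<longrightarrow> (\<forall>t\<ge>0. v t = u t)) \<and>
        (\<forall>t\<ge>0. norm (u t) \<le> sqrt (a * b) * exp (- \<mu> * t) * norm u0)"
      by (rule exI[of _ "\<lambda>t. semigroup t u0"])
         (use mild_solution_semigroup mild_solution_unique norm_semigroup_le in auto)
  qed
qed

end

section \<open>Partial fractions of interlacing products\<close>

lemma monic_linear_prod:
  fixes b :: "'i \<Rightarrow> 'a::idom"
  assumes "finite S"
  shows "degree (\<Prod>q\<in>S. [:- b q, 1:]) = card S" and "coeff (\<Prod>q\<in>S. [:- b q, 1:]) (card S) = 1"
proof -
  show *: "degree (\<Prod>q\<in>S. [:- b q, 1:]) = card S"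
    by (subst degree_prod_sum_eq) auto
  show "coeff (\<Prod>q\<in>S. [:- b q, 1:]) (card S) = 1"
    using lead_coeff_prod[of "\<lambda>q. [:- b q, 1:]" S] * by simp
qed

lemma lagrange_interpolation:
  fixes P :: "'a::field poly" and a :: "'i \<Rightarrow> 'a"
  assumes S: "finite S" "inj_on a S" and deg: "degree P < card S"
  shows "P = (\<Sum>p\<in>S. smult (poly P (a p) / (\<Prod>q\<in>S-{p}. a p - a q)) (\<Prod>q\<in>S-{p}. [:- a q, 1:]))"
    (is "_ = ?L")
proof (rule poly_eqI_degree[of "a ` S"])
  fix x assume "x \<in> a ` S"
  then obtain n where n: "n \<in> S" "x = a n" by auto
  have "poly ?L x = (\<Sum>p\<in>S. poly P (a p) / (\<Prod>q\<in>S-{p}. a p - a q) * (\<Prod>q\<in>S-{p}. a n - a q))"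
    by (simp add: poly_sum poly_prod n)
  also have "\<dots> = (\<Sum>p\<in>S. if p = n then poly P (a n) else 0)"
  proof (rule sum.cong[OF refl])
    fix p assume p: "p \<in> S"
    show "poly P (a p) / (\<Prod>q\<in>S-{p}. a p - a q) * (\<Prod>q\<in>S-{p}. a n - a q) =
        (if p = n then poly P (a n) else 0)"
    proof (cases "p = n")
      case True
      have "a n \<noteq> a q" if "q \<in> S - {n}" for q
        using inj_onD[OF S(2), of n q] that n by auto
      then have "(\<Prod>q\<in>S-{n}. a n - a q) \<noteq> 0" using S by (simp add: prod_zero_iff)
      then show ?thesis using True by simp
    next
      case False
      then have "(\<Prod>q\<in>S-{p}. a n - a q) = 0" using S n by auto
      then show ?thesis using False by simp
    qed
  qed
  also have "\<dots> = poly P x" using S n by simp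
  finally show "poly P x = poly ?L x" by simp
next
  have card: "card (a ` S) = card S" using S by (simp add: card_image)
  show "degree P < card (a ` S)" using deg card by simp
  have "degree ?L \<le> card S - 1"
  proof (rule degree_sum_le)
    fix p assume "p \<in> S"
    then show "degree (smult (poly P (a p) / (\<Prod>q\<in>S-{p}. a p - a q)) (\<Prod>q\<in>S-{p}. [:- a q, 1:])) \<le> card S - 1"
      using S by (intro order_trans[OF degree_smult_le]) (simp add: monic_linear_prod)
  qed (use S in auto)
  then show "degree ?L < card (a ` S)" using deg card by linarith
qed

text \<open>The residue at \<open>a p\<close> of the rational function \<open>\<Prod>q\<le>N. (z - b q) / (z - a q)\<close>.  It is also the
quantity that appears in the inverse of the Cauchy matrix \<open>1 / (a p - b n)\<close>.\<close>

definition weight :: "(nat \<Rightarrow> complex) \<Rightarrow> (nat \<Rightarrow> complex) \<Rightarrow> nat \<Rightarrow> nat \<Rightarrow> complex" where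
  "weight a b N p = (a p - b p) * (\<Prod>q\<in>{1..N}-{p}. (a p - b q) / (a p - a q))"

text \<open>Both identities come from the interpolation of \<open>\<Prod>q\<noteq>n. (z - b q)\<close> in the nodes \<open>a p\<close>: the first
one compares the leading coefficients, the second one the values at \<open>b n\<close>.\<close>

lemma weight_sums:
  fixes a b :: "nat \<Rightarrow> complex"
  assumes inj: "inj_on a {1..N}" "inj_on b {1..N}"
    and ab: "\<And>p q. p \<in> {1..N} \<Longrightarrow> q \<in> {1..N} \<Longrightarrow> a p \<noteq> b q" and n: "n \<in> {1..N}"
  shows "(\<Sum>p\<in>{1..N}. weight a b N p / (a p - b n)) = 1"
    and "weight b a N n * (\<Sum>p\<in>{1..N}. weight a b N p / (a p - b n)\<^sup>2) = -1"
proof -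
  define S where "S = {1..N}"
  define P where "P = (\<Prod>q\<in>S-{n}. [:- b q, 1:])"
  have S: "finite S" "n \<in> S" using n by (auto simp: S_def)
  have cS: "card (S - {p}) = card S - 1" "card S > 0" if "p \<in> S" for p
    using that S by (auto simp: card_gt_0_iff)
  have degP: "degree P = card S - 1" and coeffP: "coeff P (card S - 1) = 1"
    using monic_linear_prod[of "S - {n}" b] S cS[OF S(2)] by (simp_all add: P_def)
  have polyP: "poly P x = (\<Prod>q\<in>S-{n}. x - b q)" for x by (simp add: P_def poly_prod)
  have w: "weight a b N p / (a p - b n) = poly P (a p) / (\<Prod>q\<in>S-{p}. a p - a q)" if p: "p \<in> S" for p
  proof -
    have "(a p - b p) * (\<Prod>q\<in>S-{p}. a p - b q) = (\<Prod>q\<in>S. a p - b q)"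
      by (rule prod.remove[OF S(1) p, symmetric])
    also have "\<dots> = (a p - b n) * poly P (a p)"
      unfolding polyP by (rule prod.remove[OF S])
    finally have "weight a b N p = (a p - b n) * poly P (a p) / (\<Prod>q\<in>S-{p}. a p - a q)"
      by (simp add: weight_def S_def prod_dividef)
    moreover have "a p \<noteq> b n" using ab p n by (auto simp: S_def)
    ultimately show ?thesis by simp
  qed
  have L: "P = (\<Sum>p\<in>S. smult (weight a b N p / (a p - b n)) (\<Prod>q\<in>S-{p}. [:- a q, 1:]))"
    using lagrange_interpolation[of S a P] S inj degP cS[OF S(2)] w by (simp add: S_def)
  have "coeff (\<Sum>p\<in>S. smult (weight a b N p / (a p - b n)) (\<Prod>q\<in>S-{p}. [:- a q, 1:])) (card S - 1) =
      (\<Sum>p\<in>S. weight a b N p / (a p - b n))"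
    unfolding coeff_sum coeff_smult
  proof (rule sum.cong[OF refl])
    fix p assume p: "p \<in> S"
    have "coeff (\<Prod>q\<in>S-{p}. [:- a q, 1:]) (card S - 1) = 1"
      using monic_linear_prod(2)[of "S - {p}" a] S(1) cS(1)[OF p] by simp
    then show "weight a b N p / (a p - b n) * coeff (\<Prod>q\<in>S-{p}. [:- a q, 1:]) (card S - 1) =
        weight a b N p / (a p - b n)" by simp
  qed
  with L coeffP show "(\<Sum>p\<in>{1..N}. weight a b N p / (a p - b n)) = 1" by (simp add: S_def)
  define M where "M = (\<Prod>q\<in>S. b n - a q)"
  have nz: "(\<Prod>q\<in>S-{n}. b n - b q) \<noteq> 0"
  proof -
    have "b n \<noteq> b q" if "q \<in> S - {n}" for q
      using inj_onD[OF inj(2), of n q] that n by (auto simp: S_def)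
    then show ?thesis using S by (simp add: prod_zero_iff)
  qed
  have "(\<Prod>q\<in>S-{n}. b n - b q) = poly P (b n)" by (simp add: polyP)
  also have "\<dots> = (\<Sum>p\<in>S. weight a b N p / (a p - b n) * (\<Prod>q\<in>S-{p}. b n - a q))"
    by (subst L) (simp add: poly_sum poly_prod)
  also have "\<dots> = (\<Sum>p\<in>S. - M * (weight a b N p / (a p - b n)\<^sup>2))"
  proof (rule sum.cong[OF refl])
    fix p assume p: "p \<in> S"
    have ne: "a p \<noteq> b n" using ab p n by (auto simp: S_def)
    have "M = (b n - a p) * (\<Prod>q\<in>S-{p}. b n - a q)" unfolding M_def by (rule prod.remove[OF S(1) p])
    then have M: "- M = (a p - b n) * (\<Prod>q\<in>S-{p}. b n - a q)" by (simp add: algebra_simps)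
    have "a p - b n \<noteq> 0" using ne by simp
    then show "weight a b N p / (a p - b n) * (\<Prod>q\<in>S-{p}. b n - a q) =
        - M * (weight a b N p / (a p - b n)\<^sup>2)"
      unfolding M power2_eq_square by simp
  qed
  finally have key: "(\<Prod>q\<in>S-{n}. b n - b q) = - M * (\<Sum>p\<in>S. weight a b N p / (a p - b n)\<^sup>2)"
    by (simp only: sum_distrib_left)
  have "weight b a N n = M / (\<Prod>q\<in>S-{n}. b n - b q)"
    unfolding weight_def M_def S_def[symmetric] prod.remove[OF S, of "\<lambda>q. b n - a q"]
    by (simp add: prod_dividef)
  then have "weight b a N n * (\<Sum>p\<in>S. weight a b N p / (a p - b n)\<^sup>2) = -1"
    using key nz by (simp add: field_simps)
  then show "weight b a N n * (\<Sum>p\<in>{1..N}. weight a b N p / (a p - b n)\<^sup>2) = -1"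
    by (simp only: S_def)
qed

text \<open>Two sequences at bounded distance, with simple points that are separated well enough for the
products over all \<open>q\<close> to converge.  The hypotheses are symmetric in \<open>a\<close> and \<open>b\<close>, so that every
identity can be used in both directions.\<close>

locale interlacing =
  fixes a b :: "nat \<Rightarrow> complex" and S d :: real
  assumes a_inj: "\<And>p q. p \<ge> 1 \<Longrightarrow> q \<ge> 1 \<Longrightarrow> p \<noteq> q \<Longrightarrow> a p \<noteq> a q"
    and b_inj: "\<And>p q. p \<ge> 1 \<Longrightarrow> q \<ge> 1 \<Longrightarrow> p \<noteq> q \<Longrightarrow> b p \<noteq> b q"
    and ab: "\<And>p q. p \<ge> 1 \<Longrightarrow> q \<ge> 1 \<Longrightarrow> a p \<noteq> b q"
    and diff: "\<And>p. p \<ge> 1 \<Longrightarrow> cmod (a p - b p) \<le> d"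
    and sum_a: "\<And>p N. p \<ge> 1 \<Longrightarrow> (\<Sum>q\<in>{1..N}-{p}. 1 / cmod (a p - a q)) \<le> S"
    and sum_b: "\<And>p N. p \<ge> 1 \<Longrightarrow> (\<Sum>q\<in>{1..N}-{p}. 1 / cmod (b p - b q)) \<le> S"
    and sum_ab: "\<And>p. p \<ge> 1 \<Longrightarrow> (\<lambda>q. 1 / cmod (a q - b p)) summable_on {1..}"
    and sum_ba: "\<And>p. p \<ge> 1 \<Longrightarrow> (\<lambda>q. 1 / cmod (b q - a p)) summable_on {1..}"
begin

lemma swap: "interlacing b a S d"
proof
  show "b p \<noteq> a q" if "p \<ge> 1" "q \<ge> 1" for p q using ab[OF that(2,1)] by simp
  show "cmod (b p - a p) \<le> d" if "p \<ge> 1" for p using diff[OF that] by (simp add: norm_minus_commute)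
qed (fact b_inj a_inj sum_b sum_a sum_ba sum_ab)+

definition w :: "nat \<Rightarrow> complex" where "w p = lim (\<lambda>N. weight a b N p)"

lemma d_nonneg: "d \<ge> 0" using diff[of 1] norm_ge_zero[of "a 1 - b 1"] by linarith

lemma ratio_eq: "p \<ge> 1 \<Longrightarrow> q \<ge> 1 \<Longrightarrow> p \<noteq> q \<Longrightarrow> (a p - b q) / (a p - a q) = 1 + (a q - b q) / (a p - a q)"
  using a_inj[of p q] by (simp add: field_simps)

lemma ratio_sum_le:
  assumes "p \<ge> 1"
  shows "(\<Sum>q\<in>{1..N}-{p}. cmod ((a q - b q) / (a p - a q))) \<le> d * S"
proof -
  have "(\<Sum>q\<in>{1..N}-{p}. cmod ((a q - b q) / (a p - a q))) \<le> (\<Sum>q\<in>{1..N}-{p}. d * (1 / cmod (a p - a q)))"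
    by (intro sum_mono) (auto simp: norm_divide divide_simps diff intro!: divide_right_mono)
  also have "\<dots> \<le> d * S"
    unfolding sum_distrib_left[symmetric] by (intro mult_left_mono sum_a d_nonneg assms)
  finally show ?thesis .
qed

lemma weight_bound:
  assumes p: "p \<ge> 1"
  shows "cmod (weight a b N p) \<le> d * exp (d * S)"
proof -
  have "cmod (\<Prod>q\<in>{1..N}-{p}. (a p - b q) / (a p - a q)) \<le>
      (\<Prod>q\<in>{1..N}-{p}. 1 + cmod ((a q - b q) / (a p - a q)))"
    unfolding prod_norm[symmetric]
  proof (rule prod_mono)
    fix q assume "q \<in> {1..N} - {p}"
    then have "(a p - b q) / (a p - a q) = 1 + (a q - b q) / (a p - a q)" using ratio_eq p by auto
    then show "0 \<le> cmod ((a p - b q) / (a p - a q)) \<and>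
        cmod ((a p - b q) / (a p - a q)) \<le> 1 + cmod ((a q - b q) / (a p - a q))"
      using norm_triangle_ineq[of 1 "(a q - b q) / (a p - a q)"] by simp
  qed
  also have "\<dots> \<le> exp (\<Sum>q\<in>{1..N}-{p}. cmod ((a q - b q) / (a p - a q)))"
    by (rule prod_le_exp_sum) auto
  also have "\<dots> \<le> exp (d * S)" using ratio_sum_le[OF p] by simp
  finally show ?thesis
    unfolding weight_def norm_mult using diff[OF p] by (intro mult_mono d_nonneg) auto
qed

lemma weight_tendsto:
  assumes p: "p \<ge> 1"
  shows "(\<lambda>N. weight a b N p) \<longlonglongrightarrow> w p"
proof -
  \<comment> \<open>with the factors \<open>0\<close> and \<open>p\<close> set to \<open>1\<close>, the truncated weights are partial products of one sequence\<close>
  define f where "f i = (if i = 0 \<or> i = p then 1 else (a p - b i) / (a p - a i))" for i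
  have "summable (\<lambda>i. norm (f i - 1))"
  proof (rule bounded_imp_summable)
    fix N
    have "(\<Sum>i\<le>N. norm (f i - 1)) = (\<Sum>q\<in>{1..N}-{p}. cmod ((a q - b q) / (a p - a q)))"
      by (rule sum.mono_neutral_cong_right) (use p in \<open>auto simp: f_def ratio_eq\<close>)
    also have "\<dots> \<le> d * S" by (rule ratio_sum_le[OF p])
    finally show "(\<Sum>i\<le>N. norm (f i - 1)) \<le> d * S" .
  qed simp
  then have "convergent (\<lambda>N. \<Prod>i\<le>N. f i)"
    by (intro convergent_prod_imp_convergent abs_convergent_prod_imp_convergent_prod)
       (simp add: abs_convergent_prod_conv_summable)
  moreover have "(\<Prod>i\<le>N. f i) = (\<Prod>q\<in>{1..N}-{p}. (a p - b q) / (a p - a q))" for N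
    by (rule prod.mono_neutral_cong_right) (auto simp: f_def)
  ultimately have "convergent (\<lambda>N. \<Prod>q\<in>{1..N}-{p}. (a p - b q) / (a p - a q))" by simp
  then have "convergent (\<lambda>N. weight a b N p)"
    unfolding weight_def by (intro convergent_mult convergent_const)
  then show ?thesis by (simp add: w_def convergent_LIMSEQ_iff)
qed

lemma w_bound: "p \<ge> 1 \<Longrightarrow> cmod (w p) \<le> d * exp (d * S)"
  by (rule tendsto_upperbound[OF tendsto_norm[OF weight_tendsto]])
    (auto intro!: always_eventually simp: weight_bound)

lemma weighted_sum_tendsto:
  assumes g: "(\<lambda>p. cmod (g p)) summable_on {1..}"
  shows "(\<lambda>N. \<Sum>p\<in>{1..N}. weight a b N p * g p) \<longlonglongrightarrow> (\<Sum>\<^sub>\<infinity>p\<in>{1..}. w p * g p)"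
proof -
  have "(\<lambda>N. \<Sum>\<^sub>\<infinity>p\<in>{1..}. if p \<le> N then weight a b N p * g p else 0) \<longlonglongrightarrow> (\<Sum>\<^sub>\<infinity>p\<in>{1..}. w p * g p)"
  proof (rule infsum_dominated_tendsto)
    show "(\<lambda>p. d * exp (d * S) * cmod (g p)) summable_on {1..}"
      by (rule summable_on_cmult_right[OF g])
    show "\<forall>\<^sub>F N in sequentially. \<forall>p\<in>{1..}.
        norm (if p \<le> N then weight a b N p * g p else 0) \<le> d * exp (d * S) * cmod (g p)"
      by (intro always_eventually allI ballI)
         (auto simp: norm_mult d_nonneg intro!: mult_right_mono weight_bound)
    fix p :: nat assume "p \<in> {1..}"
    then have "(\<lambda>N. weight a b N p * g p) \<longlonglongrightarrow> w p * g p" by (intro tendsto_intros weight_tendsto) auto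
    then show "(\<lambda>N. if p \<le> N then weight a b N p * g p else 0) \<longlonglongrightarrow> w p * g p"
      by (rule Lim_transform_eventually)
         (rule eventually_mono[OF eventually_ge_at_top[of p]], simp)
  qed simp
  moreover have "(\<Sum>\<^sub>\<infinity>p\<in>{1..}. if p \<le> N then weight a b N p * g p else 0) =
      (\<Sum>p\<in>{1..N}. weight a b N p * g p)" for N
    by (subst infsum_finite[symmetric], simp, rule infsum_cong_neutral) auto
  ultimately show ?thesis by simp
qed

lemma inverse_square_summable:
  assumes n: "n \<ge> 1" and m: "m \<ge> 1"
  shows "(\<lambda>p. cmod (1 / ((a p - b n) * (a p - b m)))) summable_on {1..}"
proof (rule summable_on_comparison_test)
  define K where "K = (\<Sum>\<^sub>\<infinity>p\<in>{1..}. 1 / cmod (a p - b m))"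
  show "(\<lambda>p. K * (1 / cmod (a p - b n))) summable_on {1..}"
    by (intro summable_on_cmult_right sum_ab n)
  fix p :: nat assume p: "p \<in> {1..}"
  have "1 / cmod (a p - b m) \<le> K"
    using finite_sum_le_infsum[OF sum_ab[OF m], of "{p}"] p by (simp add: K_def)
  then have "1 / cmod (a p - b m) * (1 / cmod (a p - b n)) \<le> K * (1 / cmod (a p - b n))"
    by (rule mult_right_mono) simp
  then show "cmod (1 / ((a p - b n) * (a p - b m))) \<le> K * (1 / cmod (a p - b n))"
    by (simp add: norm_divide norm_mult mult.commute)
qed simp

lemma w_summable: "n \<ge> 1 \<Longrightarrow> (\<lambda>p. w p / (a p - b n)) summable_on {1..}"
proof (rule Infinite_Sum.abs_summable_summable, rule summable_on_comparison_test)
  assume n: "n \<ge> 1"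
  show "(\<lambda>p. d * exp (d * S) * (1 / cmod (a p - b n))) summable_on {1..}"
    by (intro summable_on_cmult_right sum_ab n)
  show "norm (w p / (a p - b n)) \<le> d * exp (d * S) * (1 / cmod (a p - b n))" if "p \<in> {1..}" for p
    using that w_bound[of p] by (auto simp: norm_divide intro!: divide_right_mono)
qed simp

lemma inj_on_init: "inj_on a {1..N}" "inj_on b {1..N}"
  unfolding inj_on_def by (metis a_inj atLeastAtMost_iff) (metis b_inj atLeastAtMost_iff)

text \<open>Formally \<open>F(z) = \<Prod>q. (z - b q) / (z - a q)\<close> has the expansion \<open>1 + (\<Sum>p. w p / (z - a p))\<close>.
The following three facts express \<open>F(b n) = 0\<close>, the value of \<open>F'(b n)\<close>, and the difference of
\<open>F(b n) = 0\<close> and \<open>F(b m) = 0\<close>.  They are obtained from the finite products by dominated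
convergence, since the truncated residues are bounded independently of the truncation.\<close>

lemma w_sum:
  assumes n: "n \<ge> 1"
  shows "(\<Sum>\<^sub>\<infinity>p\<in>{1..}. w p / (a p - b n)) = 1"
proof -
  have "(\<lambda>p. cmod (1 / (a p - b n))) summable_on {1..}" using sum_ab[OF n] by (simp add: norm_divide)
  from weighted_sum_tendsto[OF this]
  have "(\<lambda>N. \<Sum>p\<in>{1..N}. weight a b N p / (a p - b n)) \<longlonglongrightarrow> (\<Sum>\<^sub>\<infinity>p\<in>{1..}. w p / (a p - b n))" by simp
  moreover have "(\<lambda>N. \<Sum>p\<in>{1..N}. weight a b N p / (a p - b n)) \<longlonglongrightarrow> 1"
  proof (rule tendsto_eventually)
    show "\<forall>\<^sub>F N in sequentially. (\<Sum>p\<in>{1..N}. weight a b N p / (a p - b n)) = 1"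
      using eventually_ge_at_top[of n]
      by eventually_elim (rule weight_sums(1)[OF inj_on_init], use n ab in auto)
  qed
  ultimately show ?thesis by (rule LIMSEQ_unique)
qed

lemma w_sum_square:
  assumes n: "n \<ge> 1"
  shows "interlacing.w b a n * (\<Sum>\<^sub>\<infinity>p\<in>{1..}. w p / (a p - b n)\<^sup>2) = -1"
proof -
  interpret swapped: interlacing b a S d by (rule swap)
  have "(\<lambda>p. cmod (1 / (a p - b n)\<^sup>2)) summable_on {1..}"
    using inverse_square_summable[OF n n] by (simp add: power2_eq_square)
  from weighted_sum_tendsto[OF this]
  have "(\<lambda>N. \<Sum>p\<in>{1..N}. weight a b N p / (a p - b n)\<^sup>2) \<longlonglongrightarrow> (\<Sum>\<^sub>\<infinity>p\<in>{1..}. w p / (a p - b n)\<^sup>2)" by simp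
  then have "(\<lambda>N. weight b a N n * (\<Sum>p\<in>{1..N}. weight a b N p / (a p - b n)\<^sup>2))
      \<longlonglongrightarrow> swapped.w n * (\<Sum>\<^sub>\<infinity>p\<in>{1..}. w p / (a p - b n)\<^sup>2)"
    by (intro tendsto_mult swapped.weight_tendsto n)
  moreover have "(\<lambda>N. weight b a N n * (\<Sum>p\<in>{1..N}. weight a b N p / (a p - b n)\<^sup>2)) \<longlonglongrightarrow> -1"
  proof (rule tendsto_eventually)
    show "\<forall>\<^sub>F N in sequentially. weight b a N n * (\<Sum>p\<in>{1..N}. weight a b N p / (a p - b n)\<^sup>2) = -1"
      using eventually_ge_at_top[of n]
      by eventually_elim (rule weight_sums(2)[OF inj_on_init], use n ab in auto)
  qed
  ultimately show ?thesis by (rule LIMSEQ_unique)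
qed

lemma w_sum_off_diagonal:
  assumes n: "n \<ge> 1" and m: "m \<ge> 1" and ne: "n \<noteq> m"
  shows "(\<Sum>\<^sub>\<infinity>p\<in>{1..}. w p / ((a p - b n) * (a p - b m))) = 0"
proof -
  have "(\<Sum>\<^sub>\<infinity>p\<in>{1..}. w p / ((a p - b n) * (a p - b m))) =
      (\<Sum>\<^sub>\<infinity>p\<in>{1..}. (1 / (b n - b m)) * (w p / (a p - b n) + (-1) * (w p / (a p - b m))))"
  proof (rule infsum_cong)
    fix p :: nat assume "p \<in> {1..}"
    then have ne: "a p - b n \<noteq> 0" "a p - b m \<noteq> 0" "b n - b m \<noteq> 0"
      using ab[of p n] ab[of p m] b_inj[OF n m \<open>n \<noteq> m\<close>] n m by auto
    have "x / (u * v) = (1 / (v - u)) * (x / u + (-1) * (x / v))"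
      if "u \<noteq> 0" "v \<noteq> 0" "v - u \<noteq> 0" for x u v :: complex
    proof -
      have "x / u - x / v = x * (v - u) / (u * v)" using that(1,2) by (simp add: field_simps)
      then show ?thesis using that by simp
    qed
    from this[of "a p - b n" "a p - b m" "w p"] ne
    show "w p / ((a p - b n) * (a p - b m)) =
        (1 / (b n - b m)) * (w p / (a p - b n) + (-1) * (w p / (a p - b m)))"
      by simp
  qed
  also have "\<dots> = (1 / (b n - b m)) * (1 + (-1) * 1)"
    using w_sum[OF n] w_sum[OF m]
    by (simp only: infsum_cmult_right' infsum_add[OF w_summable[OF n] summable_on_cmult_right[OF w_summable[OF m]]])
  finally show ?thesis by simp
qed

end

section \<open>Kernel estimates\<close>

definition zeta_sum :: "real \<Rightarrow> real" where
  "zeta_sum e = (\<Sum>\<^sub>\<infinity>k\<in>{1..}. real k powr (- e))"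

lemma zeta_summable: "e > 1 \<Longrightarrow> (\<lambda>k. real k powr (- e)) summable_on {1..}"
proof -
  assume "e > 1"
  then have "summable (\<lambda>k. real k powr (- e))" by (simp add: summable_real_powr_iff)
  then have "(\<lambda>k. real k powr (- e)) summable_on UNIV" by (intro summable_nonneg_imp_summable_on) auto
  then show ?thesis by (rule summable_on_subset_banach) auto
qed

lemma sum_le_zeta: "e > 1 \<Longrightarrow> finite F \<Longrightarrow> F \<subseteq> {1..} \<Longrightarrow> (\<Sum>k\<in>F. real k powr (- e)) \<le> zeta_sum e"
  unfolding zeta_sum_def by (rule finite_sum_le_infsum[OF zeta_summable]) auto

lemma zeta_sum_nonneg: "0 \<le> zeta_sum e"
  unfolding zeta_sum_def by (rule infsum_nonneg) auto

lemma shifted_sum_le_zeta: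
  assumes e: "e > 1" and F: "finite F" "F \<subseteq> {1..}"
  shows "(\<Sum>n\<in>F-{p}. \<bar>real p - real n\<bar> powr (- e)) \<le> 2 * zeta_sum e"
proof -
  have "(\<Sum>n\<in>{n\<in>F. n < p}. \<bar>real p - real n\<bar> powr (- e)) = (\<Sum>k\<in>(\<lambda>n. p - n) ` {n\<in>F. n < p}. real k powr (- e))"
    by (subst sum.reindex) (auto simp: inj_on_def of_nat_diff intro!: sum.cong)
  also have "\<dots> \<le> zeta_sum e" by (rule sum_le_zeta[OF e]) (use F in auto)
  finally have 1: "(\<Sum>n\<in>{n\<in>F. n < p}. \<bar>real p - real n\<bar> powr (- e)) \<le> zeta_sum e" .
  have "(\<Sum>n\<in>{n\<in>F. n > p}. \<bar>real p - real n\<bar> powr (- e)) = (\<Sum>k\<in>(\<lambda>n. n - p) ` {n\<in>F. n > p}. real k powr (- e))"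
    by (subst sum.reindex) (auto simp: inj_on_def of_nat_diff intro!: sum.cong)
  also have "\<dots> \<le> zeta_sum e" by (rule sum_le_zeta[OF e]) (use F in auto)
  finally have 2: "(\<Sum>n\<in>{n\<in>F. n > p}. \<bar>real p - real n\<bar> powr (- e)) \<le> zeta_sum e" .
  have "F - {p} = {n\<in>F. n < p} \<union> {n\<in>F. n > p}" by auto
  then have "(\<Sum>n\<in>F-{p}. \<bar>real p - real n\<bar> powr (- e)) =
      (\<Sum>n\<in>{n\<in>F. n < p}. \<bar>real p - real n\<bar> powr (- e)) + (\<Sum>n\<in>{n\<in>F. n > p}. \<bar>real p - real n\<bar> powr (- e))"
    using F by (simp add: sum.union_disjoint disjoint_iff)
  with 1 2 show ?thesis by linarith
qed

lemma powr_div_self: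
  fixes u \<eta> :: real
  assumes "u > 0" shows "u powr (- \<eta>) / u = u powr (- (1 + \<eta>))"
proof -
  have "- (1 + \<eta>) = - \<eta> - 1" by simp
  then have "u powr (- (1 + \<eta>)) = u powr (- \<eta> - 1)" by (simp only:)
  also have "\<dots> = u powr (- \<eta>) / u powr 1" by (rule powr_diff)
  finally show ?thesis using assms by simp
qed

text \<open>Near the diagonal the row sums of this kernel carry a logarithm.  The bound does without it, since
part of the decay \<open>max x y powr (- \<beta>)\<close> is spent on making both terms on the right summable in \<open>y\<close>.
For \<open>y < x\<close> the second term comes from \<open>x / (y (x - y)) = 1 / y + 1 / (x - y)\<close>.\<close>

lemma kernel_bound:
  fixes x y s \<beta> \<eta> :: real
  assumes x: "x \<ge> 1" and y: "y \<ge> 1" and xy: "\<bar>x - y\<bar> \<ge> 1"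
    and \<eta>: "\<eta> > 0" "\<eta> \<le> \<beta>" "\<eta> \<le> \<beta> + s" "\<eta> \<le> \<beta> + 1 - s"
  shows "(x / y) powr s * max x y powr (- \<beta>) / \<bar>x - y\<bar> \<le> \<bar>x - y\<bar> powr (- (1 + \<eta>)) + y powr (- (1 + \<eta>))"
proof (cases "x < y")
  case True
  \<comment> \<open>the growth of \<open>(x / y) powr s\<close> in \<open>y\<close> is at most that of \<open>y powr t\<close>, and \<open>t \<le> \<beta> - \<eta>\<close>\<close>
  define t where "t = max 0 (- s)"
  have t: "t \<ge> 0" "- s \<le> t" "t - \<beta> \<le> - \<eta>" using \<eta> by (auto simp: t_def)
  have "(x / y) powr s = (y / x) powr (- s)" using x y by (simp add: powr_divide powr_minus field_simps)
  also have "\<dots> \<le> (y / x) powr t" using True x t by (intro powr_mono) auto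
  also have "\<dots> \<le> y powr t" using x y t by (intro powr_mono2) (auto simp: field_simps)
  finally have "(x / y) powr s * y powr (- \<beta>) \<le> y powr t * y powr (- \<beta>)" by (rule mult_right_mono) simp
  also have "\<dots> = y powr (t - \<beta>)" by (simp flip: powr_add)
  also have "\<dots> \<le> y powr (- \<eta>)" using y t by (intro powr_mono) auto
  also have "\<dots> \<le> (y - x) powr (- \<eta>)" using True x \<eta> by (intro powr_mono2') auto
  finally have "(x / y) powr s * y powr (- \<beta>) / (y - x) \<le> (y - x) powr (- \<eta>) / (y - x)"
    using True by (intro divide_right_mono) auto
  also have "\<dots> = (y - x) powr (- (1 + \<eta>))" using True by (intro powr_div_self) simp
  also have "\<dots> \<le> (y - x) powr (- (1 + \<eta>)) + y powr (- (1 + \<eta>))" by simp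
  finally show ?thesis using True by (simp add: max_def abs_if)
next
  case False
  then have yx: "y < x" using xy by auto
  \<comment> \<open>one power of \<open>x / y\<close> is kept for the identity below, the other \<open>t\<close> powers cost \<open>x powr t\<close>\<close>
  define t where "t = max 0 (s - 1)"
  have t: "t \<ge> 0" "s \<le> 1 + t" "t - \<beta> \<le> - \<eta>" using \<eta> by (auto simp: t_def)
  have "(x / y) powr s \<le> (x / y) powr (1 + t)" using yx y t by (intro powr_mono) auto
  also have "\<dots> = (x / y) * (x / y) powr t" using x y by (simp add: powr_add)
  also have "\<dots> \<le> (x / y) * x powr t"
    using x y t by (intro mult_left_mono powr_mono2) (auto simp: field_simps)
  finally have "(x / y) powr s * x powr (- \<beta>) \<le> (x / y) * x powr t * x powr (- \<beta>)"
    by (rule mult_right_mono) simp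
  also have "\<dots> = (x / y) * x powr (t - \<beta>)" by (simp add: mult.assoc flip: powr_add)
  also have "\<dots> \<le> (x / y) * x powr (- \<eta>)" using x y t by (intro mult_left_mono powr_mono) auto
  finally have "(x / y) powr s * x powr (- \<beta>) / (x - y) \<le> (x / y) * x powr (- \<eta>) / (x - y)"
    using yx by (intro divide_right_mono) auto
  also have "\<dots> = x powr (- \<eta>) / (x - y) + x powr (- \<eta>) / y"
    using x y yx by (simp add: field_simps)
  also have "\<dots> \<le> (x - y) powr (- \<eta>) / (x - y) + y powr (- \<eta>) / y"
    using x y yx \<eta> by (intro add_mono divide_right_mono powr_mono2') auto
  also have "\<dots> = (x - y) powr (- (1 + \<eta>)) + y powr (- (1 + \<eta>))"
    using y yx by (simp add: powr_div_self)
  finally show ?thesis using yx by (simp add: max_def)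
qed

lemma kernel_sum_le:
  fixes s \<beta> \<eta> :: real
  assumes p: "p \<ge> 1" and F: "finite F" "F \<subseteq> {1..}"
    and \<eta>: "\<eta> > 0" "\<eta> \<le> \<beta>" "\<eta> \<le> \<beta> + s" "\<eta> \<le> \<beta> + 1 - s"
  shows "(\<Sum>n\<in>F-{p}. (real p / real n) powr s * real (max p n) powr (- \<beta>) / \<bar>real p - real n\<bar>)
     \<le> 3 * zeta_sum (1 + \<eta>)"
proof -
  have "(\<Sum>n\<in>F-{p}. (real p / real n) powr s * real (max p n) powr (- \<beta>) / \<bar>real p - real n\<bar>)
     \<le> (\<Sum>n\<in>F-{p}. \<bar>real p - real n\<bar> powr (- (1 + \<eta>)) + real n powr (- (1 + \<eta>)))"
  proof (rule sum_mono)
    fix n assume n: "n \<in> F - {p}"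
    have "real p \<ge> 1" "real n \<ge> 1" "\<bar>real p - real n\<bar> \<ge> 1" using n p F by auto
    from kernel_bound[OF this \<eta>]
    show "(real p / real n) powr s * real (max p n) powr (- \<beta>) / \<bar>real p - real n\<bar>
       \<le> \<bar>real p - real n\<bar> powr (- (1 + \<eta>)) + real n powr (- (1 + \<eta>))"
      by (simp add: of_nat_max)
  qed
  also have "\<dots> \<le> 2 * zeta_sum (1 + \<eta>) + zeta_sum (1 + \<eta>)"
    unfolding sum.distrib using \<eta> F by (intro add_mono shifted_sum_le_zeta sum_le_zeta) auto
  finally show ?thesis by simp
qed

lemma powr_weight_row:
  fixes x y r :: real
  assumes "x > 0" "y > 0"
  shows "x powr r * (y powr (- r) * y powr (- 1 / 2)) = x powr (- 1 / 2) * (x / y) powr (r + 1 / 2)"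
proof -
  have "r * ln x + (- r * ln y + - 1 / 2 * ln y) = - 1 / 2 * ln x + (r + 1 / 2) * (ln x - ln y)"
    by (simp add: field_simps)
  moreover have "x powr a = exp (a * ln x)" "y powr a = exp (a * ln y)"
    "(x / y) powr a = exp (a * (ln x - ln y))" "(y / x) powr a = exp (a * (ln y - ln x))" for a
    using assms by (simp_all add: powr_def ln_div)
  ultimately show ?thesis by (simp only: exp_add[symmetric])
qed

lemma powr_weight_column:
  fixes x y r :: real
  assumes "x > 0" "y > 0"
  shows "y powr (- 1 / 2) * (y / x) powr (r + 1 / 2) * x powr (1 / 2) * y powr (- 1 / 2) =
      x powr (- 1 / 2) * (x / y) powr (1 / 2 - r)"
proof -
  have "- 1 / 2 * ln y + (r + 1 / 2) * (ln y - ln x) + 1 / 2 * ln x + - 1 / 2 * ln y =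
      - 1 / 2 * ln x + (1 / 2 - r) * (ln x - ln y)"
    by (simp add: field_simps)
  moreover have "x powr a = exp (a * ln x)" "y powr a = exp (a * ln y)"
    "(x / y) powr a = exp (a * (ln x - ln y))" "(y / x) powr a = exp (a * (ln y - ln x))" for a
    using assms by (simp_all add: powr_def ln_div)
  ultimately show ?thesis by (simp only: exp_add[symmetric])
qed

text \<open>With the weight \<open>n powr (-1/2)\<close> the rows lead to the exponent \<open>s = r + 1/2\<close> and the columns to
\<open>s = 1/2 - r\<close> in the kernel estimate.  In both cases the requirement \<open>- \<beta> < s < 1 + \<beta>\<close> with
\<open>\<beta> = al - 1 - ga\<close> is exactly the assumption on \<open>r\<close>.\<close>

lemma kernel_schur:
  fixes A :: "nat \<Rightarrow> nat \<Rightarrow> complex"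
  assumes ga: "0 \<le> ga" "ga < al - 1" and r: "1 / 2 - al + ga < r" "r < al - 1 / 2 - ga"
    and L: "L \<ge> 0" "L0 \<ge> 0"
    and diag: "\<And>p. p \<ge> 1 \<Longrightarrow> cmod (A p p) \<le> L0"
    and off: "\<And>p n. p \<ge> 1 \<Longrightarrow> n \<ge> 1 \<Longrightarrow> p \<noteq> n \<Longrightarrow> cmod (A p n) \<le>
        L * (real p powr (r + ga) * real n powr (- r) * real (max p n) powr (1 - al) / \<bar>real p - real n\<bar>)"
  shows "\<exists>M. schur {1..} (\<lambda>n. real n powr (- 1 / 2)) M A"
proof -
  define \<beta> where "\<beta> = al - 1 - ga"
  define \<eta> where "\<eta> = min \<beta> (min (\<beta> + (r + 1 / 2)) (\<beta> + (1 / 2 - r)))"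
  have \<eta>: "\<eta> > 0" "\<eta> \<le> \<beta>" "\<eta> \<le> \<beta> + (r + 1 / 2)" "\<eta> \<le> \<beta> + 1 - (r + 1 / 2)"
    "\<eta> \<le> \<beta> + (1 / 2 - r)" "\<eta> \<le> \<beta> + 1 - (1 / 2 - r)"
    using ga r by (auto simp: \<eta>_def \<beta>_def)
  have row: "cmod (A p n) * real n powr (- 1 / 2) \<le>
      L * real p powr (- 1 / 2) *
        ((real p / real n) powr (r + 1 / 2) * real (max p n) powr (- \<beta>) / \<bar>real p - real n\<bar>)"
    if "p \<ge> 1" "n \<ge> 1" "p \<noteq> n" for p n
  proof -
    have pos: "real p > 0" "real n > 0" "real (max p n) > 0" "\<bar>real p - real n\<bar> > 0" using that by auto
    have "real p powr (r + ga) * real (max p n) powr (1 - al)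
        = real p powr r * (real p powr ga * real (max p n) powr (1 - al))"
      by (simp add: powr_add)
    also have "\<dots> \<le> real p powr r * (real (max p n) powr ga * real (max p n) powr (1 - al))"
      using ga by (intro mult_left_mono mult_right_mono powr_mono2) auto
    also have "\<dots> = real p powr r * real (max p n) powr (ga + (1 - al))" by (simp only: powr_add)
    also have "ga + (1 - al) = - \<beta>" by (simp add: \<beta>_def)
    finally have 1: "real p powr (r + ga) * real (max p n) powr (1 - al) \<le> real p powr r * real (max p n) powr (- \<beta>)" .
    have 2: "real p powr r * (real n powr (- r) * real n powr (- 1 / 2)) =
        real p powr (- 1 / 2) * (real p / real n) powr (r + 1 / 2)"
      by (rule powr_weight_row) (use pos in auto)
    have "cmod (A p n) * real n powr (- 1 / 2) \<le>
        L * (real p powr (r + ga) * real n powr (- r) * real (max p n) powr (1 - al) / \<bar>real p - real n\<bar>)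
          * real n powr (- 1 / 2)"
      by (rule mult_right_mono[OF off[OF that]]) simp
    also have "\<dots> = (L * real n powr (- r) * real n powr (- 1 / 2) / \<bar>real p - real n\<bar>) *
        (real p powr (r + ga) * real (max p n) powr (1 - al))" by simp
    also have "\<dots> \<le> (L * real n powr (- r) * real n powr (- 1 / 2) / \<bar>real p - real n\<bar>) *
        (real p powr r * real (max p n) powr (- \<beta>))"
      by (rule mult_left_mono[OF 1]) (use L in simp)
    also have "\<dots> = L * (real p powr r * (real n powr (- r) * real n powr (- 1 / 2))) *
        (real (max p n) powr (- \<beta>) / \<bar>real p - real n\<bar>)" by simp
    also have "\<dots> = L * real p powr (- 1 / 2) *
        ((real p / real n) powr (r + 1 / 2) * real (max p n) powr (- \<beta>) / \<bar>real p - real n\<bar>)"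
      unfolding 2 by simp
    finally show ?thesis .
  qed
  have column: "cmod (A n p) * real n powr (- 1 / 2) \<le>
      L * real p powr (- 1 / 2) *
        ((real p / real n) powr (1 / 2 - r) * real (max p n) powr (- \<beta>) / \<bar>real p - real n\<bar>)"
    if "p \<ge> 1" "n \<ge> 1" "p \<noteq> n" for p n
  proof -
    have pos: "real p > 0" "real n > 0" "real n \<noteq> 0" "real p \<noteq> 0" using that by auto
    have "cmod (A n p) = cmod (A n p) * real p powr (- 1 / 2) * real p powr (1 / 2)"
      using pos by (simp add: mult.assoc flip: powr_add)
    also have "\<dots> \<le> (L * real n powr (- 1 / 2) *
        ((real n / real p) powr (r + 1 / 2) * real (max n p) powr (- \<beta>) / \<bar>real n - real p\<bar>)) * real p powr (1 / 2)"
      by (intro mult_right_mono row) (use that in auto)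
    finally have "cmod (A n p) * real n powr (- 1 / 2) \<le> (L * real n powr (- 1 / 2) *
        ((real n / real p) powr (r + 1 / 2) * real (max n p) powr (- \<beta>) / \<bar>real n - real p\<bar>)) * real p powr (1 / 2)
        * real n powr (- 1 / 2)" by (rule mult_right_mono) simp
    also have "\<dots> = L * (real n powr (- 1 / 2) * (real n / real p) powr (r + 1 / 2) * real p powr (1 / 2)
        * real n powr (- 1 / 2)) * (real (max p n) powr (- \<beta>) / \<bar>real p - real n\<bar>)"
      by (simp add: max.commute abs_minus_commute)
    also have "real n powr (- 1 / 2) * (real n / real p) powr (r + 1 / 2) * real p powr (1 / 2)
        * real n powr (- 1 / 2) = real p powr (- 1 / 2) * (real p / real n) powr (1 / 2 - r)"
      by (rule powr_weight_column) (use pos in auto)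
    finally show ?thesis by simp
  qed
  have "schur {1..} (\<lambda>n. real n powr (- 1 / 2)) (L0 + L * (3 * zeta_sum (1 + \<eta>))) A"
    unfolding schur_def
  proof (intro conjI ballI allI impI)
    show "0 \<le> L0 + L * (3 * zeta_sum (1 + \<eta>))" using L zeta_sum_nonneg by simp
  next
    fix p :: nat and F :: "nat set" assume "p \<in> {1..}" and F0: "finite F \<and> F \<subseteq> {1..}"
    then have p: "p \<ge> 1" and F: "finite F" "F \<subseteq> {1..}" by auto
    have split: "(\<Sum>n\<in>F. g n * real n powr (- 1 / 2)) \<le> (L0 + L * (3 * zeta_sum (1 + \<eta>))) * real p powr (- 1 / 2)"
      if g0: "g p \<le> L0" "g p \<ge> 0"
        and g: "\<And>n. n \<ge> 1 \<Longrightarrow> p \<noteq> n \<Longrightarrow> g n * real n powr (- 1 / 2) \<le> L * real p powr (- 1 / 2) *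
        ((real p / real n) powr s * real (max p n) powr (- \<beta>) / \<bar>real p - real n\<bar>)"
        and s: "\<eta> \<le> \<beta> + s" "\<eta> \<le> \<beta> + 1 - s" for g s
    proof -
      have "(\<Sum>n\<in>F. g n * real n powr (- 1 / 2)) \<le> g p * real p powr (- 1 / 2) + (\<Sum>n\<in>F-{p}. g n * real n powr (- 1 / 2))"
        using F g0 by (cases "p \<in> F") (auto simp: sum.remove)
      also have "\<dots> \<le> L0 * real p powr (- 1 / 2) + (\<Sum>n\<in>F-{p}. L * real p powr (- 1 / 2) *
        ((real p / real n) powr s * real (max p n) powr (- \<beta>) / \<bar>real p - real n\<bar>))"
        by (intro add_mono sum_mono g mult_right_mono g0) (use F in auto)
      also have "\<dots> \<le> L0 * real p powr (- 1 / 2) + L * real p powr (- 1 / 2) * (3 * zeta_sum (1 + \<eta>))"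
        unfolding sum_distrib_left[symmetric]
        by (intro add_left_mono mult_left_mono kernel_sum_le) (use L p F \<eta> s in auto)
      finally show ?thesis by (simp add: algebra_simps)
    qed
    show "(\<Sum>n\<in>F. cmod (A p n) * real n powr (- 1 / 2)) \<le> (L0 + L * (3 * zeta_sum (1 + \<eta>))) * real p powr (- 1 / 2)"
      by (rule split[of _ "r + 1 / 2"]) (use diag row p \<eta> in auto)
    show "(\<Sum>n\<in>F. cmod (A n p) * real n powr (- 1 / 2)) \<le> (L0 + L * (3 * zeta_sum (1 + \<eta>))) * real p powr (- 1 / 2)"
      by (rule split[of _ "1 / 2 - r"]) (use diag column p \<eta> in auto)
  qed auto
  then show ?thesis by blast
qed

section \<open>The feedback for one input\<close>

lemma gap_max:
  fixes lam :: "nat \<Rightarrow> complex"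
  assumes gap: "\<And>n p. n \<ge> 1 \<Longrightarrow> p \<ge> 1 \<Longrightarrow>
      cmod (lam n - lam p) \<ge> c * real n powr (al - 1) * \<bar>real n - real p\<bar>"
    and "n \<ge> 1" "p \<ge> 1"
  shows "cmod (lam n - lam p) \<ge> c * real (max n p) powr (al - 1) * \<bar>real n - real p\<bar>"
  using gap[of n p] gap[of p n] assms(2,3)
  by (cases "n \<le> p") (simp_all add: max_def norm_minus_commute abs_minus_commute)

text \<open>For large indices the gap between the \<open>lam n\<close> dominates the shift \<open>m\<close>; the finitely many
remaining pairs contribute a minimum of positive numbers.\<close>

lemma shifted_gap:
  fixes lam :: "nat \<Rightarrow> complex"
  assumes al: "al > 1" and c: "c > 0" and m: "m > 0"
    and gap: "\<And>n p. n \<ge> 1 \<Longrightarrow> p \<ge> 1 \<Longrightarrow>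
      cmod (lam n - lam p) \<ge> c * real n powr (al - 1) * \<bar>real n - real p\<bar>"
    and generic: "\<And>n p. n \<ge> 1 \<Longrightarrow> p \<ge> 1 \<Longrightarrow> lam n - complex_of_real m \<noteq> lam p"
  shows "\<exists>c'>0. \<forall>n\<ge>1. \<forall>p\<ge>1. n \<noteq> p \<longrightarrow>
     c' * real (max n p) powr (al - 1) * \<bar>real n - real p\<bar> \<le> cmod (lam p - (lam n - complex_of_real m))"
proof -
  have "filterlim (\<lambda>n. real n powr (al - 1)) at_top sequentially"
    by (rule filterlim_compose[OF real_powr_at_top filterlim_real_sequentially]) (use al in simp)
  then have "\<forall>\<^sub>F n in sequentially. 2 * m / c \<le> real n powr (al - 1)"
    by (simp add: filterlim_at_top)
  \<comment> \<open>from \<open>N\<close> on half of the gap is at least the shift\<close>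
  then obtain N where N: "\<And>n. n \<ge> N \<Longrightarrow> 2 * m / c \<le> real n powr (al - 1)"
    by (auto simp: eventually_sequentially)
  define q where "q = (\<lambda>(n, p). cmod (lam p - (lam n - complex_of_real m)) /
      (real (max n p) powr (al - 1) * \<bar>real n - real p\<bar>))"
  define S where "S = {(n, p). n \<in> {1..N} \<and> p \<in> {1..N} \<and> n \<noteq> p}"
  have "finite S" by (rule finite_subset[of _ "{1..N} \<times> {1..N}"]) (auto simp: S_def)
  define c' where "c' = Min (insert (c / 2) (q ` S))"
  have den: "real (max n p) powr (al - 1) * \<bar>real n - real p\<bar> > 0" if "n \<ge> 1" "p \<ge> 1" "n \<noteq> p" for n p
    using that by (intro mult_pos_pos) auto
  have "x > 0" if "x \<in> insert (c / 2) (q ` S)" for x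
  proof -
    have "q (n, p) > 0" if "(n, p) \<in> S" for n p
    proof -
      have np: "n \<ge> 1" "p \<ge> 1" "n \<noteq> p" using that by (auto simp: S_def)
      have "lam p - (lam n - complex_of_real m) \<noteq> 0" using generic[OF np(1,2)] by auto
      then show ?thesis using den[OF np] by (simp add: q_def)
    qed
    then show ?thesis using that c by auto
  qed
  then have c': "c' > 0" using \<open>finite S\<close> by (simp add: c'_def)
  have "c' * real (max n p) powr (al - 1) * \<bar>real n - real p\<bar> \<le> cmod (lam p - (lam n - complex_of_real m))"
    if np: "n \<ge> 1" "p \<ge> 1" "n \<noteq> p" for n p
  proof (cases "n \<le> N \<and> p \<le> N")
    case True
    then have "(n, p) \<in> S" using np by (auto simp: S_def)
    then have "c' \<le> q (n, p)" using \<open>finite S\<close> by (auto simp: c'_def intro!: Min_le)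
    then have "c' \<le> cmod (lam p - (lam n - complex_of_real m)) /
       (real (max n p) powr (al - 1) * \<bar>real n - real p\<bar>)" by (simp add: q_def)
    then show ?thesis unfolding pos_le_divide_eq[OF den[OF np]] by (simp add: mult.assoc)
  next
    case False
    then have "max n p \<ge> N" by auto
    from N[OF this] have "2 * m \<le> c * real (max n p) powr (al - 1)"
      using c by (simp add: pos_divide_le_eq mult.commute)
    also have "\<dots> = c * real (max n p) powr (al - 1) * 1" by simp
    also have "\<dots> \<le> c * real (max n p) powr (al - 1) * \<bar>real n - real p\<bar>"
      by (rule mult_left_mono) (use np c in auto)
    finally have *: "2 * m \<le> c * real (max n p) powr (al - 1) * \<bar>real n - real p\<bar>" .
    have "cmod (lam n - lam p) \<le> cmod (lam p - (lam n - complex_of_real m)) + m"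
      using norm_triangle_ineq4[of "complex_of_real m" "lam p - (lam n - complex_of_real m)"] m
      by (simp add: algebra_simps)
    with gap_max[of c al lam, OF gap np(1,2)]
    have "c * real (max n p) powr (al - 1) * \<bar>real n - real p\<bar> \<le> cmod (lam p - (lam n - complex_of_real m)) + m"
      by linarith
    with * have "c / 2 * real (max n p) powr (al - 1) * \<bar>real n - real p\<bar> \<le> cmod (lam p - (lam n - complex_of_real m))"
      by linarith
    moreover have "c' \<le> c / 2" unfolding c'_def by (rule Min_le) (use \<open>finite S\<close> in auto)
    then have "c' * (real (max n p) powr (al - 1) * \<bar>real n - real p\<bar>) \<le>
        c / 2 * (real (max n p) powr (al - 1) * \<bar>real n - real p\<bar>)"
      by (rule mult_right_mono) simp
    ultimately show ?thesis by (simp add: mult.assoc)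
  qed
  with c' show ?thesis by blast
qed

lemma l2_powr: "e < - 1 / 2 \<Longrightarrow> l2 {1..} (\<lambda>p. complex_of_real (real p powr e))"
proof -
  assume e: "e < - 1 / 2"
  have "(\<lambda>p. real p powr (- (- 2 * e))) summable_on {1..}" by (rule zeta_summable) (use e in simp)
  moreover have "(cmod (complex_of_real (real p powr e)))\<^sup>2 = real p powr (- (- 2 * e))" for p
    by (simp add: power2_eq_square flip: powr_add)
  ultimately show ?thesis by (simp add: l2_def)
qed

text \<open>Cauchy--Schwarz after splitting \<open>p powr (- r) = p powr (- r - s) * p powr s\<close>; the first factor is
square summable precisely for \<open>s > 1/2 - r\<close>.\<close>

lemma weighted_pairing_summable:
  assumes k: "\<And>p. p \<ge> 1 \<Longrightarrow> cmod (k p) \<le> M * real p powr (- r)"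
    and s: "s > 1 / 2 - r" and f: "l2 {1..} (\<lambda>p. complex_of_real (real p powr s) * f p)"
  shows "(\<lambda>p. cmod (k p * f p)) summable_on {1..}"
    and "(\<Sum>\<^sub>\<infinity>p\<in>{1..}. cmod (k p * f p)) \<le>
       M * (sqrt (sqsum {1..} (\<lambda>p. complex_of_real (real p powr (- r - s)))) *
         sqrt (sqsum {1..} (\<lambda>p. complex_of_real (real p powr s) * f p)))"
proof -
  define g where "g = (\<lambda>p. complex_of_real (real p powr (- r - s)))"
  define h where "h = (\<lambda>p. complex_of_real (real p powr s) * f p)"
  have M: "M \<ge> 0" using order_trans[OF norm_ge_zero k[of 1]] by simp
  have g: "l2 {1..} g" unfolding g_def by (rule l2_powr) (use s in simp)
  have h: "l2 {1..} h" using f by (simp add: h_def)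
  have le: "cmod (k p * f p) \<le> M * (cmod (g p) * cmod (h p))" if "p \<in> {1..}" for p
  proof -
    have "cmod (k p * f p) \<le> M * real p powr (- r) * cmod (f p)"
      unfolding norm_mult by (rule mult_right_mono[OF k]) (use that in auto)
    also have "real p powr (- r) = real p powr (- r - s) * real p powr s" by (simp flip: powr_add)
    also have "M * (real p powr (- r - s) * real p powr s) * cmod (f p) = M * (cmod (g p) * cmod (h p))"
      by (simp add: g_def h_def norm_mult)
    finally show ?thesis .
  qed
  have dom: "(\<lambda>p. M * (cmod (g p) * cmod (h p))) summable_on {1..}"
    by (rule summable_on_cmult_right[OF l2_mult_summable(1)[OF g h]])
  show *: "(\<lambda>p. cmod (k p * f p)) summable_on {1..}"
    by (rule summable_on_comparison_test[OF dom le]) auto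
  have "(\<Sum>\<^sub>\<infinity>p\<in>{1..}. cmod (k p * f p)) \<le> (\<Sum>\<^sub>\<infinity>p\<in>{1..}. M * (cmod (g p) * cmod (h p)))"
    by (rule infsum_mono[OF * dom le])
  also have "\<dots> = M * (\<Sum>\<^sub>\<infinity>p\<in>{1..}. cmod (g p) * cmod (h p))" by (rule infsum_cmult_right')
  also have "\<dots> \<le> M * (sqrt (sqsum {1..} g) * sqrt (sqsum {1..} h))"
    by (rule mult_left_mono[OF l2_mult_summable(2)[OF g h] M])
  finally show "(\<Sum>\<^sub>\<infinity>p\<in>{1..}. cmod (k p * f p)) \<le>
       M * (sqrt (sqsum {1..} (\<lambda>p. complex_of_real (real p powr (- r - s)))) *
         sqrt (sqsum {1..} (\<lambda>p. complex_of_real (real p powr s) * f p)))"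
    by (simp add: g_def h_def)
qed

text \<open>One scalar input \<open>b\<close> acting on a diagonal system with eigenvalues \<open>lam\<close>.  All eigenvalues are to be
moved by the same amount \<open>m\<close> to the left; \<open>generic\<close> keeps the new eigenvalues apart from the
old ones, and \<open>c'\<close> measures the gaps between both families.\<close>

locale single_input =
  fixes lam b :: "nat \<Rightarrow> complex" and al ga r c c1 c2 \<omega> m c' :: real
  assumes al: "al > 1" and c: "c > 0" and c1: "c1 > 0" and c2: "c2 > 0" and m: "m > 0" and c': "c' > 0"
    and growth: "\<And>n. n \<ge> 1 \<Longrightarrow> c * real n powr al \<le> cmod (lam n) + 1"
    and gap: "\<And>n p. n \<ge> 1 \<Longrightarrow> p \<ge> 1 \<Longrightarrow>
      c * real n powr (al - 1) * \<bar>real n - real p\<bar> \<le> cmod (lam n - lam p)"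
    and ga: "0 \<le> ga" "ga < al - 1"
    and r: "1 / 2 - al + ga < r" "r < al - 1 / 2 - ga"
    and b_lower: "\<And>n. n \<ge> 1 \<Longrightarrow> c1 * real n powr r \<le> cmod (b n)"
    and b_upper: "\<And>n. n \<ge> 1 \<Longrightarrow> cmod (b n) \<le> c2 * real n powr (r + ga)"
    and Re_lam: "\<And>n. n \<ge> 1 \<Longrightarrow> Re (lam n) \<le> \<omega>"
    and generic: "\<And>n p. n \<ge> 1 \<Longrightarrow> p \<ge> 1 \<Longrightarrow> lam n - complex_of_real m \<noteq> lam p"
    and gap': "\<And>n p. n \<ge> 1 \<Longrightarrow> p \<ge> 1 \<Longrightarrow> n \<noteq> p \<Longrightarrow>
      c' * real (max n p) powr (al - 1) * \<bar>real n - real p\<bar> \<le> cmod (lam p - (lam n - complex_of_real m))"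
begin

definition nu :: "nat \<Rightarrow> complex" where "nu n = lam n - complex_of_real m"

lemma b_nonzero: "n \<ge> 1 \<Longrightarrow> b n \<noteq> 0"
  using b_lower[of n] c1 by (auto simp: mult_le_0_iff)

lemma inverse_gap_le:
  assumes np: "n \<ge> 1" "p \<ge> 1" "n \<noteq> p" and k: "k > 0"
    and x: "k * real (max n p) powr (al - 1) * \<bar>real n - real p\<bar> \<le> x"
  shows "1 / x \<le> 1 / k * \<bar>real n - real p\<bar> powr (- al)"
proof -
  have pos: "\<bar>real n - real p\<bar> > 0" using np by auto
  have "k * \<bar>real n - real p\<bar> powr al = k * (\<bar>real n - real p\<bar> powr (al - 1) * \<bar>real n - real p\<bar>)"
    using pos by (simp add: powr_diff)
  also have "\<dots> \<le> k * (real (max n p) powr (al - 1) * \<bar>real n - real p\<bar>)"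
    by (intro mult_left_mono mult_right_mono powr_mono2) (use al k in auto)
  also have "\<dots> \<le> x" using x by (simp add: mult.assoc)
  finally have "k * \<bar>real n - real p\<bar> powr al \<le> x" .
  then have "1 / x \<le> 1 / (k * \<bar>real n - real p\<bar> powr al)"
    using pos k by (intro divide_left_mono mult_pos_pos) (auto intro: less_le_trans[rotated])
  then show ?thesis by (simp add: powr_minus divide_inverse)
qed

lemma inverse_shifted_gap_summable:
  assumes n: "n \<ge> 1"
    and x: "\<And>p. p \<ge> 1 \<Longrightarrow> p \<noteq> n \<Longrightarrow> c' * real (max n p) powr (al - 1) * \<bar>real n - real p\<bar> \<le> x p"
      "x n \<ge> 0"
  shows "(\<lambda>p. 1 / x p) summable_on {1..}"
proof (rule bounded_sums_imp_summable_on(1))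
  have x0: "x p \<ge> 0" if "p \<ge> 1" for p
  proof (cases "p = n")
    case False
    have "0 \<le> c' * real (max n p) powr (al - 1) * \<bar>real n - real p\<bar>" using c' by simp
    also have "\<dots> \<le> x p" by (rule x(1)[OF that False])
    finally show ?thesis .
  qed (use x in simp)
  then show "0 \<le> 1 / x p" if "p \<in> {1..}" for p using that by simp
  fix F :: "nat set" assume F: "finite F" "F \<subseteq> {1..}"
  have "(\<Sum>p\<in>F. 1 / x p) \<le> 1 / x n + (\<Sum>p\<in>F-{n}. 1 / x p)"
    using F x0[OF n] by (cases "n \<in> F") (auto simp: sum.remove)
  also have "(\<Sum>p\<in>F-{n}. 1 / x p) \<le> (\<Sum>p\<in>F-{n}. 1 / c' * \<bar>real n - real p\<bar> powr (- al))"
    by (intro sum_mono inverse_gap_le n c' x) (use F in auto)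
  also have "\<dots> \<le> 1 / c' * (2 * zeta_sum al)"
    unfolding sum_distrib_left[symmetric] by (intro mult_left_mono shifted_sum_le_zeta al F) (use c' in simp)
  finally show "(\<Sum>p\<in>F. 1 / x p) \<le> 1 / x n + 1 / c' * (2 * zeta_sum al)" by simp
qed

lemma gap_sum_le:
  assumes p: "p \<ge> 1"
  shows "(\<Sum>q\<in>{1..N}-{p}. 1 / cmod (lam p - lam q)) \<le> 1 / c * (2 * zeta_sum al)"
proof -
  have "(\<Sum>q\<in>{1..N}-{p}. 1 / cmod (lam p - lam q)) \<le> (\<Sum>q\<in>{1..N}-{p}. 1 / c * \<bar>real p - real q\<bar> powr (- al))"
    by (intro sum_mono inverse_gap_le p c gap_max[of c al lam] gap) auto
  also have "\<dots> \<le> 1 / c * (2 * zeta_sum al)"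
    unfolding sum_distrib_left[symmetric] by (intro mult_left_mono shifted_sum_le_zeta al) (use c in auto)
  finally show ?thesis .
qed

text \<open>The residues of \<open>\<Prod>q. (z - nu q) / (z - lam q)\<close> are \<open>fwd.w\<close>, and \<open>bwd.w\<close> are those of its
reciprocal.\<close>

sublocale fwd: interlacing lam nu "1 / c * (2 * zeta_sum al)" m
proof
  show "lam p \<noteq> lam q" if "p \<ge> 1" "q \<ge> 1" "p \<noteq> q" for p q
  proof -
    have "0 < c * real p powr (al - 1) * \<bar>real p - real q\<bar>" using that c by simp
    with gap[OF that(1,2)] show ?thesis by auto
  qed
  then show "nu p \<noteq> nu q" if "p \<ge> 1" "q \<ge> 1" "p \<noteq> q" for p q using that by (simp add: nu_def)
  show "lam p \<noteq> nu q" if "p \<ge> 1" "q \<ge> 1" for p q using generic[OF that(2,1)] by (auto simp: nu_def)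
  show "cmod (lam p - nu p) \<le> m" if "p \<ge> 1" for p using m by (simp add: nu_def)
  show "(\<Sum>q\<in>{1..N}-{p}. 1 / cmod (lam p - lam q)) \<le> 1 / c * (2 * zeta_sum al)" if "p \<ge> 1" for p N
    by (rule gap_sum_le[OF that])
  then show "(\<Sum>q\<in>{1..N}-{p}. 1 / cmod (nu p - nu q)) \<le> 1 / c * (2 * zeta_sum al)" if "p \<ge> 1" for p N
    using that by (simp add: nu_def)
  show "(\<lambda>q. 1 / cmod (lam q - nu p)) summable_on {1..}" if "p \<ge> 1" for p
    by (rule inverse_shifted_gap_summable[OF that]) (use gap'[OF that] in \<open>auto simp: nu_def\<close>)
  show "(\<lambda>q. 1 / cmod (nu q - lam p)) summable_on {1..}" if "p \<ge> 1" for p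
    by (rule inverse_shifted_gap_summable[OF that])
       (use gap'[OF _ that] in \<open>auto simp: nu_def norm_minus_commute max.commute abs_minus_commute\<close>)
qed

sublocale bwd: interlacing nu lam "1 / c * (2 * zeta_sum al)" m by (rule fwd.swap)

lemma lam_minus_nu_nonzero: "p \<ge> 1 \<Longrightarrow> n \<ge> 1 \<Longrightarrow> lam p - nu n \<noteq> 0"
  using fwd.ab[of p n] by simp

definition weight_bd :: real where "weight_bd = m * exp (m * (1 / c * (2 * zeta_sum al)))"

lemma weight_bd: "weight_bd \<ge> 0" "p \<ge> 1 \<Longrightarrow> cmod (fwd.w p) \<le> weight_bd" "p \<ge> 1 \<Longrightarrow> cmod (bwd.w p) \<le> weight_bd"
  using m fwd.w_bound bwd.w_bound by (auto simp: weight_bd_def)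

text \<open>This choice makes \<open>1 - (\<Sum>p. k p * b p / (z - lam p))\<close>, the characteristic function of the closed
loop, equal to \<open>\<Prod>q. (z - nu q) / (z - lam q)\<close>.\<close>

definition k :: "nat \<Rightarrow> complex" where "k p = - fwd.w p / b p"

text \<open>The column \<open>Psi _ n\<close> is the eigenvector of the closed loop for the eigenvalue \<open>nu n\<close>,
and the row \<open>X n _\<close> is the corresponding coordinate functional.  Up to diagonal factors both are the Cauchy matrix \<open>1 / (lam p - nu n)\<close> and
its inverse.\<close>

definition X :: "nat \<Rightarrow> nat \<Rightarrow> complex" where
  "X n p = bwd.w n * fwd.w p * b n / (b p * (lam p - nu n))"

definition Psi :: "nat \<Rightarrow> nat \<Rightarrow> complex" where
  "Psi p n = - b p / (b n * (lam p - nu n))"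

lemma k_bound: "p \<ge> 1 \<Longrightarrow> cmod (k p) \<le> weight_bd / c1 * real p powr (- r)"
proof -
  assume p: "p \<ge> 1"
  then have pos: "0 < c1 * real p powr r" using c1 by simp
  have "cmod (k p) = cmod (fwd.w p) / cmod (b p)" by (simp add: k_def norm_divide)
  also have "\<dots> \<le> weight_bd / (c1 * real p powr r)"
    by (intro frac_le weight_bd b_lower p pos)
  finally show ?thesis by (simp add: powr_minus divide_inverse)
qed

text \<open>The bounds on \<open>b\<close> only give \<open>|b p / b n| \<le> (c2 / c1) * p powr (r + ga) * n powr (- r)\<close>.  The kernels
of \<open>Psi\<close> and of \<open>X\<close> are both of this form when the first index is the row: the factor \<open>w p / b p\<close> in
\<open>X\<close> needs an upper bound for \<open>w\<close> only.\<close>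

lemma ratio_kernel_schur:
  fixes A :: "nat \<Rightarrow> nat \<Rightarrow> complex" and x :: "nat \<Rightarrow> nat \<Rightarrow> real"
  assumes L: "L \<ge> 0"
    and A: "\<And>p n. p \<ge> 1 \<Longrightarrow> n \<ge> 1 \<Longrightarrow> cmod (A p n) \<le> L * (cmod (b p) / cmod (b n) / x p n)"
    and x: "\<And>p. p \<ge> 1 \<Longrightarrow> x p p = m"
      "\<And>p n. p \<ge> 1 \<Longrightarrow> n \<ge> 1 \<Longrightarrow> p \<noteq> n \<Longrightarrow> c' * real (max p n) powr (al - 1) * \<bar>real p - real n\<bar> \<le> x p n"
  shows "\<exists>M. schur {1..} (\<lambda>n. real n powr (- 1 / 2)) M A"
proof (rule kernel_schur[OF ga r])
  show "L * (c2 / c1 / c') \<ge> 0" "L / m \<ge> 0" using L c1 c2 c' m by auto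
  show "cmod (A p p) \<le> L / m" if "p \<ge> 1" for p
    using A[OF that that] x(1)[OF that] b_nonzero[OF that] by simp
  fix p n :: nat assume pn: "p \<ge> 1" "n \<ge> 1" "p \<noteq> n"
  have pos: "0 < c1 * real n powr r" "0 < c' * real (max p n) powr (al - 1) * \<bar>real p - real n\<bar>"
    using c1 c' pn by auto
  have "cmod (A p n) \<le> L * (cmod (b p) / cmod (b n) / x p n)" by (rule A[OF pn(1,2)])
  also have "\<dots> \<le> L * (c2 * real p powr (r + ga) / (c1 * real n powr r) /
      (c' * real (max p n) powr (al - 1) * \<bar>real p - real n\<bar>))"
    by (intro mult_left_mono frac_le b_upper b_lower pn L pos x(2) order_refl)
       (use c2 pos in auto)
  also have "\<dots> = L * (c2 / c1 / c') *
      (real p powr (r + ga) * real n powr (- r) * real (max p n) powr (1 - al) / \<bar>real p - real n\<bar>)"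
  proof -
    have "real (max p n) powr (1 - al) = inverse (real (max p n) powr (al - 1))"
      using powr_minus[of "real (max p n)" "al - 1"] by simp
    then show ?thesis by (simp add: powr_minus divide_inverse)
  qed
  finally show "cmod (A p n) \<le> L * (c2 / c1 / c') *
      (real p powr (r + ga) * real n powr (- r) * real (max p n) powr (1 - al) / \<bar>real p - real n\<bar>)" .
qed

lemma Psi_schur: "\<exists>M. schur {1..} (\<lambda>n. real n powr (- 1 / 2)) M Psi"
proof (rule ratio_kernel_schur[of 1 _ "\<lambda>p n. cmod (lam p - nu n)"])
  show "cmod (lam p - nu p) = m" for p using m by (simp add: nu_def)
  show "c' * real (max p n) powr (al - 1) * \<bar>real p - real n\<bar> \<le> cmod (lam p - nu n)"
    if "p \<ge> 1" "n \<ge> 1" "p \<noteq> n" for p n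
    using gap'[of n p] that by (simp add: nu_def max.commute abs_minus_commute)
qed (auto simp: Psi_def norm_divide norm_mult)

lemma X_schur: "\<exists>M. schur {1..} (\<lambda>n. real n powr (- 1 / 2)) M X"
proof (rule ratio_kernel_schur[of "weight_bd * weight_bd" _ "\<lambda>n p. cmod (lam p - nu n)"])
  show "cmod (lam p - nu p) = m" for p using m by (simp add: nu_def)
  show "c' * real (max n p) powr (al - 1) * \<bar>real n - real p\<bar> \<le> cmod (lam p - nu n)"
    if "n \<ge> 1" "p \<ge> 1" "n \<noteq> p" for n p
    using gap'[of n p] that by (simp add: nu_def)
  show "weight_bd * weight_bd \<ge> 0" using weight_bd by simp
  fix n p :: nat assume np: "n \<ge> 1" "p \<ge> 1"
  have "cmod (X n p) = (cmod (bwd.w n) * cmod (fwd.w p)) * (cmod (b n) / cmod (b p) / cmod (lam p - nu n))"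
    by (simp add: X_def norm_divide norm_mult)
  also have "\<dots> \<le> (weight_bd * weight_bd) * (cmod (b n) / cmod (b p) / cmod (lam p - nu n))"
    by (intro mult_right_mono mult_mono weight_bd np) auto
  finally show "cmod (X n p) \<le> weight_bd * weight_bd * (cmod (b n) / cmod (b p) / cmod (lam p - nu n))" .
qed

lemma X_Psi:
  assumes n: "n \<ge> 1" and q: "q \<ge> 1"
  shows "(\<Sum>\<^sub>\<infinity>p\<in>{1..}. X n p * Psi p q) = (if n = q then 1 else 0)"
proof -
  have "(\<Sum>\<^sub>\<infinity>p\<in>{1..}. X n p * Psi p q) =
      (\<Sum>\<^sub>\<infinity>p\<in>{1..}. (- bwd.w n * b n / b q) * (fwd.w p / ((lam p - nu n) * (lam p - nu q))))"
    by (rule infsum_cong) (use b_nonzero in \<open>simp add: X_def Psi_def mult_ac\<close>)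
  also have "\<dots> = (- bwd.w n * b n / b q) * (\<Sum>\<^sub>\<infinity>p\<in>{1..}. fwd.w p / ((lam p - nu n) * (lam p - nu q)))"
    by (rule infsum_cmult_right')
  also have "\<dots> = (if n = q then 1 else 0)"
  proof (cases "n = q")
    case True
    have "bwd.w n * (\<Sum>\<^sub>\<infinity>p\<in>{1..}. fwd.w p / ((lam p - nu n) * (lam p - nu n))) = -1"
      using fwd.w_sum_square[OF n] by (simp add: power2_eq_square)
    then show ?thesis using True b_nonzero[OF n] by simp
  next
    case False
    then show ?thesis using fwd.w_sum_off_diagonal[OF n q False] by simp
  qed
  finally show ?thesis .
qed

lemma Psi_X:
  assumes p: "p \<ge> 1" and q: "q \<ge> 1"
  shows "(\<Sum>\<^sub>\<infinity>n\<in>{1..}. Psi p n * X n q) = (if p = q then 1 else 0)"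
proof -
  have "(\<Sum>\<^sub>\<infinity>n\<in>{1..}. Psi p n * X n q) =
      (\<Sum>\<^sub>\<infinity>n\<in>{1..}. (- b p * fwd.w q / b q) * (bwd.w n / ((nu n - lam p) * (nu n - lam q))))"
  proof (rule infsum_cong)
    fix n :: nat assume "n \<in> {1..}"
    then have "b n \<noteq> 0" using b_nonzero by simp
    moreover have "(nu n - lam p) * (nu n - lam q) = (lam p - nu n) * (lam q - nu n)"
      by (simp add: algebra_simps)
    ultimately show "Psi p n * X n q = (- b p * fwd.w q / b q) * (bwd.w n / ((nu n - lam p) * (nu n - lam q)))"
      by (simp add: X_def Psi_def mult_ac)
  qed
  also have "\<dots> = (- b p * fwd.w q / b q) * (\<Sum>\<^sub>\<infinity>n\<in>{1..}. bwd.w n / ((nu n - lam p) * (nu n - lam q)))"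
    by (rule infsum_cmult_right')
  also have "\<dots> = (if p = q then 1 else 0)"
  proof (cases "p = q")
    case True
    have "fwd.w p * (\<Sum>\<^sub>\<infinity>n\<in>{1..}. bwd.w n / ((nu n - lam p) * (nu n - lam p))) = -1"
      using bwd.w_sum_square[OF p] by (simp add: power2_eq_square)
    then show ?thesis using True b_nonzero[OF p] by simp
  next
    case False
    then show ?thesis using bwd.w_sum_off_diagonal[OF p q False] by simp
  qed
  finally show ?thesis .
qed

lemma X_mat_Psi: "l2 {1..} g \<Longrightarrow> n \<ge> 1 \<Longrightarrow> mat_app {1..} X (mat_app {1..} Psi g) n = g n"
proof -
  assume g: "l2 {1..} g" and n: "n \<ge> 1"
  obtain M M' where "schur {1..} (\<lambda>n. real n powr (- 1 / 2)) M X" "schur {1..} (\<lambda>n. real n powr (- 1 / 2)) M' Psi"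
    using X_schur Psi_schur by blast
  then show ?thesis by (rule mat_app_inverse[OF _ _ g]) (use n X_Psi in auto)
qed

lemma Psi_mat_X: "l2 {1..} g \<Longrightarrow> n \<ge> 1 \<Longrightarrow> mat_app {1..} Psi (mat_app {1..} X g) n = g n"
proof -
  assume g: "l2 {1..} g" and n: "n \<ge> 1"
  obtain M M' where "schur {1..} (\<lambda>n. real n powr (- 1 / 2)) M Psi" "schur {1..} (\<lambda>n. real n powr (- 1 / 2)) M' X"
    using X_schur Psi_schur by blast
  then show ?thesis by (rule mat_app_inverse[OF _ _ g]) (use n Psi_X in auto)
qed

text \<open>Since \<open>X n p * (lam p - nu n)\<close> is a multiple of \<open>k p\<close>, the two sides differ by a multiple of
\<open>\<Sum>p. k p * f p\<close>, and that multiple vanishes because \<open>1 = (\<Sum>p. w p / (lam p - nu n))\<close>.  The family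
\<open>lam p * f p\<close> itself need not be square summable, only its sum with the control term.\<close>

lemma X_diagonalises:
  assumes f: "l2 {1..} f" and kf: "(\<lambda>p. cmod (k p * f p)) summable_on {1..}"
    and h: "l2 {1..} (\<lambda>p. lam p * f p + b p * (\<Sum>\<^sub>\<infinity>q\<in>{1..}. k q * f q))" and n: "n \<ge> 1"
  shows "nu n * mat_app {1..} X f n =
    mat_app {1..} X (\<lambda>p. lam p * f p + b p * (\<Sum>\<^sub>\<infinity>q\<in>{1..}. k q * f q)) n"
proof -
  define \<kappa> where "\<kappa> = (\<Sum>\<^sub>\<infinity>q\<in>{1..}. k q * f q)"
  define e where "e = bwd.w n * b n"
  obtain M where X: "schur {1..} (\<lambda>n. real n powr (- 1 / 2)) M X" using X_schur by blast
  have n': "n \<in> {1..}" using n by simp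
  have s1: "(\<lambda>p. X n p * (lam p * f p + b p * \<kappa>)) summable_on {1..}"
    using schur_mat_app_summable(2)[OF X h n'] by (simp add: \<kappa>_def)
  have s2: "(\<lambda>p. fwd.w p / (lam p - nu n)) summable_on {1..}" by (rule fwd.w_summable[OF n])
  have s3: "(\<lambda>p. k p * f p) summable_on {1..}" using kf by (rule Infinite_Sum.abs_summable_summable)
  have "nu n * mat_app {1..} X f n = (\<Sum>\<^sub>\<infinity>p\<in>{1..}. nu n * (X n p * f p))"
    unfolding mat_app_def by (rule infsum_cmult_right'[symmetric])
  also have "\<dots> = (\<Sum>\<^sub>\<infinity>p\<in>{1..}. X n p * (lam p * f p + b p * \<kappa>) +
      ((- e * \<kappa>) * (fwd.w p / (lam p - nu n)) + e * (k p * f p)))"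
  proof (rule infsum_cong)
    fix p :: nat assume "p \<in> {1..}"
    then have nz: "b p \<noteq> 0" "lam p - nu n \<noteq> 0" using b_nonzero lam_minus_nu_nonzero n by auto
    have 1: "X n p * (lam p - nu n) = - e * k p"
      using nz by (simp add: X_def k_def e_def)
    have 2: "X n p * b p = e * (fwd.w p / (lam p - nu n))"
      using nz by (simp add: X_def e_def)
    have "nu n * (X n p * f p) = X n p * lam p * f p - (X n p * (lam p - nu n)) * f p"
      by (simp add: algebra_simps)
    also have "\<dots> = X n p * (lam p * f p + b p * \<kappa>) + (- (X n p * b p) * \<kappa> + e * (k p * f p))"
      unfolding 1 by (simp add: algebra_simps)
    also have "\<dots> = X n p * (lam p * f p + b p * \<kappa>) +
      ((- e * \<kappa>) * (fwd.w p / (lam p - nu n)) + e * (k p * f p))"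
      unfolding 2 by simp
    finally show "nu n * (X n p * f p) = X n p * (lam p * f p + b p * \<kappa>) +
      ((- e * \<kappa>) * (fwd.w p / (lam p - nu n)) + e * (k p * f p))" .
  qed
  also have "\<dots> = (\<Sum>\<^sub>\<infinity>p\<in>{1..}. X n p * (lam p * f p + b p * \<kappa>)) +
      ((- e * \<kappa>) * (\<Sum>\<^sub>\<infinity>p\<in>{1..}. fwd.w p / (lam p - nu n)) + e * (\<Sum>\<^sub>\<infinity>p\<in>{1..}. k p * f p))"
    by (simp only: infsum_add[OF s1 summable_on_add[OF summable_on_cmult_right[OF s2] summable_on_cmult_right[OF s3]]]
        infsum_add[OF summable_on_cmult_right[OF s2] summable_on_cmult_right[OF s3]] infsum_cmult_right')
  also have "\<dots> = (\<Sum>\<^sub>\<infinity>p\<in>{1..}. X n p * (lam p * f p + b p * \<kappa>))"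
    unfolding fwd.w_sum[OF n] \<kappa>_def[symmetric] by simp
  finally show ?thesis unfolding mat_app_def \<kappa>_def .
qed

lemma resolvent_lower_bound:
  assumes z: "Re z > \<omega>"
  shows "\<exists>g>0. \<forall>p\<ge>1. g * real p powr al \<le> cmod (z - lam p)"
proof -
  define d where "d = Re z - \<omega>"
  define K where "K = 1 + (1 + cmod z) / d"
  have d: "d > 0" using z by (simp add: d_def)
  have K: "K > 0" using d by (simp add: K_def add_pos_nonneg)
  have "c / K * real p powr al \<le> cmod (z - lam p)" if p: "p \<ge> 1" for p
  proof -
    have "d \<le> Re (z - lam p)" using Re_lam[OF p] by (simp add: d_def)
    also have "\<dots> \<le> cmod (z - lam p)" by (rule complex_Re_le_cmod)
    finally have "(1 + cmod z) / d * d \<le> (1 + cmod z) / d * cmod (z - lam p)"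
      by (rule mult_left_mono) (use d in simp)
    then have "1 + cmod z \<le> (1 + cmod z) / d * cmod (z - lam p)" using d by simp
    moreover have "cmod (lam p) \<le> cmod z + cmod (z - lam p)"
      using norm_triangle_ineq4[of z "z - lam p"] by simp
    ultimately have "cmod (lam p) + 1 \<le> K * cmod (z - lam p)"
      by (simp add: K_def distrib_right)
    with growth[OF p] have "c * real p powr al \<le> K * cmod (z - lam p)" by linarith
    then show ?thesis using K by (simp add: field_simps)
  qed
  moreover have "c / K > 0" using c K by simp
  ultimately show ?thesis by blast
qed

text \<open>The growth of \<open>lam\<close> gains the factor \<open>p powr (- al)\<close>; the second condition on \<open>s\<close> is what makes the
control term \<open>b p / (z - lam p)\<close> square summable with the weight \<open>p powr s\<close>.\<close>

lemma resolvent_l2: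
  assumes z: "Re z > \<omega>" and h: "l2 {1..} h" and s: "s \<le> al" "s + r + ga - al < - 1 / 2"
  shows "l2 {1..} (\<lambda>p. complex_of_real (real p powr s) * ((h p + b p * \<kappa>) / (z - lam p)))"
proof -
  obtain g where g: "g > 0" "\<And>p. p \<ge> 1 \<Longrightarrow> g * real p powr al \<le> cmod (z - lam p)"
    using resolvent_lower_bound[OF z] by blast
  have inv: "real p powr s / cmod (z - lam p) \<le> 1 / g * real p powr (s - al)" if "p \<ge> 1" for p
  proof -
    have "real p powr s / cmod (z - lam p) \<le> real p powr s / (g * real p powr al)"
      by (rule frac_le[OF _ order_refl _ g(2)[OF that]]) (use g that in auto)
    then show ?thesis by (simp add: powr_diff)
  qed
  have 1: "l2 {1..} (\<lambda>p. complex_of_real (real p powr s) * (h p / (z - lam p)))"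
  proof (rule l2_comparison(1)[OF h])
    fix p :: nat assume "p \<in> {1..}"
    then have p: "p \<ge> 1" by simp
    have "real p powr (s - al) \<le> real p powr 0" by (rule powr_mono) (use s p in auto)
    then have "1 / g * real p powr (s - al) \<le> 1 / g * 1"
      by (intro mult_left_mono) (use g p in auto)
    with inv[OF p] have "real p powr s / cmod (z - lam p) \<le> 1 / g" by linarith
    then have "real p powr s / cmod (z - lam p) * cmod (h p) \<le> 1 / g * cmod (h p)" by (rule mult_right_mono) simp
    then show "cmod (complex_of_real (real p powr s) * (h p / (z - lam p))) \<le> 1 / g * cmod (h p)"
      by (simp add: norm_mult norm_divide)
  qed
  have 2: "l2 {1..} (\<lambda>p. complex_of_real (real p powr s) * (b p / (z - lam p)))"
  proof (rule l2_comparison(1)[OF l2_powr[OF s(2)]])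
    fix p :: nat assume "p \<in> {1..}"
    then have p: "p \<ge> 1" by simp
    have "cmod (complex_of_real (real p powr s) * (b p / (z - lam p))) =
        cmod (b p) * (real p powr s / cmod (z - lam p))" by (simp add: norm_mult norm_divide)
    also have "\<dots> \<le> (c2 * real p powr (r + ga)) * (1 / g * real p powr (s - al))"
      by (intro mult_mono b_upper inv p) (use c2 g in auto)
    also have "\<dots> = c2 / g * (real p powr (r + ga) * real p powr (s - al))" by simp
    also have "real p powr (r + ga) * real p powr (s - al) = real p powr (s + r + ga - al)"
      unfolding powr_add[symmetric] by (simp add: algebra_simps)
    finally show "cmod (complex_of_real (real p powr s) * (b p / (z - lam p))) \<le>
        c2 / g * cmod (complex_of_real (real p powr (s + r + ga - al)))" by simp
  qed
  have "l2 {1..} (\<lambda>p. complex_of_real (real p powr s) * (h p / (z - lam p)) +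
      \<kappa> * (complex_of_real (real p powr s) * (b p / (z - lam p))))"
    by (rule l2_add[OF 1 l2_scale[OF 2]])
  then show ?thesis by (simp add: add_divide_distrib algebra_simps)
qed

lemma resolvent_nonzero:
  assumes z: "Re z > \<omega>" and p: "p \<ge> 1"
  shows "z - lam p \<noteq> 0" "z \<noteq> nu p"
proof -
  show "z - lam p \<noteq> 0" using Re_lam[OF p] z by auto
  show "z \<noteq> nu p" using Re_lam[OF p] z m by (auto simp: nu_def)
qed

lemma resolvent_pairing_summable:
  assumes z: "Re z > \<omega>" and h: "l2 {1..} h"
  shows "(\<lambda>p. cmod (k p * ((h p + b p * \<kappa>) / (z - lam p)))) summable_on {1..}"
proof -
  \<comment> \<open>the first bound on \<open>\<epsilon>\<close> serves the part of \<open>h\<close>, the second one that of \<open>b\<close>\<close>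
  define \<epsilon> where "\<epsilon> = min (al - 1 / 2 + r) (al - 1 - ga) / 2"
  have \<epsilon>: "\<epsilon> > 0" "\<epsilon> < al - 1 / 2 + r" "\<epsilon> < al - 1 - ga" using ga r by (auto simp: \<epsilon>_def min_def)
  have "l2 {1..} (\<lambda>p. complex_of_real (real p powr (1 / 2 + \<epsilon> - r)) * ((h p + b p * \<kappa>) / (z - lam p)))"
    by (rule resolvent_l2[OF z h]) (use \<epsilon> in auto)
  then show ?thesis
    by (rule weighted_pairing_summable(1)[OF k_bound, rotated 2]) (use \<epsilon> in auto)
qed

text \<open>At a zero of the characteristic function, \<open>b p / (z - lam p)\<close> would be an eigenvector of the closed
loop.  Its coordinates satisfy \<open>nu n * X f n = z * X f n\<close>, hence vanish as \<open>z\<close> is none of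
the \<open>nu n\<close>, which contradicts the injectivity of \<open>X\<close>.\<close>

lemma characteristic_nonzero:
  assumes z: "Re z > \<omega>"
  shows "(\<Sum>\<^sub>\<infinity>p\<in>{1..}. k p * (b p / (z - lam p))) \<noteq> 1"
proof
  assume eq: "(\<Sum>\<^sub>\<infinity>p\<in>{1..}. k p * (b p / (z - lam p))) = 1"
  define f where "f p = b p / (z - lam p)" for p
  have zero: "l2 {1..} (\<lambda>p::nat. 0)" by (simp add: l2_def)
  have "l2 {1..} (\<lambda>p. complex_of_real (real p powr 0) * ((0 + b p * 1) / (z - lam p)))"
    by (rule resolvent_l2[OF z zero]) (use al r in auto)
  then have f: "l2 {1..} f" by (subst l2_cong[where g = "\<lambda>p. complex_of_real (real p powr 0) * ((0 + b p * 1) / (z - lam p))"]) (auto simp: f_def)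
  have kf: "(\<lambda>p. cmod (k p * f p)) summable_on {1..}"
    using resolvent_pairing_summable[OF z zero, of 1] by (simp add: f_def)
  have kf1: "(\<Sum>\<^sub>\<infinity>p\<in>{1..}. k p * f p) = 1" using eq by (simp add: f_def)
  have h: "lam p * f p + b p * (\<Sum>\<^sub>\<infinity>q\<in>{1..}. k q * f q) = z * f p" if "p \<in> {1..}" for p
    using resolvent_nonzero(1)[OF z, of p] that unfolding kf1 by (simp add: f_def field_simps)
  have l2h: "l2 {1..} (\<lambda>p. lam p * f p + b p * (\<Sum>\<^sub>\<infinity>q\<in>{1..}. k q * f q))"
    using l2_scale[OF f, of z] by (subst l2_cong[OF h])
  have Xf: "mat_app {1..} X f n = 0" if n: "n \<ge> 1" for n
  proof -
    have "nu n * mat_app {1..} X f n =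
      mat_app {1..} X (\<lambda>p. lam p * f p + b p * (\<Sum>\<^sub>\<infinity>q\<in>{1..}. k q * f q)) n"
      by (rule X_diagonalises[OF f kf l2h n])
    also have "\<dots> = mat_app {1..} X (\<lambda>p. z * f p) n"
      unfolding mat_app_def by (rule infsum_cong) (simp only: h)
    also have "\<dots> = z * mat_app {1..} X f n" by (rule mat_app_scale)
    finally show ?thesis using resolvent_nonzero(2)[OF z n] by simp
  qed
  have "f 1 = mat_app {1..} Psi (mat_app {1..} X f) 1" using Psi_mat_X[OF f, of 1] by simp
  also have "\<dots> = 0" unfolding mat_app_def[of _ Psi] by (rule infsum_0) (use Xf in auto)
  finally show False using b_nonzero[of 1] resolvent_nonzero(1)[OF z, of 1] by (simp add: f_def)
qed

text \<open>The value of the feedback on the solution \<open>f\<close> of \<open>z f - (A + b k) f = h\<close>, found by applying \<open>k\<close> to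
\<open>f p = (h p + b p * k f) / (z - lam p)\<close>.\<close>

definition feedback_value :: "complex \<Rightarrow> (nat \<Rightarrow> complex) \<Rightarrow> complex" where
  "feedback_value z h = (\<Sum>\<^sub>\<infinity>p\<in>{1..}. k p * (h p / (z - lam p))) /
     (1 - (\<Sum>\<^sub>\<infinity>p\<in>{1..}. k p * (b p / (z - lam p))))"

definition resolvent :: "complex \<Rightarrow> (nat \<Rightarrow> complex) \<Rightarrow> nat \<Rightarrow> complex" where
  "resolvent z h p = (h p + b p * feedback_value z h) / (z - lam p)"

lemma resolvent_feedback:
  assumes z: "Re z > \<omega>" and h: "l2 {1..} h"
  shows "(\<Sum>\<^sub>\<infinity>p\<in>{1..}. k p * resolvent z h p) = feedback_value z h"
proof -
  define F where "F = (\<Sum>\<^sub>\<infinity>p\<in>{1..}. k p * (b p / (z - lam p)))"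
  define \<kappa> where "\<kappa> = feedback_value z h"
  have F: "1 - F \<noteq> 0" using characteristic_nonzero[OF z] by (simp add: F_def)
  have s1: "(\<lambda>p. k p * (h p / (z - lam p))) summable_on {1..}"
    using Infinite_Sum.abs_summable_summable[OF resolvent_pairing_summable[OF z h, of 0]] by simp
  have "l2 {1..} (\<lambda>p::nat. 0)" by (simp add: l2_def)
  from Infinite_Sum.abs_summable_summable[OF resolvent_pairing_summable[OF z this, of 1]]
  have s2: "(\<lambda>p. k p * (b p / (z - lam p))) summable_on {1..}" by simp
  have "(\<Sum>\<^sub>\<infinity>p\<in>{1..}. k p * resolvent z h p) =
      (\<Sum>\<^sub>\<infinity>p\<in>{1..}. k p * (h p / (z - lam p)) + \<kappa> * (k p * (b p / (z - lam p))))"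
    by (rule infsum_cong) (simp add: resolvent_def \<kappa>_def add_divide_distrib algebra_simps)
  also have "\<dots> = (\<Sum>\<^sub>\<infinity>p\<in>{1..}. k p * (h p / (z - lam p))) + \<kappa> * F"
    by (simp only: infsum_add[OF s1 summable_on_cmult_right[OF s2]] infsum_cmult_right' F_def)
  also have "(\<Sum>\<^sub>\<infinity>p\<in>{1..}. k p * (h p / (z - lam p))) = \<kappa> * (1 - F)"
    using F by (simp add: \<kappa>_def feedback_value_def F_def)
  finally show ?thesis by (simp add: \<kappa>_def algebra_simps)
qed

lemma resolvent_equation:
  assumes z: "Re z > \<omega>" and h: "l2 {1..} h" and p: "p \<ge> 1"
  shows "lam p * resolvent z h p + b p * (\<Sum>\<^sub>\<infinity>q\<in>{1..}. k q * resolvent z h q) = z * resolvent z h p - h p"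
proof -
  have "(z - lam p) * resolvent z h p = h p + b p * feedback_value z h"
    using resolvent_nonzero(1)[OF z p] by (simp add: resolvent_def)
  then show ?thesis unfolding resolvent_feedback[OF z h] by (simp add: algebra_simps)
qed

end

section \<open>A bound on the real parts of the eigenvalues\<close>

text \<open>Telescoping \<open>T(h)\<^sup>N x - exp(z h)\<^sup>N x\<close> with \<open>h = t / N\<close> bounds the difference by \<open>N\<close> times the error
of a single step of length \<open>h\<close>, and that error is \<open>o(h)\<close> because \<open>x\<close> is an eigenvector of the
generator.\<close>

lemma generator_eigenvector_orbit:
  fixes x :: "'a::complex_hilbert_space"
  assumes gen: "generates D A T" and x: "x \<in> D" "A x = z *\<^sub>C x"
    and bd: "\<And>t y. t \<ge> 0 \<Longrightarrow> norm (T t y) \<le> M * exp (\<omega> * t) * norm y" and t: "t \<ge> 0"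
  shows "T t x = exp (z * complex_of_real t) *\<^sub>C x"
proof (cases "t = 0 \<or> x = 0")
  case True
  have "T 0 = id" "T t 0 = 0"
    using gen t by (auto simp: generates_def c0_semigroup_def intro: linear_0 bounded_linear.linear)
  then show ?thesis using True by auto
next
  case False
  then have t: "t > 0" and x0: "x \<noteq> 0" using t by auto
  have T: "bounded_linear (T s)" "T s (a *\<^sub>C y) = a *\<^sub>C T s y" if "s \<ge> 0" for s a y
    using gen that by (auto simp: generates_def c0_semigroup_def)
  have T_add: "T (s + s') y = T s (T s' y)" if "s \<ge> 0" "s' \<ge> 0" for s s' y
    using gen that by (auto simp: generates_def c0_semigroup_def)
  have T0: "T 0 y = y" for y using gen by (auto simp: generates_def c0_semigroup_def)
  have M: "M \<ge> 0"
  proof -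
    have "norm x \<le> M * norm x" using bd[of 0 x] by (simp add: T0)
    then show ?thesis using x0 by (metis mult_le_0_iff norm_ge_zero norm_le_zero_iff order_trans linorder_linear zero_le_mult_iff)
  qed
  \<comment> \<open>the error of a single step of length \<open>h\<close>\<close>
  define \<rho> where "\<rho> h = norm (T h x - exp (z * complex_of_real h) *\<^sub>C x)" for h
  define L where "L = \<bar>\<omega>\<bar> + cmod z"
  have L: "\<omega> \<le> L" "Re z \<le> L" "0 \<le> L"
    using abs_ge_self[of \<omega>] abs_ge_zero[of \<omega>] norm_ge_zero[of z] complex_Re_le_cmod[of z]
    unfolding L_def by linarith+
  have expz: "cmod (exp (z * complex_of_real s)) \<le> exp (L * s)" if "s \<ge> 0" for s
  proof -
    have "Re (z * complex_of_real s) \<le> L * s"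
      using mult_right_mono[OF L(2) that] by simp
    then show ?thesis by (simp only: norm_exp_eq_Re exp_le_cancel_iff)
  qed
  have step: "norm (T (real N * h) x - exp (z * complex_of_real (real N * h)) *\<^sub>C x)
      \<le> real N * (M * exp (L * (real N * h)) * \<rho> h)" if h: "h \<ge> 0" for N h
  proof (induction N)
    case 0
    then show ?case by (simp add: T0)
  next
    case (Suc N)
    define s where "s = real N * h"
    have s: "s \<ge> 0" using h by (simp add: s_def)
    have e: "real (Suc N) * h = s + h" by (simp add: s_def algebra_simps)
    have "T (s + h) x - exp (z * complex_of_real (s + h)) *\<^sub>C x =
        T s (T h x - exp (z * complex_of_real h) *\<^sub>C x) +
        exp (z * complex_of_real h) *\<^sub>C (T s x - exp (z * complex_of_real s) *\<^sub>C x)"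
      by (simp add: T_add s h linear_diff[OF bounded_linear.linear[OF T(1)[OF s]]] T(2)[OF s]
          scaleC_minus_right scaleC_scaleC distrib_left exp_add mult.commute)
    then have "norm (T (s + h) x - exp (z * complex_of_real (s + h)) *\<^sub>C x) \<le>
        norm (T s (T h x - exp (z * complex_of_real h) *\<^sub>C x)) +
        cmod (exp (z * complex_of_real h)) * norm (T s x - exp (z * complex_of_real s) *\<^sub>C x)"
      by (metis norm_triangle_ineq norm_scaleC)
    also have "norm (T s (T h x - exp (z * complex_of_real h) *\<^sub>C x)) \<le> M * exp (L * (s + h)) * \<rho> h"
    proof -
      have "norm (T s (T h x - exp (z * complex_of_real h) *\<^sub>C x)) \<le> M * exp (\<omega> * s) * \<rho> h"
        unfolding \<rho>_def by (rule bd[OF s])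
      also have "\<dots> \<le> M * exp (L * (s + h)) * \<rho> h"
      proof -
        have "\<omega> * s \<le> L * s" by (rule mult_right_mono[OF L(1) s])
        also have "\<dots> \<le> L * (s + h)" using h L by (intro mult_left_mono) auto
        finally show ?thesis using M by (intro mult_right_mono mult_left_mono) (auto simp: \<rho>_def)
      qed
      finally show ?thesis .
    qed
    also have "cmod (exp (z * complex_of_real h)) * norm (T s x - exp (z * complex_of_real s) *\<^sub>C x) \<le>
        exp (L * h) * (real N * (M * exp (L * s) * \<rho> h))"
      using Suc.IH unfolding s_def[symmetric] by (intro mult_mono expz h) auto
    also have "exp (L * h) * (real N * (M * exp (L * s) * \<rho> h)) = real N * (M * exp (L * (s + h)) * \<rho> h)"
      by (simp add: distrib_left exp_add)
    finally show ?case unfolding e by (simp add: algebra_simps)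
  qed
  have lim: "((\<lambda>h. \<rho> h / h) \<longlongrightarrow> 0) (at_right 0)"
  proof -
    have "((\<lambda>h. (T h x - x) /\<^sub>R h) \<longlongrightarrow> z *\<^sub>C x) (at_right 0)"
      using gen x by (auto simp: generates_def)
    moreover have "((\<lambda>h. ((exp (z * complex_of_real h) - 1) / complex_of_real h) *\<^sub>C x) \<longlongrightarrow> z *\<^sub>C x) (at_right 0)"
      by (rule bounded_linear.tendsto[OF bounded_linear_scaleC_left exp_difference_quotient])
    ultimately have "((\<lambda>h. norm ((T h x - x) /\<^sub>R h - ((exp (z * complex_of_real h) - 1) / complex_of_real h) *\<^sub>C x))
        \<longlongrightarrow> norm (z *\<^sub>C x - z *\<^sub>C x)) (at_right 0)"
      by (intro tendsto_norm tendsto_diff)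
    moreover have "norm ((T h x - x) /\<^sub>R h - ((exp (z * complex_of_real h) - 1) / complex_of_real h) *\<^sub>C x) = \<rho> h / h"
      if "h > 0" for h
    proof -
      have "((exp (z * complex_of_real h) - 1) / complex_of_real h) *\<^sub>C x =
          (exp (z * complex_of_real h) *\<^sub>C x - x) /\<^sub>R h"
        by (simp add: scaleR_scaleC scaleC_scaleC divide_inverse mult.commute
            flip: scaleC_minus_left[of "exp (z * complex_of_real h)" 1 x, simplified])
      then have "(T h x - x) /\<^sub>R h - ((exp (z * complex_of_real h) - 1) / complex_of_real h) *\<^sub>C x =
          (T h x - exp (z * complex_of_real h) *\<^sub>C x) /\<^sub>R h"
        by (simp flip: scaleR_diff_right)
      then show ?thesis using that by (simp add: \<rho>_def divide_inverse mult.commute)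
    qed
    ultimately show ?thesis
      by (subst tendsto_cong[where g = "\<lambda>h. norm ((T h x - x) /\<^sub>R h - ((exp (z * complex_of_real h) - 1) / complex_of_real h) *\<^sub>C x)"])
         (auto simp: eventually_at_filter intro!: always_eventually)
  qed
  have seq: "filterlim (\<lambda>N. t / real (Suc N)) (at_right 0) sequentially"
    unfolding filterlim_at using LIMSEQ_Suc[OF lim_const_over_n[of t]] t
    by (auto intro!: always_eventually)
  have "(\<lambda>N. (t * M * exp (L * t)) * (\<rho> (t / real (Suc N)) / (t / real (Suc N)))) \<longlonglongrightarrow> (t * M * exp (L * t)) * 0"
    by (intro tendsto_mult tendsto_const filterlim_compose[OF lim seq])
  moreover have "norm (T t x - exp (z * complex_of_real t) *\<^sub>C x) \<le>
      (t * M * exp (L * t)) * (\<rho> (t / real (Suc N)) / (t / real (Suc N)))" for N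
  proof -
    define h where "h = t / real (Suc N)"
    have h: "h > 0" "real (Suc N) * h = t" using t by (simp_all add: h_def del: of_nat_Suc)
    then have "real (Suc N) = t / h" by (metis less_irrefl nonzero_mult_div_cancel_right)
    moreover have "norm (T t x - exp (z * complex_of_real t) *\<^sub>C x) \<le> real (Suc N) * (M * exp (L * t) * \<rho> h)"
      using step[of h "Suc N", unfolded h(2)] h(1) by (simp only: less_imp_le)
    ultimately show ?thesis unfolding h_def[symmetric] by simp
  qed
  ultimately have "norm (T t x - exp (z * complex_of_real t) *\<^sub>C x) \<le> 0"
    by (intro tendsto_lowerbound[of _ "(t * M * exp (L * t)) * 0" sequentially, simplified]) auto
  then show ?thesis by simp
qed

text \<open>The eigenvector evolves as \<open>exp (z t)\<close>, which the exponential bound of the semigroup limits.\<close>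

lemma generator_eigenvalue_Re_le:
  fixes x :: "'a::complex_hilbert_space"
  assumes gen: "generates D A T" and x: "x \<in> D" "A x = z *\<^sub>C x" "x \<noteq> 0"
    and bd: "\<And>t y. t \<ge> 0 \<Longrightarrow> norm (T t y) \<le> M * exp (\<omega> * t) * norm y"
  shows "Re z \<le> \<omega>"
proof (rule ccontr)
  assume "\<not> Re z \<le> \<omega>"
  then have d: "Re z - \<omega> > 0" by simp
  define t where "t = \<bar>M\<bar> / (Re z - \<omega>)"
  have t: "t \<ge> 0" using d by (simp add: t_def)
  have "exp (Re z * t) * norm x \<le> M * exp (\<omega> * t) * norm x"
  proof -
    have "T t x = exp (z * complex_of_real t) *\<^sub>C x"
      by (rule generator_eigenvector_orbit[OF gen x(1,2) _ t]) (rule bd)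
    then show ?thesis using bd[OF t, of x] by (simp add: norm_scaleC)
  qed
  then have "exp (Re z * t) \<le> M * exp (\<omega> * t)" using x(3) by simp
  then have "exp (Re z * t) / exp (\<omega> * t) \<le> M" by (simp add: divide_le_eq)
  then have "exp ((Re z - \<omega>) * t) \<le> M" by (simp add: left_diff_distrib exp_diff)
  moreover have "(Re z - \<omega>) * t = \<bar>M\<bar>" using d by (simp add: t_def)
  ultimately have "exp \<bar>M\<bar> \<le> M" by (simp only:)
  then show False using exp_ge_add_one_self[of "\<bar>M\<bar>"] abs_ge_self[of M] by linarith
qed

lemma finite_growth_bound:
  assumes "\<bar>growth_bound T\<bar> \<noteq> \<infinity>"
  obtains M \<omega> where "\<And>t x. t \<ge> 0 \<Longrightarrow> norm (T t x) \<le> M * exp (\<omega> * t) * norm x"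
proof -
  have "{ereal \<omega> | \<omega>. \<exists>M. \<forall>t\<ge>0. \<forall>x. norm (T t x) \<le> M * exp (\<omega> * t) * norm x} \<noteq> {}"
    using assms unfolding growth_bound_def by (metis Inf_empty abs_ereal.simps(3) top_ereal_def)
  then show ?thesis using that by auto
qed

(* The index set is to stay in the form {1..}. *)
declare One_nat_def [simp del]

section \<open>Formal series along a Riesz basis\<close>

lemma l2_index_product:
  fixes f :: "'m::finite \<Rightarrow> nat \<Rightarrow> complex"
  shows "l2 (UNIV \<times> {1..}) (case_prod f) \<longleftrightarrow> (\<forall>i. l2 {1..} (f i))"
    and "l2 (UNIV \<times> {1..}) (case_prod f) \<Longrightarrow> sqsum (UNIV \<times> {1..}) (case_prod f) = (\<Sum>i\<in>UNIV. sqsum {1..} (f i))"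
proof -
  have eq: "(\<lambda>j. (cmod (case_prod f j))\<^sup>2) = (\<lambda>(i, n). (cmod (f i n))\<^sup>2)" by auto
  show *: "l2 (UNIV \<times> {1..}) (case_prod f) \<longleftrightarrow> (\<forall>i. l2 {1..} (f i))"
  proof
    assume "l2 (UNIV \<times> {1..}) (case_prod f)"
    then show "\<forall>i. l2 {1..} (f i)"
      unfolding l2_def eq using summable_on_SigmaD1[of "\<lambda>i n. (cmod (f i n))\<^sup>2" UNIV "\<lambda>_. {1..}"] by auto
  next
    assume l: "\<forall>i. l2 {1..} (f i)"
    show "l2 (UNIV \<times> {1..}) (case_prod f)"
      unfolding l2_def eq
      by (rule summable_on_SigmaI[where g = "\<lambda>i. sqsum {1..} (f i)"])
         (use l in \<open>auto simp: l2_def sqsum_def\<close>)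
  qed
  show "sqsum (UNIV \<times> {1..}) (case_prod f) = (\<Sum>i\<in>UNIV. sqsum {1..} (f i))"
    if "l2 (UNIV \<times> {1..}) (case_prod f)"
    using infsum_Sigma'_banach[of "\<lambda>i n. (cmod (f i n))\<^sup>2" UNIV "\<lambda>_. {1..}"] that
    unfolding l2_def sqsum_def eq by simp
qed

lemma Hi_iff: "f \<in> Hi s \<longleftrightarrow> f 0 = 0 \<and> l2 {1..} (\<lambda>n. complex_of_real (real n powr s) * f n)"
  and Hi_norm_eq: "Hi_norm s f = sqrt (sqsum {1..} (\<lambda>n. complex_of_real (real n powr s) * f n))"
proof -
  have "(cmod (complex_of_real (real n powr s) * f n))\<^sup>2 = real n powr (2 * s) * (cmod (f n))\<^sup>2" for n
    by (simp add: norm_mult power_mult_distrib power2_eq_square flip: powr_add)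
  then show "f \<in> Hi s \<longleftrightarrow> f 0 = 0 \<and> l2 {1..} (\<lambda>n. complex_of_real (real n powr s) * f n)"
    and "Hi_norm s f = sqrt (sqsum {1..} (\<lambda>n. complex_of_real (real n powr s) * f n))"
    by (simp_all add: Hi_def Hi_norm_def l2_def sqsum_def)
qed

lemma H_0_iff:
  fixes f :: "'m::finite \<Rightarrow> nat \<Rightarrow> complex"
  shows "f \<in> H (\<lambda>_. 0) \<longleftrightarrow> (\<forall>i. f i 0 = 0) \<and> (\<forall>i. l2 {1..} (f i))"
proof -
  have "l2 {1..} (\<lambda>n. complex_of_real (real n powr 0) * f i n) \<longleftrightarrow> l2 {1..} (f i)" for i
    by (rule l2_cong) auto
  then show ?thesis by (auto simp: H_def Hi_iff)
qed

locale riesz_series = riesz_family "UNIV \<times> {1..}" "\<lambda>(i, n). \<phi> i n" cR CR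
  for \<phi> :: "'m::finite \<Rightarrow> nat \<Rightarrow> 'a::complex_hilbert_space" and cR CR
begin

lemma H_0_l2: "f \<in> H (\<lambda>_. 0) \<Longrightarrow> l2 (UNIV \<times> {1..}) (case_prod f)"
  by (simp add: H_0_iff l2_index_product)

lemma term_eq: "(\<lambda>j. (case j of (i, n) \<Rightarrow> f i n) *\<^sub>C (case j of (i, n) \<Rightarrow> \<phi> i n)) = (\<lambda>(i, n). f i n *\<^sub>C \<phi> i n)"
  by auto

lemma series_synth: "series \<phi> f = synth (case_prod f)"
  by (simp add: series_def synth_def term_eq)

lemma coeffs_unique:
  assumes f: "f \<in> H (\<lambda>_. 0)" and x: "synth (case_prod f) = x"
  shows "coeffs \<phi> x = f"
  unfolding coeffs_def
proof (rule the_equality)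
  show "f \<in> H (\<lambda>_. 0) \<and> ((\<lambda>(i, n). f i n *\<^sub>C \<phi> i n) has_sum x) (UNIV \<times> {1..})"
    using f synth_has_sum[OF H_0_l2[OF f]] x by (simp add: term_eq)
  fix g assume g: "g \<in> H (\<lambda>_. 0) \<and> ((\<lambda>(i, n). g i n *\<^sub>C \<phi> i n) has_sum x) (UNIV \<times> {1..})"
  then have "synth (case_prod g) = x" unfolding synth_def term_eq by (simp add: infsumI)
  then have "case_prod g (i, n) = case_prod f (i, n)" if "n \<ge> 1" for i n
    using synth_inj[of "case_prod g" "case_prod f" "(i, n)"] g f x H_0_l2 that by auto
  moreover have "g i 0 = f i 0" for i using f g by (auto simp: H_0_iff)
  ultimately have "g i n = f i n" for i n by (cases n) auto
  then show "g = f" by blast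
qed

lemma coeffs_series: "f \<in> H (\<lambda>_. 0) \<Longrightarrow> coeffs \<phi> (series \<phi> f) = f"
  by (rule coeffs_unique) (simp_all add: series_synth)

lemma coeffs_in_H: "coeffs \<phi> x \<in> H (\<lambda>_. 0)"
  and series_coeffs: "series \<phi> (coeffs \<phi> x) = x"
proof -
  obtain a where a: "l2 (UNIV \<times> {1..}) a" "synth a = x" using synth_surj by blast
  define f where "f = (\<lambda>i n. if n = 0 then 0 else a (i, n))"
  have fa: "case_prod f j = a j" if "j \<in> UNIV \<times> {1..}" for j using that by (auto simp: f_def)
  have "l2 (UNIV \<times> {1..}) (case_prod f)" using a(1) by (subst l2_cong[OF fa])
  then have f: "f \<in> H (\<lambda>_. 0)" by (simp add: H_0_iff l2_index_product f_def)
  have "synth (case_prod f) = synth a" unfolding synth_def by (rule infsum_cong) (simp add: fa)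
  then have "coeffs \<phi> x = f" and "series \<phi> f = x"
    using coeffs_unique[OF f] a(2) by (simp_all add: series_synth)
  with f show "coeffs \<phi> x \<in> H (\<lambda>_. 0)" and "series \<phi> (coeffs \<phi> x) = x" by auto
qed

lemma coeffs_l2: "l2 {1..} (coeffs \<phi> x i)" and coeffs_0: "coeffs \<phi> x i 0 = 0"
  using coeffs_in_H[of x] by (auto simp: H_0_iff)

lemma coeffs_add: "coeffs \<phi> (x + y) = (\<lambda>i n. coeffs \<phi> x i n + coeffs \<phi> y i n)"
proof (rule coeffs_unique)
  show "(\<lambda>i n. coeffs \<phi> x i n + coeffs \<phi> y i n) \<in> H (\<lambda>_. 0)"
    by (simp add: H_0_iff coeffs_l2 coeffs_0 l2_add)
  have "case_prod (\<lambda>i n. coeffs \<phi> x i n + coeffs \<phi> y i n) =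
      (\<lambda>j. case_prod (coeffs \<phi> x) j + case_prod (coeffs \<phi> y) j)" by auto
  then show "synth (case_prod (\<lambda>i n. coeffs \<phi> x i n + coeffs \<phi> y i n)) = x + y"
    using synth_add[OF H_0_l2 H_0_l2, OF coeffs_in_H coeffs_in_H, of x y]
    by (simp add: series_synth[symmetric] series_coeffs)
qed

lemma coeffs_scale: "coeffs \<phi> (z *\<^sub>C x) = (\<lambda>i n. z * coeffs \<phi> x i n)"
proof (rule coeffs_unique)
  show "(\<lambda>i n. z * coeffs \<phi> x i n) \<in> H (\<lambda>_. 0)"
    by (simp add: H_0_iff coeffs_l2 coeffs_0 l2_scale)
  have "case_prod (\<lambda>i n. z * coeffs \<phi> x i n) = (\<lambda>j. z * case_prod (coeffs \<phi> x) j)" by auto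
  then show "synth (case_prod (\<lambda>i n. z * coeffs \<phi> x i n)) = z *\<^sub>C x"
    using synth_scale[OF H_0_l2, OF coeffs_in_H, of z x]
    by (simp add: series_synth[symmetric] series_coeffs)
qed

lemma coeffs_bounds:
  "cR * (\<Sum>i\<in>UNIV. sqsum {1..} (coeffs \<phi> x i)) \<le> (norm x)\<^sup>2"
  "(norm x)\<^sup>2 \<le> CR * (\<Sum>i\<in>UNIV. sqsum {1..} (coeffs \<phi> x i))"
  using synth_bounds[OF H_0_l2[OF coeffs_in_H], of x] l2_index_product(2)[OF H_0_l2[OF coeffs_in_H[of x]]]
  by (simp_all add: series_synth[symmetric] series_coeffs)

end

section \<open>The closed loop\<close>

text \<open>Each component of the feedback acts on the corresponding component of the state only, so that the
closed loop is the direct sum of \<open>CARD('m)\<close> systems with one input.\<close>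

locale multi_input = riesz_series \<phi> cR CR
  for \<phi> :: "'m::finite \<Rightarrow> nat \<Rightarrow> 'a::complex_hilbert_space" and cR CR +
  fixes lam B :: "'m \<Rightarrow> nat \<Rightarrow> complex" and \<alpha> \<gamma> r :: "'m \<Rightarrow> real" and c c1 c2 \<omega> m :: real
    and c' :: "'m \<Rightarrow> real"
  assumes single: "\<And>i. single_input (lam i) (B i) (\<alpha> i) (\<gamma> i) (r i) c c1 c2 \<omega> m (c' i)"
    and B_0: "\<And>i. B i 0 = 0"
begin

sublocale si: single_input "lam i" "B i" "\<alpha> i" "\<gamma> i" "r i" c c1 c2 \<omega> m "c' i" for i
  by (rule single)

definition K :: "('m \<Rightarrow> nat \<Rightarrow> complex) \<Rightarrow> complex ^ 'm" where
  "K f = (\<chi> i. \<Sum>\<^sub>\<infinity>n\<in>{1..}. si.k i n * f i n)"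

lemma K_nth: "K f $ i = (\<Sum>\<^sub>\<infinity>n\<in>{1..}. si.k i n * f i n)"
  by (simp add: K_def)

lemma H_pairing:
  assumes s: "\<And>i. s i > 1 / 2 - r i" and f: "f \<in> H s"
  shows "(\<lambda>n. cmod (si.k i n * f i n)) summable_on {1..}" and "(\<lambda>n. si.k i n * f i n) summable_on {1..}"
    and "cmod (K f $ i) \<le> si.weight_bd i / c1 *
      sqrt (sqsum {1..} (\<lambda>p. complex_of_real (real p powr (- r i - s i)))) * Hi_norm (s i) (f i)"
proof -
  have fi: "l2 {1..} (\<lambda>n. complex_of_real (real n powr s i) * f i n)"
    using f by (auto simp: H_def Hi_iff)
  note bd = weighted_pairing_summable[OF si.k_bound s fi]
  show 1: "(\<lambda>n. cmod (si.k i n * f i n)) summable_on {1..}" by (rule bd(1))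
  then show "(\<lambda>n. si.k i n * f i n) summable_on {1..}" by (rule Infinite_Sum.abs_summable_summable)
  have "cmod (K f $ i) \<le> (\<Sum>\<^sub>\<infinity>n\<in>{1..}. cmod (si.k i n * f i n))"
    unfolding K_nth by (rule norm_infsum_bound[OF 1])
  with bd(2) show "cmod (K f $ i) \<le> si.weight_bd i / c1 *
      sqrt (sqsum {1..} (\<lambda>p. complex_of_real (real p powr (- r i - s i)))) * Hi_norm (s i) (f i)"
    unfolding Hi_norm_eq by (simp add: mult.assoc)
qed

lemma Hi_norm_le_H_norm: "Hi_norm (s i) (f i) \<le> H_norm s f"
  unfolding H_norm_def
  by (rule real_le_rsqrt, rule member_le_sum[of i UNIV "\<lambda>i. (Hi_norm (s i) (f i))\<^sup>2"]) auto

lemma K_bounded_linear: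
  assumes s: "\<And>i. s i > 1 / 2 - r i"
  shows "bounded_linear_on_H s K"
  unfolding bounded_linear_on_H_def
proof (intro conjI ballI allI)
  show "K (\<lambda>i n. f i n + g i n) = K f + K g" if "f \<in> H s" "g \<in> H s" for f g
    by (simp add: vec_eq_iff K_nth distrib_left infsum_add H_pairing(2)[OF s] that)
  show "K (\<lambda>i n. z * f i n) = z *s K f" for z f
    by (simp add: vec_eq_iff K_nth mult.left_commute[of _ z] infsum_cmult_right')
  define L where "L i = si.weight_bd i / c1 *
      sqrt (sqsum {1..} (\<lambda>p. complex_of_real (real p powr (- r i - s i))))" for i
  have L: "L i \<ge> 0" for i
    using si.weight_bd(1)[of i] si.c1 by (simp add: L_def)
  show "\<exists>M. \<forall>f\<in>H s. norm (K f) \<le> M * H_norm s f"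
  proof (intro exI ballI)
    fix f assume f: "f \<in> H s"
    have "norm (K f) \<le> (\<Sum>i\<in>UNIV. cmod (K f $ i))"
      unfolding norm_vec_def by (rule L2_set_le_sum) auto
    also have "\<dots> \<le> (\<Sum>i\<in>UNIV. L i * H_norm s f)"
    proof (rule sum_mono)
      fix i
      have "cmod (K f $ i) \<le> L i * Hi_norm (s i) (f i)" unfolding L_def by (rule H_pairing(3)[OF s f])
      also have "\<dots> \<le> L i * H_norm s f" by (rule mult_left_mono[OF Hi_norm_le_H_norm L])
      finally show "cmod (K f $ i) \<le> L i * H_norm s f" .
    qed
    finally show "norm (K f) \<le> (\<Sum>i\<in>UNIV. L i) * H_norm s f" by (simp add: sum_distrib_right)
  qed
qed

text \<open>The coordinates along the Riesz basis of eigenvectors of the closed loop.\<close>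

definition U :: "'a \<Rightarrow> 'm \<times> nat \<Rightarrow> complex" where
  "U x = (\<lambda>(i, n). mat_app {1..} (si.X i) (coeffs \<phi> x i) n)"

definition V :: "('m \<times> nat \<Rightarrow> complex) \<Rightarrow> 'a" where
  "V g = series \<phi> (\<lambda>i n. if n = 0 then 0 else mat_app {1..} (si.Psi i) (\<lambda>n. g (i, n)) n)"

text \<open>A common bound for the finitely many blocks of a block diagonal matrix.\<close>

lemma schur_family_bound:
  assumes "\<And>i. \<exists>M. schur {1..} (\<lambda>n. real n powr (- 1 / 2)) M (A i)"
  shows "\<exists>b>0. \<forall>f. (\<forall>i. l2 {1..} (f i)) \<longrightarrow>
    (\<Sum>i\<in>UNIV. sqsum {1..} (mat_app {1..} (A i) (f i))) \<le> b * (\<Sum>i\<in>(UNIV :: 'm set). sqsum {1..} (f i))"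
proof -
  obtain M where M: "\<And>i. schur {1..} (\<lambda>n. real n powr (- 1 / 2)) (M i) (A i)" using assms by metis
  define b where "b = 1 + (\<Sum>i\<in>UNIV. (M i)\<^sup>2)"
  have b: "(M i)\<^sup>2 \<le> b" for i
    using member_le_sum[of i UNIV "\<lambda>i. (M i)\<^sup>2"] by (simp add: b_def)
  have "(\<Sum>i\<in>UNIV. sqsum {1..} (mat_app {1..} (A i) (f i))) \<le> b * (\<Sum>i\<in>UNIV. sqsum {1..} (f i))"
    if f: "\<forall>i. l2 {1..} (f i)" for f
    unfolding sum_distrib_left
  proof (rule sum_mono)
    fix i
    have "sqsum {1..} (mat_app {1..} (A i) (f i)) \<le> (M i)\<^sup>2 * sqsum {1..} (f i)"
      using schur_l2(2)[OF M] f by blast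
    also have "\<dots> \<le> b * sqsum {1..} (f i)" by (intro mult_right_mono b) simp
    finally show "sqsum {1..} (mat_app {1..} (A i) (f i)) \<le> b * sqsum {1..} (f i)" .
  qed
  moreover have "b > 0" unfolding b_def by (intro add_pos_nonneg sum_nonneg) auto
  ultimately show ?thesis by blast
qed

lemma X_l2: "l2 {1..} f \<Longrightarrow> l2 {1..} (mat_app {1..} (si.X i) f)"
  and Psi_l2: "l2 {1..} f \<Longrightarrow> l2 {1..} (mat_app {1..} (si.Psi i) f)"
  using si.X_schur[of i] si.Psi_schur[of i] schur_l2(1) by blast+

lemma coordinates: "\<exists>a b. coordinates (UNIV \<times> {1..}) U V a b"
proof -
  obtain bX where bX: "bX > 0" "\<And>f. (\<And>i. l2 {1..} (f i)) \<Longrightarrow>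
      (\<Sum>i\<in>UNIV. sqsum {1..} (mat_app {1..} (si.X i) (f i))) \<le> bX * (\<Sum>i\<in>UNIV. sqsum {1..} (f i))"
    using schur_family_bound[of si.X] si.X_schur by auto
  obtain bP where bP: "bP > 0" "\<And>f. (\<And>i. l2 {1..} (f i)) \<Longrightarrow>
      (\<Sum>i\<in>UNIV. sqsum {1..} (mat_app {1..} (si.Psi i) (f i))) \<le> bP * (\<Sum>i\<in>UNIV. sqsum {1..} (f i))"
    using schur_family_bound[of si.Psi] si.Psi_schur by auto
  have U_l2: "l2 (UNIV \<times> {1..}) (U x)" for x
    unfolding U_def l2_index_product by (simp add: X_l2 coeffs_l2)
  have U_sq: "sqsum (UNIV \<times> {1..}) (U x) = (\<Sum>i\<in>UNIV. sqsum {1..} (mat_app {1..} (si.X i) (coeffs \<phi> x i)))" for x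
    using l2_index_product(2)[of "\<lambda>i n. mat_app {1..} (si.X i) (coeffs \<phi> x i) n"] U_l2[of x]
    by (simp add: U_def)
  have "coordinates (UNIV \<times> {1..}) U V (CR * bP) (bX / cR)"
  proof
    show "l2 (UNIV \<times> {1..}) (U x)" for x by (rule U_l2)
    show "U (x + y) j = U x j + U y j" if jJ: "j \<in> UNIV \<times> {1..}" for x y j
    proof -
      obtain i n where j: "j = (i, n)" "n \<in> {1..}" using jJ by (cases j) auto
      obtain M where "schur {1..} (\<lambda>n. real n powr (- 1 / 2)) M (si.X i)" using si.X_schur by blast
      from mat_app_add[OF this coeffs_l2[of x i] coeffs_l2[of y i] j(2)]
      show ?thesis by (simp add: U_def j coeffs_add)
    qed
    show "U (z *\<^sub>C x) j = z * U x j" if "j \<in> UNIV \<times> {1..}" for z x j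
      by (cases j) (simp add: U_def coeffs_scale mat_app_scale)
    show "CR * bP > 0" "bX / cR > 0" using C c bX bP by auto
    show "sqsum (UNIV \<times> {1..}) (U x) \<le> bX / cR * (norm x)\<^sup>2" for x
    proof -
      have "sqsum (UNIV \<times> {1..}) (U x) \<le> bX * (\<Sum>i\<in>UNIV. sqsum {1..} (coeffs \<phi> x i))"
        unfolding U_sq by (rule bX(2)) (rule coeffs_l2)
      also have "\<dots> \<le> bX * ((norm x)\<^sup>2 / cR)"
        using coeffs_bounds(1)[of x] c bX by (intro mult_left_mono) (auto simp: field_simps)
      finally show ?thesis by simp
    qed
    show "(norm x)\<^sup>2 \<le> CR * bP * sqsum (UNIV \<times> {1..}) (U x)" for x
    proof -
      have "(norm x)\<^sup>2 \<le> CR * (\<Sum>i\<in>UNIV. sqsum {1..} (coeffs \<phi> x i))" by (rule coeffs_bounds(2))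
      also have "(\<Sum>i\<in>UNIV. sqsum {1..} (coeffs \<phi> x i)) =
          (\<Sum>i\<in>UNIV. sqsum {1..} (mat_app {1..} (si.Psi i) (mat_app {1..} (si.X i) (coeffs \<phi> x i))))"
        by (intro sum.cong refl sqsum_cong) (simp add: si.Psi_mat_X coeffs_l2)
      also have "CR * \<dots> \<le> CR * (bP * sqsum (UNIV \<times> {1..}) (U x))"
        unfolding U_sq using C by (intro mult_left_mono bP(2) X_l2 coeffs_l2) auto
      finally show ?thesis by simp
    qed
    show "U (V g) j = g j" if g: "l2 (UNIV \<times> {1..}) g" and j: "j \<in> UNIV \<times> {1..}" for g j
    proof -
      obtain i n where j: "j = (i, n)" "n \<ge> 1" using j by (cases j) auto
      have gi: "l2 {1..} (\<lambda>n. g (i, n))" for i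
        using g l2_index_product(1)[of "\<lambda>i n. g (i, n)"] by (simp add: case_prod_unfold)
      define f where "f = (\<lambda>i n. if n = 0 then 0 else mat_app {1..} (si.Psi i) (\<lambda>n. g (i, n)) n)"
      have fi: "f i n = mat_app {1..} (si.Psi i) (\<lambda>n. g (i, n)) n" if "n \<in> {1..}" for i n
        using that by (auto simp: f_def)
      have "l2 {1..} (f i)" for i using Psi_l2[OF gi] by (subst l2_cong[OF fi])
      then have "f \<in> H (\<lambda>_. 0)" by (simp add: H_0_iff f_def)
      then have "coeffs \<phi> (V g) = f" unfolding V_def f_def[symmetric] by (rule coeffs_series)
      then have "U (V g) j = mat_app {1..} (si.X i) (f i) n" by (simp add: U_def j)
      also have "\<dots> = mat_app {1..} (si.X i) (mat_app {1..} (si.Psi i) (\<lambda>n. g (i, n))) n"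
        unfolding mat_app_def[of _ "si.X i"] by (rule infsum_cong) (simp add: fi)
      also have "\<dots> = g j" using si.X_mat_Psi[OF gi j(2)] j by simp
      finally show ?thesis .
    qed
  qed
  then show ?thesis by blast
qed

definition feedback_space :: "('m \<Rightarrow> nat \<Rightarrow> complex) set" where
  "feedback_space = (\<Union>\<epsilon>\<in>{0<..}. H (\<lambda>i. 1 / 2 + \<epsilon> - r i))"

lemma feedback_space_pairing: "f \<in> feedback_space \<Longrightarrow> (\<lambda>n. cmod (si.k i n * f i n)) summable_on {1..}"
  unfolding feedback_space_def by (auto intro: H_pairing(1)[rotated])

abbreviation "domain \<equiv> closed_loop_domain \<phi> lam B feedback_space K"
abbreviation "operator \<equiv> closed_loop_op \<phi> lam B K"

lemma closed_loop_coeffs_eq: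
  "closed_loop_coeffs lam B K f i n = lam i n * f i n + B i n * (\<Sum>\<^sub>\<infinity>n\<in>{1..}. si.k i n * f i n)"
  by (simp add: closed_loop_coeffs_def diag_op_def K_nth)

lemma coeffs_operator: "x \<in> domain \<Longrightarrow> coeffs \<phi> (operator x) = closed_loop_coeffs lam B K (coeffs \<phi> x)"
  unfolding closed_loop_domain_def closed_loop_op_def by (simp add: coeffs_series)

lemma U_operator:
  assumes x: "x \<in> domain" and n: "n \<ge> 1"
  shows "U (operator x) (i, n) = si.nu i n * U x (i, n)"
proof -
  let ?h = "\<lambda>p. lam i p * coeffs \<phi> x i p + B i p * (\<Sum>\<^sub>\<infinity>q\<in>{1..}. si.k i q * coeffs \<phi> x i q)"
  have "coeffs \<phi> x \<in> feedback_space" "closed_loop_coeffs lam B K (coeffs \<phi> x) \<in> H (\<lambda>_. 0)"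
    using x by (auto simp: closed_loop_domain_def)
  moreover have e: "closed_loop_coeffs lam B K (coeffs \<phi> x) i = ?h"
    by (rule ext) (rule closed_loop_coeffs_eq)
  ultimately have "si.nu i n * mat_app {1..} (si.X i) (coeffs \<phi> x i) n = mat_app {1..} (si.X i) ?h n"
    by (intro si.X_diagonalises coeffs_l2 feedback_space_pairing n) (auto simp: H_0_iff simp flip: e)
  then show ?thesis by (simp add: U_def coeffs_operator[OF x] e)
qed

text \<open>The two parts \<open>h p / (z - lam p)\<close> and \<open>b p / (z - lam p)\<close> of the solution lie in \<open>feedback_space\<close> for
\<open>\<epsilon> < \<alpha> i - 1/2 + r i\<close> and \<open>\<epsilon> < \<alpha> i - 1 - \<gamma> i\<close> respectively; a minimum over \<open>i\<close> satisfies both for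
all components.\<close>

lemma resolvent_surj:
  assumes z: "Re z > \<omega>"
  shows "\<exists>x\<in>domain. operator x = z *\<^sub>C x - y"
proof -
  define h where "h = coeffs \<phi> y"
  define f where "f = (\<lambda>i n. if n = 0 then 0 else si.resolvent i z (h i) n)"
  have h: "l2 {1..} (h i)" "h i 0 = 0" for i by (auto simp: h_def coeffs_l2 coeffs_0)
  have fi: "f i n = si.resolvent i z (h i) n" if "n \<in> {1..}" for i n using that by (auto simp: f_def)
  have weighted: "l2 {1..} (\<lambda>n. complex_of_real (real n powr s) * f i n)"
    if "s \<le> \<alpha> i" "s + r i + \<gamma> i - \<alpha> i < - 1 / 2" for s i
    using si.resolvent_l2[OF z h(1) that]
    by (subst l2_cong[where g = "\<lambda>n. complex_of_real (real n powr s) * si.resolvent i z (h i) n"])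
       (auto simp: fi si.resolvent_def)
  have "f \<in> H (\<lambda>_. 0)"
    unfolding H_def Hi_iff mem_Collect_eq
  proof (intro allI conjI)
    show "l2 {1..} (\<lambda>n. complex_of_real (real n powr 0) * f i n)" for i
      by (rule weighted) (use si.al[of i] si.r[of i] in auto)
  qed (simp add: f_def)
  then have cf: "coeffs \<phi> (series \<phi> f) = f" by (rule coeffs_series)
  define \<epsilon> where "\<epsilon> = Min (range (\<lambda>i. min (\<alpha> i - 1 / 2 + r i) (\<alpha> i - 1 - \<gamma> i))) / 2"
  have "min (\<alpha> i - 1 / 2 + r i) (\<alpha> i - 1 - \<gamma> i) > 0" for i
    using si.ga[of i] si.r[of i] by auto
  then have e0: "Min (range (\<lambda>i. min (\<alpha> i - 1 / 2 + r i) (\<alpha> i - 1 - \<gamma> i))) > 0"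
    by (subst Min_gr_iff) auto
  have ei: "\<epsilon> < min (\<alpha> i - 1 / 2 + r i) (\<alpha> i - 1 - \<gamma> i)" for i
  proof -
    have "Min (range (\<lambda>i. min (\<alpha> i - 1 / 2 + r i) (\<alpha> i - 1 - \<gamma> i))) \<le> min (\<alpha> i - 1 / 2 + r i) (\<alpha> i - 1 - \<gamma> i)"
      by (rule Min_le) auto
    with e0 show ?thesis unfolding \<epsilon>_def by linarith
  qed
  have "f \<in> H (\<lambda>i. 1 / 2 + \<epsilon> - r i)"
    unfolding H_def Hi_iff mem_Collect_eq
  proof (intro allI conjI)
    show "l2 {1..} (\<lambda>n. complex_of_real (real n powr (1 / 2 + \<epsilon> - r i)) * f i n)" for i
      by (rule weighted) (use ei[of i] in auto)
  qed (simp add: f_def)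
  moreover have "\<epsilon> > 0" using e0 by (simp add: \<epsilon>_def)
  ultimately have feedback_space: "f \<in> feedback_space" by (auto simp: feedback_space_def)
  have clc: "closed_loop_coeffs lam B K f = (\<lambda>i n. z * f i n - h i n)"
  proof (intro ext)
    fix i n
    have "(\<Sum>\<^sub>\<infinity>q\<in>{1..}. si.k i q * f i q) = (\<Sum>\<^sub>\<infinity>q\<in>{1..}. si.k i q * si.resolvent i z (h i) q)"
      by (rule infsum_cong) (simp add: fi)
    then show "closed_loop_coeffs lam B K f i n = z * f i n - h i n"
      using si.resolvent_equation[OF z h(1), of n i] B_0[of i] h(2)[of i]
      unfolding closed_loop_coeffs_eq by (cases "n = 0") (simp_all add: f_def)
  qed
  have H0: "(\<lambda>i n. z * f i n - h i n) \<in> H (\<lambda>_. 0)"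
    using \<open>f \<in> H (\<lambda>_. 0)\<close> h by (auto simp: H_0_iff intro!: l2_diff l2_scale)
  then have dom: "series \<phi> f \<in> domain" using feedback_space clc cf by (simp add: closed_loop_domain_def)
  have "coeffs \<phi> (z *\<^sub>C series \<phi> f - y) = (\<lambda>i n. z * f i n - h i n)"
  proof -
    have "z *\<^sub>C series \<phi> f - y = z *\<^sub>C series \<phi> f + (-1) *\<^sub>C y"
      by (simp add: complex_vector.scale_minus_left)
    then show ?thesis by (simp only: coeffs_add coeffs_scale cf h_def) simp
  qed
  moreover have "coeffs \<phi> (operator (series \<phi> f)) = (\<lambda>i n. z * f i n - h i n)"
    by (simp add: coeffs_operator[OF dom] cf clc)
  ultimately have "operator (series \<phi> f) = z *\<^sub>C series \<phi> f - y" by (metis series_coeffs)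
  with dom show ?thesis by blast
qed

text \<open>The closed loop operator is contained in the diagonal operator in the coordinates \<open>U\<close>.  For \<open>z\<close> to
the right of the spectrum, \<open>z\<close> minus the former is onto and \<open>z\<close> minus the latter is injective, so
their domains coincide.  In this way no regularity of the series over the eigenvectors has to be
proved.\<close>

lemma domain_eq: "domain = {x. l2 (UNIV \<times> {1..}) (\<lambda>(i, n). si.nu i n * U x (i, n))}"
proof -
  obtain a b where "coordinates (UNIV \<times> {1..}) U V a b" using coordinates by blast
  then interpret coordinates "UNIV \<times> {1..}" U V a b .
  show ?thesis
  proof (intro equalityI subsetI CollectI)
    fix x assume x: "x \<in> domain"
    have e: "U (operator x) j = (case j of (i, n) \<Rightarrow> si.nu i n * U x (i, n))" if "j \<in> UNIV \<times> {1..}" for j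
      using that U_operator[OF x] by auto
    from U_l2[of "operator x"]
    show "l2 (UNIV \<times> {1..}) (\<lambda>(i, n). si.nu i n * U x (i, n))" by (subst (asm) l2_cong[OF e])
  next
    fix x assume "x \<in> {x. l2 (UNIV \<times> {1..}) (\<lambda>(i, n). si.nu i n * U x (i, n))}"
    then have x: "l2 (UNIV \<times> {1..}) (\<lambda>(i, n). si.nu i n * U x (i, n))" by simp
    define y where "y = V (\<lambda>(i, n). si.nu i n * U x (i, n))"
    define z where "z = complex_of_real (\<omega> + 1)"
    have z: "Re z > \<omega>" by (simp add: z_def)
    obtain x' where x': "x' \<in> domain" "operator x' = z *\<^sub>C x' - (z *\<^sub>C x - y)"
      using resolvent_surj[OF z] by blast
    have "U x j = U x' j" if j: "j \<in> UNIV \<times> {1..}" for j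
    proof -
      obtain i n where jn: "j = (i, n)" "n \<ge> 1" using j by (cases j) auto
      have "si.nu i n * U x' j = z * U x' j - (z * U x j - si.nu i n * U x j)"
        using U_operator[OF x'(1) jn(2), of i] U_V[OF x j] j
        unfolding x'(2) by (simp add: U_diff U_scale y_def jn)
      then have "(z - si.nu i n) * (U x j - U x' j) = 0" by (simp add: algebra_simps)
      then show ?thesis using si.resolvent_nonzero(2)[OF z jn(2), of i] by simp
    qed
    then have "x = x'" by (rule U_inject)
    then show "x \<in> domain" using x'(1) by simp
  qed
qed

lemma closed_loop_stable:
  assumes \<mu>: "\<mu> > 0" "\<omega> + \<mu> \<le> m"
  shows "exponentially_stable domain operator \<mu>"
proof -
  obtain a b where ab: "coordinates (UNIV \<times> {1..}) U V a b" using coordinates by blast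
  have "diagonalised (UNIV \<times> {1..}) U V a b (\<lambda>(i, n). si.nu i n) \<mu> domain operator"
  proof (intro diagonalised.intro ab diagonalised_axioms.intro)
    show "\<mu> > 0" by (rule \<mu>(1))
    show "Re (case j of (i, n) \<Rightarrow> si.nu i n) \<le> - \<mu>" if "j \<in> UNIV \<times> {1..}" for j
    proof (cases j)
      case (Pair i n)
      then have "Re (lam i n) \<le> \<omega>" using that si.Re_lam[of n i] by auto
      then show ?thesis using \<mu>(2) by (simp add: Pair si.nu_def)
    qed
    show "domain = {x. l2 (UNIV \<times> {1..}) (\<lambda>j. (case j of (i, n) \<Rightarrow> si.nu i n) * U x j)}"
      unfolding domain_eq by (simp add: case_prod_unfold)
    show "U (operator x) j = (case j of (i, n) \<Rightarrow> si.nu i n) * U x j"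
      if "x \<in> domain" "j \<in> UNIV \<times> {1..}" for x j
      using that U_operator by auto
  qed
  then show ?thesis by (rule diagonalised.exponentially_stable)
qed

end

text \<open>The forbidden shifts form a countable set.\<close>

lemma exists_generic_shift:
  fixes lam :: "'m::finite \<Rightarrow> nat \<Rightarrow> complex"
  shows "\<exists>m>x. \<forall>i n p. lam i n - complex_of_real m \<noteq> lam i p"
proof -
  define S where "S = range (\<lambda>(i, n, p). Re (lam i n - lam i p))"
  have "countable S" unfolding S_def by (intro countable_image) simp
  moreover have "uncountable {x<..<x + 1}" by (simp add: uncountable_open_interval)
  ultimately have "{x<..<x + 1} - S \<noteq> {}" using uncountable_minus_countable by (metis countable_empty)
  then obtain m where "m \<in> {x<..<x + 1} - S" by blast
  then have m: "m > x" "m \<notin> S" by auto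
  have "lam i n - complex_of_real m \<noteq> lam i p" for i n p
  proof
    assume "lam i n - complex_of_real m = lam i p"
    then have "m = Re (lam i n - lam i p)" by (metis Re_complex_of_real diff_diff_eq2 add_diff_cancel_left' diff_add_cancel)
    moreover have "Re (lam i n - lam i p) \<in> S"
      unfolding S_def by (rule range_eqI[of _ _ "(i, n, p)"]) simp
    ultimately show False using m(2) by simp
  qed
  with m(1) show ?thesis by blast
qed

theorem corollary3p5:
  fixes D :: "'a::complex_hilbert_space set" and A :: "'a \<Rightarrow> 'a"
    and \<phi> :: "'m::finite \<Rightarrow> nat \<Rightarrow> 'a" and lam :: "'m \<Rightarrow> nat \<Rightarrow> complex"
    and \<alpha> \<gamma> r :: "'m \<Rightarrow> real" and B :: "'m \<Rightarrow> nat \<Rightarrow> complex"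
    and c C c1 c2 :: real
  assumes "\<exists>T. generates D A T \<and> \<bar>growth_bound T\<bar> \<noteq> \<infinity>"
    and "diagonalizable D A \<phi> lam"
    and "\<And>i. \<alpha> i > 1" and "c > 0" and "C > 0"
    and "\<And>i n. n \<ge> 1 \<Longrightarrow>
           c * real n powr \<alpha> i \<le> cmod (lam i n) + 1 \<and> cmod (lam i n) + 1 \<le> C * real n powr \<alpha> i"
    and "\<And>i n p. n \<ge> 1 \<Longrightarrow> p \<ge> 1 \<Longrightarrow>
           cmod (lam i n - lam i p) \<ge> c * real n powr (\<alpha> i - 1) * \<bar>real n - real p\<bar>"
    and "\<And>i. 0 \<le> \<gamma> i \<and> \<gamma> i < (\<alpha> i - 1) / 2"
    and "\<And>i. 1 / 2 - \<alpha> i + \<gamma> i < r i \<and> r i < \<alpha> i - 1 / 2 - \<gamma> i"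
    and "\<And>i. B i \<in> Hi (- \<alpha> i)"
    and "c1 > 0" and "c2 > 0"
    and "\<And>i n. n \<ge> 1 \<Longrightarrow>
           c1 * real n powr r i \<le> cmod (B i n) \<and> cmod (B i n) \<le> c2 * real n powr (r i + \<gamma> i)"
  shows "\<forall>\<mu>>0. \<exists>K :: ('m \<Rightarrow> nat \<Rightarrow> complex) \<Rightarrow> complex ^ 'm.
           bounded_linear_on_H (\<lambda>i. \<alpha> i / 2 - r i) K \<and>
           (\<forall>\<epsilon>>0. bounded_linear_on_H (\<lambda>i. 1 / 2 + \<epsilon> - r i) K) \<and>
           exponentially_stable
             (closed_loop_domain \<phi> lam B (\<Union>\<epsilon>\<in>{0<..}. H (\<lambda>i. 1 / 2 + \<epsilon> - r i)) K)
             (closed_loop_op \<phi> lam B K) \<mu>"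
proof (intro allI impI)
  fix \<mu> :: real assume \<mu>: "\<mu> > 0"
  have riesz: "riesz_basis (UNIV \<times> {1..}) (\<lambda>(i, n). \<phi> i n)"
    and eig: "\<And>i n. n \<ge> 1 \<Longrightarrow> \<phi> i n \<in> eigenspace D A (lam i n)"
    using assms(2) unfolding diagonalizable_def by blast+
  obtain cR CR where family: "riesz_family (UNIV \<times> {1..}) (\<lambda>(i, n). \<phi> i n) cR CR"
    using riesz_basis_family[OF riesz] by blast
  have \<phi>_nonzero: "\<phi> i n \<noteq> 0" if "n \<ge> 1" for i n
  proof
    assume "\<phi> i n = 0"
    then have "cR \<le> 0"
      using riesz_family.lower[OF family, of "{(i, n)}" "\<lambda>_. 1"] that by simp
    then show False using riesz_family.c[OF family] by simp
  qed
  obtain T where T: "generates D A T" "\<bar>growth_bound T\<bar> \<noteq> \<infinity>"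
    using assms(1) by (elim exE conjE)
  obtain M \<omega> where bd: "\<And>t x. t \<ge> 0 \<Longrightarrow> norm (T t x) \<le> M * exp (\<omega> * t) * norm x"
    by (rule finite_growth_bound[OF T(2)]) (rule that)
  have Re_lam: "Re (lam i n) \<le> \<omega>" if "n \<ge> 1" for i n
  proof (rule generator_eigenvalue_Re_le[OF T(1) _ _ \<phi>_nonzero[OF that]])
    show "\<phi> i n \<in> D" "A (\<phi> i n) = lam i n *\<^sub>C \<phi> i n"
      using eig[OF that] by (simp_all add: eigenspace_def)
  qed (rule bd)
  obtain m where m: "m > max 0 (\<omega> + \<mu>)" and generic: "\<And>i n p. lam i n - complex_of_real m \<noteq> lam i p"
    using exists_generic_shift[of "max 0 (\<omega> + \<mu>)" lam] by (elim exE conjE) simp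
  define gap_const where "gap_const i c' \<longleftrightarrow> c' > 0 \<and> (\<forall>n\<ge>1. \<forall>p\<ge>1. n \<noteq> p \<longrightarrow>
     c' * real (max n p) powr (\<alpha> i - 1) * \<bar>real n - real p\<bar> \<le> cmod (lam i p - (lam i n - complex_of_real m)))"
    for i c'
  have "\<exists>c'. gap_const i c'" for i
    unfolding gap_const_def by (rule shifted_gap[OF assms(3,4) _ assms(7)]) (use m generic in auto)
  then obtain c' where c': "\<And>i. gap_const i (c' i)" by metis
  have "multi_input \<phi> cR CR lam B \<alpha> \<gamma> r c c1 c2 \<omega> m c'"
  proof (intro multi_input.intro riesz_series.intro family multi_input_axioms.intro)
    show "B i 0 = 0" for i using assms(10)[of i] by (simp add: Hi_def)
    show "single_input (lam i) (B i) (\<alpha> i) (\<gamma> i) (r i) c c1 c2 \<omega> m (c' i)" for i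
    proof
      show "\<gamma> i < \<alpha> i - 1" using assms(3)[of i] assms(8)[of i] by auto
    qed (use assms m c'[of i] generic Re_lam in \<open>auto simp: gap_const_def\<close>)
  qed
  then interpret multi_input \<phi> cR CR lam B \<alpha> \<gamma> r c c1 c2 \<omega> m c' .
  show "\<exists>K :: ('m \<Rightarrow> nat \<Rightarrow> complex) \<Rightarrow> complex ^ 'm.
           bounded_linear_on_H (\<lambda>i. \<alpha> i / 2 - r i) K \<and>
           (\<forall>\<epsilon>>0. bounded_linear_on_H (\<lambda>i. 1 / 2 + \<epsilon> - r i) K) \<and>
           exponentially_stable
             (closed_loop_domain \<phi> lam B (\<Union>\<epsilon>\<in>{0<..}. H (\<lambda>i. 1 / 2 + \<epsilon> - r i)) K)
             (closed_loop_op \<phi> lam B K) \<mu>"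
  proof (intro exI[of _ K] conjI allI impI)
    show "bounded_linear_on_H (\<lambda>i. \<alpha> i / 2 - r i) K"
      by (rule K_bounded_linear) (use assms(3) in auto)
    show "bounded_linear_on_H (\<lambda>i. 1 / 2 + \<epsilon> - r i) K" if "\<epsilon> > 0" for \<epsilon>
      by (rule K_bounded_linear) (use that in auto)
    show "exponentially_stable
             (closed_loop_domain \<phi> lam B (\<Union>\<epsilon>\<in>{0<..}. H (\<lambda>i. 1 / 2 + \<epsilon> - r i)) K)
             (closed_loop_op \<phi> lam B K) \<mu>"
      using closed_loop_stable[OF \<mu>] m by (simp add: feedback_space_def)
  qed
qed

end
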